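(* Let $K$ be a quadratic field and let $E/K$ be a $\mathbb{Q}$-curve without complex multiplication that is not strongly modular over $K$, i.e. such that, for $\nu$ the non-trivial automorphism of $K$, there exists an isogeny $\mu_\nu\colon{}^\nu E\to E$ that cannot be defined over $K$. Then the minimal field of complete definition $L$ of $E$ is Galois over $\mathbb{Q}$ with Galois group isomorphic to $C_2\times C_2$.
   Context: All number fields are inside a fixed algebraic closure $\overline{\mathbb{Q}}$ of $\mathbb{Q}$. For a Galois number field $F$, an elliptic curve $C/F$ is a $\mathbb{Q}$-curve if for every $\sigma\in\mathrm{Gal}(F/\mathbb{Q})$ there is a $\overline{\mathbb{Q}}$-isogeny ${}^\sigma C\to C$; it is completely defined over $F$ if all $\overline{\mathbb{Q}}$-isogenies between its conjugates ${}^\sigma C$ are defined over $F$. A $\mathbb{Q}$-curve $C$ over a number field $F$ is strongly modular if $L(C/F,s)$ is a product of $L$-functions of holomorphic newforms of weight $2$ for groups $\Gamma_1(N)$. Minimal field of complete definition: write $E\colon y^2=x^3+Ax+B$ with $A,B\in K$, and for each $\sigma\in\mathrm{Gal}(K/\mathbb{Q})$ choose a $\overline{\mathbb{Q}}$-isogeny $\mu_\sigma\colon{}^\sigma E\to E$. Then $\mu_\sigma(x,y)=\bigl(F_\sigma(x),\tfrac{1}{\lambda_\sigma}yF_\sigma'(x)\bigr)$ for some $F_\sigma\in K(x)$ and $\lambda_\sigma\in\overline{\mathbb{Q}}^\times$ with $\lambda_\sigma^2\in K^\times$. The minimal field of complete definition of $E/K$ is $L=K(\lambda_\sigma\colon\sigma\in\mathrm{Gal}(K/\mathbb{Q}))$;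 it is the smallest Galois extension of $\mathbb{Q}$ containing $K$ over which $E$ becomes completely defined. *)

theory Defs
  imports "HOL-Algebra.Algebra" "HOL-Algebra.Algebraic_Closure_Type"
begin

section \<open>Number fields inside a fixed algebraic closure of the rationals\<close>

type_synonym qbar = "rat alg_closure"

abbreviation qbar_ring :: "qbar ring" where
  "qbar_ring \<equiv> ring_of_type_algebra"

definition number_field :: "qbar set \<Rightarrow> bool" where
  "number_field F \<longleftrightarrow> subfield F qbar_ring \<and> ring.finite_dimension qbar_ring \<rat> F"

definition quadratic_field :: "qbar set \<Rightarrow> bool" where
  "quadratic_field F \<longleftrightarrow> subfield F qbar_ring \<and> ring.dimension qbar_ring 2 \<rat> F"

text \<open>
  The group of field automorphisms of \<open>F\<close>, as functions that are \<open>undefined\<close> outside \<open>F\<close>. They fix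
  the rationals automatically, so for \<open>F\<close> Galois this is the Galois group of \<open>F\<close> over the rationals.
\<close>
definition gal_group :: "qbar set \<Rightarrow> (qbar \<Rightarrow> qbar) monoid" where
  "gal_group F = BijGroup F
     \<lparr>carrier := Bij F \<inter> ring_hom (qbar_ring\<lparr>carrier := F\<rparr>) (qbar_ring\<lparr>carrier := F\<rparr>)\<rparr>"

definition galois_number_field :: "qbar set \<Rightarrow> bool" where
  "galois_number_field F \<longleftrightarrow>
     number_field F \<and> {x \<in> F. \<forall>\<sigma>\<in>carrier (gal_group F). \<sigma> x = x} = \<rat>"


section \<open>Elliptic curves and their points over the algebraic closure\<close>

text \<open>\<open>Weierstrass a b\<close> stands for \<open>y^2 = x^3 + a x + b\<close>.\<close>
datatype 'a weierstrass = Weierstrass (coeff_a: 'a) (coeff_b: 'a)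

definition elliptic_curve_over :: "qbar set \<Rightarrow> qbar weierstrass \<Rightarrow> bool" where
  "elliptic_curve_over F E \<longleftrightarrow>
     coeff_a E \<in> F \<and> coeff_b E \<in> F \<and> 4 * coeff_a E ^ 3 + 27 * coeff_b E ^ 2 \<noteq> 0"

abbreviation conj_curve :: "(qbar \<Rightarrow> qbar) \<Rightarrow> qbar weierstrass \<Rightarrow> qbar weierstrass" where
  "conj_curve \<sigma> E \<equiv> map_weierstrass \<sigma> E"

datatype point = Infinity | Affine qbar qbar

definition affine_points :: "qbar weierstrass \<Rightarrow> (qbar \<times> qbar) set" where
  "affine_points E = {(x, y). y ^ 2 = x ^ 3 + coeff_a E * x + coeff_b E}"

fun ec_add :: "qbar weierstrass \<Rightarrow> point \<Rightarrow> point \<Rightarrow> point" where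
  "ec_add E Infinity Q = Q"
| "ec_add E (Affine x1 y1) Infinity = Affine x1 y1"
| "ec_add E (Affine x1 y1) (Affine x2 y2) =
     (if x1 = x2 \<and> y1 = - y2 then Infinity
      else let m = (if x1 = x2 then (3 * x1 ^ 2 + coeff_a E) / (2 * y1)
                    else (y2 - y1) / (x2 - x1));
               x3 = m ^ 2 - x1 - x2
           in Affine x3 (m * (x1 - x3) - y1))"

definition ec_group :: "qbar weierstrass \<Rightarrow> point monoid" where
  "ec_group E = \<lparr>carrier = insert Infinity ((\<lambda>(x, y). Affine x y) ` affine_points E),
                 monoid.mult = ec_add E, one = Infinity\<rparr>"


section \<open>Isogenies\<close>

text \<open>A polynomial in \<open>x\<close> and \<open>y\<close> is a polynomial in \<open>y\<close> whose coefficients are polynomials in \<open>x\<close>.\<close>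
definition eval2 :: "qbar poly poly \<Rightarrow> qbar \<Rightarrow> qbar \<Rightarrow> qbar" where
  "eval2 p x y = poly (poly p [:y:]) x"

definition coeffs_in :: "qbar set \<Rightarrow> qbar poly poly \<Rightarrow> bool" where
  "coeffs_in k p \<longleftrightarrow> (\<forall>i j. Polynomial.coeff (Polynomial.coeff p i) j \<in> k)"

text \<open>
  \<open>\<phi>\<close> agrees, away from finitely many points of the curve \<open>E\<close>, with a pair of rational functions in
  \<open>x\<close> and \<open>y\<close> with coefficients in \<open>k\<close>.
\<close>
definition rational_map_over :: "qbar set \<Rightarrow> qbar weierstrass \<Rightarrow> (point \<Rightarrow> point) \<Rightarrow> bool" where
  "rational_map_over k E \<phi> \<longleftrightarrow>
     (\<exists>p q r s. coeffs_in k p \<and> coeffs_in k q \<and> coeffs_in k r \<and> coeffs_in k s \<and>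
        finite {(x, y) \<in> affine_points E.
          \<not> (eval2 q x y \<noteq> 0 \<and> eval2 s x y \<noteq> 0 \<and>
             \<phi> (Affine x y) = Affine (eval2 p x y / eval2 q x y) (eval2 r x y / eval2 s x y))})"

text \<open>
  An isogeny is a nonzero homomorphism on points over the algebraic closure that is given by rational
  functions. A homomorphism given by rational functions at all but finitely many points coincides
  with the everywhere defined morphism of curves that these rational functions induce.
\<close>
definition isogeny_over ::
    "qbar set \<Rightarrow> qbar weierstrass \<Rightarrow> qbar weierstrass \<Rightarrow> (point \<Rightarrow> point) \<Rightarrow> bool" where
  "isogeny_over k E E' \<phi> \<longleftrightarrow>
     \<phi> \<in> hom (ec_group E) (ec_group E') \<and>
     (\<exists>P\<in>carrier (ec_group E). \<phi> P \<noteq> Infinity) \<and>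
     rational_map_over k E \<phi>"

abbreviation isogeny :: "qbar weierstrass \<Rightarrow> qbar weierstrass \<Rightarrow> (point \<Rightarrow> point) \<Rightarrow> bool" where
  "isogeny \<equiv> isogeny_over UNIV"

text \<open>The zero endomorphism is multiplication by \<open>0\<close>, so it suffices to look at isogenies.\<close>
definition has_CM :: "qbar weierstrass \<Rightarrow> bool" where
  "has_CM E \<longleftrightarrow>
     (\<exists>\<phi>. isogeny E E \<phi> \<and> \<not> (\<exists>n::int. \<forall>P\<in>carrier (ec_group E). \<phi> P = P [^]\<^bsub>ec_group E\<^esub> n))"

definition Q_curve :: "qbar set \<Rightarrow> qbar weierstrass \<Rightarrow> bool" where
  "Q_curve F E \<longleftrightarrow>
     galois_number_field F \<and> elliptic_curve_over F E \<and>
     (\<forall>\<sigma>\<in>carrier (gal_group F). \<exists>\<phi>. isogeny (conj_curve \<sigma> E) E \<phi>)"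


section \<open>The minimal field of complete definition\<close>

text \<open>
  \<open>\<phi> (x, y) = (f x, y f' x / l)\<close> with \<open>f = p / q\<close>; the quotient \<open>(p' q - p q') / q^2\<close> is \<open>f'\<close>.
\<close>
definition isogeny_scalar :: "qbar weierstrass \<Rightarrow> (point \<Rightarrow> point) \<Rightarrow> qbar \<Rightarrow> bool" where
  "isogeny_scalar E \<phi> l \<longleftrightarrow> l \<noteq> 0 \<and>
     (\<exists>p q :: qbar poly. q \<noteq> 0 \<and>
        finite {(x, y) \<in> affine_points E.
          \<not> (poly q x \<noteq> 0 \<and>
             \<phi> (Affine x y) =
               Affine (poly p x / poly q x)
                 (1 / l * y * (poly (Polynomial.pderiv p * q - p * Polynomial.pderiv q) x
                               / poly q x ^ 2)))})"

text \<open>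
  An isogeny has exactly one scalar, and \<open>f\<close> is determined by the isogeny as well. Hence it is not
  required here that \<open>f\<close> has coefficients in \<open>K\<close> or that the square of the scalar lies in \<open>K\<close>.
\<close>
definition minimal_field_of_complete_definition ::
    "qbar set \<Rightarrow> qbar weierstrass \<Rightarrow> qbar set \<Rightarrow> bool" where
  "minimal_field_of_complete_definition K E L \<longleftrightarrow>
     (\<exists>\<mu> :: (qbar \<Rightarrow> qbar) \<Rightarrow> point \<Rightarrow> point.
        (\<forall>\<sigma>\<in>carrier (gal_group K). isogeny (conj_curve \<sigma> E) E (\<mu> \<sigma>)) \<and>
        L = generate_field qbar_ring
              (K \<union> {l. \<exists>\<sigma>\<in>carrier (gal_group K). isogeny_scalar (conj_curve \<sigma> E) (\<mu> \<sigma>) l}))"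

end

(*
  An isogeny acts on the invariant differential by its scalar l. Since E has no CM, the composite of
  an isogeny from the conjugate curve to E with the conjugate of another such isogeny is
  multiplication by an integer. So the scalars of all isogenies from the conjugate curve to E are
  proportional over the rationals, and l N(l) is an integer for every automorphism N extending the
  nontrivial one of K. An automorphism over K multiplies l by a rational number, which can only be
  1 or -1, so l^2 lies in K. If l were in K then every isogeny would descend to K, because f is
  determined by l through the differential equation that expresses the action on the invariant
  differential. Hence L = K(l) has degree 4, and the automorphisms l -> -l and l -> n / l generate
  its Galois group.

  Rational functions on a curve are evaluated at its generic point, which is expanded as a pair of
  Laurent series at infinity. There the addition theorem gives, to first order, both that the isogeny
  has a simple pole in x and that it multiplies the invariant differential by a constant.
*)
theory Submission
  imports Defs "HOL-Computational_Algebra.Formal_Laurent_Series"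
begin

text \<open>The first-order comparison works as follows. With x(Q) = t^-2 the abscissa of P0 + Q is
  x0 - 2 * y0 * t + O(t^2). Let H and G be the coordinates of the image of the generic point, of
  orders n and m in t; the target curve gives 2 * m = 3 * n as soon as n < 0. Equating x(phi (P0 +
  Q)) with x(phi P0 + phi Q) and clearing denominators confronts a term of order 1 + 2 * n, whose
  coefficient contains the derivative at x0 of the abscissa function f, with a term of order m,
  whose coefficient contains the ordinate of phi P0. As f is not constant the orders must agree,
  which forces n = -2, and equality of the coefficients makes the ordinate of phi P0 a fixed
  multiple of y0 * f'(x0). The obstacle is that isogenies are bare maps on points, prescribed by
  rational functions only off a finite set. Functions on points and Laurent series are therefore
  tied together by a relation that looks at almost all points. For the same reason conjugation has
  to act on all points, so automorphisms of K are extended to the whole algebraic closure.\<close>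

section \<open>The chord and tangent formulas\<close>

text \<open>\<open>slope\<close> is the derivative at \<open>x1\<close> of the identity x^3 + a * x
  + b - (y1 + m * (x - x1))^2 = (x - x1) * (x - x2) * (x - x3). Free of division, it covers the
  chord and, for \<open>x1 = x2\<close>, the tangent; \<open>slope2\<close> and
  \<open>slope3\<close> are its analogues at the other two intersections.\<close>

locale ec_line =
  fixes a b x1 y1 x2 y2 m x3 y3 :: "'a :: field"
  assumes curve1: "y1 ^ 2 = x1 ^ 3 + a * x1 + b"
    and curve2: "y2 ^ 2 = x2 ^ 3 + a * x2 + b"
    and chord: "y2 - y1 = m * (x2 - x1)"
    and slope: "2 * m * y1 = 3 * x1 ^ 2 + a - (x1 - x2) * (2 * x1 + x2 - m ^ 2)"
    and x3: "x3 = m ^ 2 - x1 - x2"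
    and y3: "y3 = m * (x1 - x3) - y1"
begin

lemma slope2: "2 * m * y2 = 3 * x2 ^ 2 + a - (x2 - x1) * (x2 - x3)"
  using chord slope unfolding x3 by Groebner_Basis.algebra

lemma on_curve: "y3 ^ 2 = x3 ^ 3 + a * x3 + b"
  using curve1 slope unfolding y3 x3 by Groebner_Basis.algebra

lemma slope3: "- 2 * m * y3 = 3 * x3 ^ 2 + a - (x3 - x1) * (x3 - x2)"
  using slope unfolding y3 x3 by Groebner_Basis.algebra

end

lemma ec_line_chord:
  fixes a b x1 y1 x2 y2 :: "'a :: field"
  assumes "y1 ^ 2 = x1 ^ 3 + a * x1 + b" "y2 ^ 2 = x2 ^ 3 + a * x2 + b" "x1 \<noteq> x2"
    and m: "m = (y2 - y1) / (x2 - x1)"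
  shows "ec_line a b x1 y1 x2 y2 m (m ^ 2 - x1 - x2) (m * (x1 - (m ^ 2 - x1 - x2)) - y1)"
proof
  show c: "y2 - y1 = m * (x2 - x1)"
    using assms by simp
  have "(x2 - x1) * (2 * m * y1) = (x2 - x1) * (3 * x1 ^ 2 + a - (x1 - x2) * (2 * x1 + x2 - m ^ 2))"
    using c assms(1,2) by Groebner_Basis.algebra
  thus "2 * m * y1 = 3 * x1 ^ 2 + a - (x1 - x2) * (2 * x1 + x2 - m ^ 2)"
    using assms(3) by simp
qed (use assms in auto)

lemma ec_line_tangent:
  fixes a b x y :: "'a :: field"
  assumes "y ^ 2 = x ^ 3 + a * x + b" "2 * y \<noteq> 0" and m: "m = (3 * x ^ 2 + a) / (2 * y)"
  shows "ec_line a b x y x y m (m ^ 2 - x - x) (m * (x - (m ^ 2 - x - x)) - y)"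
proof
  have "m * (2 * y) = 3 * x ^ 2 + a"
    unfolding m by (rule nonzero_eq_divide_eq[THEN iffD1]) (use assms in auto)
  thus "2 * m * y = 3 * x ^ 2 + a - (x - x) * (2 * x + x - m ^ 2)"
    by (simp add: algebra_simps)
qed (use assms in auto)

text \<open>
  \<open>w\<close> stands for \<open>dX / Y\<close>, where \<open>(X, Y)\<close> is a fixed generic point: the pullback of the invariant
  differential along \<open>(X, Y) \<mapsto> (x, y)\<close> is \<open>c\<close> times the invariant differential. The second equation
  follows from the first one unless \<open>y = 0\<close>.
\<close>
definition inv_diff :: "'a fls \<Rightarrow> 'a fls \<Rightarrow> 'a fls \<Rightarrow> 'a fls \<Rightarrow> 'a :: field_char_0 fls \<Rightarrow> bool" where
  "inv_diff a w c x y \<longleftrightarrow>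
     fls_deriv x = c * y * w \<and> 2 * fls_deriv y = c * (3 * x ^ 2 + a) * w"

text \<open>Additivity of the pullback of the invariant differential, for chord and tangent at once.
  The derivative of \<open>m\<close> is the only datum that depends on how \<open>m\<close> arose,
  so it is a premise. Both \<open>m * (x1 - x3) - y1\<close> and \<open>m * (x2 - x3) - y2\<close>
  equal \<open>y3\<close>, which is why \<open>c1\<close> and \<open>c2\<close> add up.\<close>

lemma inv_diff_add_aux:
  fixes a b x1 y1 x2 y2 m x3 y3 w c1 c2 :: "'a :: field_char_0 fls"
  assumes "ec_line a b x1 y1 x2 y2 m x3 y3"
    and "inv_diff a w c1 x1 y1" "inv_diff a w c2 x2 y2"
    and dm: "2 * fls_deriv m = (c1 * (x1 - x3) + c2 * (x2 - x3)) * w"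
  shows "inv_diff a w (c1 + c2) x3 y3"
proof -
  interpret ec_line a b x1 y1 x2 y2 m x3 y3 by fact
  have y3': "y3 = m * (x2 - x3) - y2"
    using chord unfolding y3 by Groebner_Basis.algebra
  have d1: "fls_deriv x1 = c1 * y1 * w" "2 * fls_deriv y1 = c1 * (3 * x1 ^ 2 + a) * w"
    and d2: "fls_deriv x2 = c2 * y2 * w"
    using assms(2,3) by (auto simp: inv_diff_def)
  have d: "fls_deriv x3 = 2 * m * fls_deriv m - fls_deriv x1 - fls_deriv x2"
    unfolding x3 by (simp add: power2_eq_square algebra_simps)
  have "fls_deriv x3 = m * ((c1 * (x1 - x3) + c2 * (x2 - x3)) * w) - c1 * y1 * w - c2 * y2 * w"
    unfolding d d1 d2 dm[symmetric] by (simp add: algebra_simps)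
  also have "\<dots> = (c1 * (m * (x1 - x3) - y1) + c2 * (m * (x2 - x3) - y2)) * w"
    by (simp add: algebra_simps)
  also have "\<dots> = (c1 + c2) * y3 * w"
    unfolding y3'[symmetric] y3[symmetric] by (simp add: algebra_simps)
  finally have 1: "fls_deriv x3 = (c1 + c2) * y3 * w" .
  have "2 * fls_deriv y3 = 2 * fls_deriv m * (x1 - x3) + 2 * m * (fls_deriv x1 - fls_deriv x3)
          - 2 * fls_deriv y1"
    unfolding y3 by (simp add: algebra_simps)
  also have "\<dots> = (c1 * (x1 - x3) + c2 * (x2 - x3)) * w * (x1 - x3)
      + 2 * m * (c1 * y1 * w - (c1 + c2) * y3 * w) - c1 * (3 * x1 ^ 2 + a) * w"
    unfolding 1 d1 dm by simp
  also have "\<dots> = (c1 + c2) * (3 * x3 ^ 2 + a) * w"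
    using slope slope3 y3 y3' x3 by Groebner_Basis.algebra
  finally show ?thesis
    using 1 by (simp add: inv_diff_def)
qed

lemma inv_diff_chord:
  fixes a b x1 y1 x2 y2 m x3 y3 w c1 c2 :: "'a :: field_char_0 fls"
  assumes "ec_line a b x1 y1 x2 y2 m x3 y3" "x1 \<noteq> x2"
    and i: "inv_diff a w c1 x1 y1" "inv_diff a w c2 x2 y2"
  shows "inv_diff a w (c1 + c2) x3 y3"
proof (rule inv_diff_add_aux)
  interpret ec_line a b x1 y1 x2 y2 m x3 y3 by fact
  have "fls_deriv y2 - fls_deriv y1 = fls_deriv m * (x2 - x1) + m * (fls_deriv x2 - fls_deriv x1)"
    using arg_cong[OF chord, of fls_deriv] by (simp add: algebra_simps)
  hence "2 * fls_deriv y2 - 2 * fls_deriv y1 =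
      2 * fls_deriv m * (x2 - x1) + 2 * m * (fls_deriv x2 - fls_deriv x1)"
    by Groebner_Basis.algebra
  hence "2 * fls_deriv m * (x2 - x1) =
      c2 * (3 * x2 ^ 2 + a) * w - c1 * (3 * x1 ^ 2 + a) * w - 2 * m * (c2 * y2 * w - c1 * y1 * w)"
    using i by (simp add: inv_diff_def algebra_simps)
  also have "\<dots> = (c1 * (x1 - x3) + c2 * (x2 - x3)) * w * (x2 - x1)"
    using slope slope2 x3 by Groebner_Basis.algebra
  finally show "2 * fls_deriv m = (c1 * (x1 - x3) + c2 * (x2 - x3)) * w"
    using assms(2) by simp
qed fact+

text \<open>For a doubled point the chord equation is trivial, so the derivative of \<open>m\<close>
  comes from differentiating the tangent equation instead; this is where \<open>a\<close> has to be
  constant.\<close>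

lemma inv_diff_tangent:
  fixes a b x y m x3 y3 w c :: "'a :: field_char_0 fls"
  assumes "ec_line a b x y x y m x3 y3" "y \<noteq> 0" "fls_deriv a = 0"
    and i: "inv_diff a w c x y"
  shows "inv_diff a w (c + c) x3 y3"
proof (rule inv_diff_add_aux)
  interpret ec_line a b x y x y m x3 y3 by fact
  have "fls_deriv (2 * m * y) = fls_deriv (3 * x ^ 2 + a)"
    using slope by simp
  hence "2 * fls_deriv m * y + m * (2 * fls_deriv y) = 6 * x * fls_deriv x"
    using assms(3) by (simp add: power2_eq_square algebra_simps)
  hence "2 * fls_deriv m * y = 6 * x * (c * y * w) - m * (c * (3 * x ^ 2 + a) * w)"
    using i by (simp add: inv_diff_def algebra_simps)
  also have "\<dots> = (c * (x - x3) + c * (x - x3)) * w * y"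
    using slope x3 by Groebner_Basis.algebra
  finally show "2 * fls_deriv m = (c * (x - x3) + c * (x - x3)) * w"
    using assms(2) by simp
qed fact+

section \<open>Polynomials over Laurent series\<close>

text \<open>A homomorphism known only on a subring, so that one theory of \<open>map_poly\<close>
  serves the embedding of constants into Laurent series, automorphisms of the closure, partial
  embeddings, and the identity on \<open>K\<close>.\<close>

locale ring_hom_on =
  fixes F :: "'a :: comm_ring_1 set" and h :: "'a \<Rightarrow> 'b :: comm_ring_1"
  assumes zero_mem: "0 \<in> F" and one_mem: "1 \<in> F"
    and add_mem: "x \<in> F \<Longrightarrow> y \<in> F \<Longrightarrow> x + y \<in> F"
    and mult_mem: "x \<in> F \<Longrightarrow> y \<in> F \<Longrightarrow> x * y \<in> F"
    and uminus_mem: "x \<in> F \<Longrightarrow> - x \<in> F"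
    and hom_one: "h 1 = 1"
    and hom_add: "x \<in> F \<Longrightarrow> y \<in> F \<Longrightarrow> h (x + y) = h x + h y"
    and hom_mult: "x \<in> F \<Longrightarrow> y \<in> F \<Longrightarrow> h (x * y) = h x * h y"
begin

lemma hom_zero: "h 0 = 0"
  using hom_add[OF zero_mem zero_mem] by simp

lemma hom_uminus: "x \<in> F \<Longrightarrow> h (- x) = - h x"
  using hom_add[of x "- x"] uminus_mem[of x] by (simp add: hom_zero add_eq_0_iff)

lemma hom_diff: "x \<in> F \<Longrightarrow> y \<in> F \<Longrightarrow> h (x - y) = h x - h y"
  using hom_add[of x "- y"] hom_uminus[of y] uminus_mem[of y] by simp

lemma diff_mem: "x \<in> F \<Longrightarrow> y \<in> F \<Longrightarrow> x - y \<in> F"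
  using add_mem[of x "- y"] uminus_mem[of y] by simp

lemma power_mem: "x \<in> F \<Longrightarrow> x ^ n \<in> F"
  by (induction n) (auto simp: one_mem mult_mem)

lemma hom_power: "x \<in> F \<Longrightarrow> h (x ^ n) = h x ^ n"
  by (induction n) (auto simp: hom_one hom_mult power_mem)

definition polys_in :: "'a poly \<Rightarrow> bool" where
  "polys_in p \<longleftrightarrow> (\<forall>i. Polynomial.coeff p i \<in> F)"

lemma polys_in_0 [simp]: "polys_in 0"
  by (simp add: polys_in_def zero_mem)

lemma polys_in_pCons [simp]: "polys_in (pCons c p) \<longleftrightarrow> c \<in> F \<and> polys_in p"
  by (auto simp: polys_in_def coeff_pCons split: nat.splits)

lemma polys_in_add: "polys_in p \<Longrightarrow> polys_in q \<Longrightarrow> polys_in (p + q)"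
  by (simp add: polys_in_def add_mem)

lemma polys_in_diff: "polys_in p \<Longrightarrow> polys_in q \<Longrightarrow> polys_in (p - q)"
  by (simp add: polys_in_def diff_mem)

lemma polys_in_smult: "c \<in> F \<Longrightarrow> polys_in p \<Longrightarrow> polys_in (smult c p)"
  by (simp add: polys_in_def mult_mem)

lemma polys_in_mult:
  assumes "polys_in p" "polys_in q"
  shows "polys_in (p * q)"
  using assms(1)
proof (induction p)
  case (pCons c p)
  thus ?case
    using assms(2) by (auto simp: mult_pCons_left zero_mem intro!: polys_in_add polys_in_smult)
qed simp

lemma poly_mem: "polys_in p \<Longrightarrow> x \<in> F \<Longrightarrow> poly p x \<in> F"
  by (induction p) (auto simp: zero_mem intro!: add_mem mult_mem)

lemma map_pCons [simp]: "map_poly h (pCons c p) = pCons (h c) (map_poly h p)"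
  by (simp add: map_poly_pCons hom_zero)

lemma map_add: "polys_in p \<Longrightarrow> polys_in q \<Longrightarrow> map_poly h (p + q) = map_poly h p + map_poly h q"
  by (intro poly_eqI) (auto simp: coeff_map_poly hom_zero polys_in_def hom_add)

lemma map_diff: "polys_in p \<Longrightarrow> polys_in q \<Longrightarrow> map_poly h (p - q) = map_poly h p - map_poly h q"
  by (intro poly_eqI) (auto simp: coeff_map_poly hom_zero polys_in_def hom_diff)

lemma map_smult: "c \<in> F \<Longrightarrow> polys_in p \<Longrightarrow> map_poly h (smult c p) = smult (h c) (map_poly h p)"
  by (intro poly_eqI) (auto simp: coeff_map_poly hom_zero polys_in_def hom_mult)

lemma map_mult:
  assumes "polys_in p" "polys_in q"
  shows "map_poly h (p * q) = map_poly h p * map_poly h q"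
  using assms(1)
proof (induction p)
  case (pCons c p)
  thus ?case
    using assms(2)
    by (auto simp: mult_pCons_left zero_mem hom_zero map_add map_smult polys_in_smult polys_in_mult)
qed simp

lemma hom_poly: "polys_in p \<Longrightarrow> x \<in> F \<Longrightarrow> h (poly p x) = poly (map_poly h p) (h x)"
  by (induction p) (auto simp: hom_zero hom_add hom_mult poly_mem mult_mem)

end

unbundle Formal_Power_Series.fps_syntax
unbundle fps_syntax

interpretation fls_const: ring_hom_on UNIV "fls_const :: 'a :: comm_ring_1 \<Rightarrow> 'a fls"
  by unfold_locales (auto simp: fls_plus_const)

lemma fls_const_polys_in [simp]: "fls_const.polys_in p"
  by (simp add: fls_const.polys_in_def)

definition fpoly :: "'a :: comm_ring_1 poly \<Rightarrow> 'a fls \<Rightarrow> 'a fls" where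
  "fpoly p H = poly (map_poly fls_const p) H"

lemma fpoly_0 [simp]: "fpoly 0 H = 0"
  and fpoly_1 [simp]: "fpoly 1 H = 1"
  and fpoly_pCons [simp]: "fpoly (pCons c p) H = fls_const c + H * fpoly p H"
  and fpoly_add [simp]: "fpoly (p + q) H = fpoly p H + fpoly q H"
  and fpoly_diff [simp]: "fpoly (p - q) H = fpoly p H - fpoly q H"
  and fpoly_mult [simp]: "fpoly (p * q) H = fpoly p H * fpoly q H"
  and fpoly_smult [simp]: "fpoly (smult c p) H = fls_const c * fpoly p H"
  by (auto simp: fpoly_def fls_const.map_add fls_const.map_diff fls_const.map_mult
      fls_const.map_smult)

lemma fpoly_uminus [simp]: "fpoly (- p) H = - fpoly p H"
  using fpoly_diff[of 0 p H] by simp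

lemma fls_deriv_fpoly: "fls_deriv (fpoly p H) = fpoly (pderiv p) H * fls_deriv H"
  by (induction p) (auto simp: pderiv_pCons algebra_simps)

text \<open>Over an algebraically closed field \<open>p\<close> splits into linear factors, and
  \<open>H - fls_const r\<close> is nonzero for every root \<open>r\<close>: a nonconstant series is
  transcendental over the constants.\<close>

lemma fpoly_eq_0_iff:
  fixes H :: "'a :: alg_closed_field fls"
  assumes "\<And>c. H \<noteq> fls_const c"
  shows "fpoly p H = 0 \<longleftrightarrow> p = 0"
proof
  show "fpoly p H = 0 \<Longrightarrow> p = 0"
  proof (induction "Polynomial.degree p" arbitrary: p)
    case 0
    then obtain c where "p = [:c:]"
      by (metis degree_0_id)
    thus ?case using 0 by simp
  next
    case (Suc n)
    then obtain r where "poly p r = 0"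
      using alg_closed_imp_poly_has_root[of p] by auto
    then obtain q where q: "p = [:- r, 1:] * q"
      by (auto simp: poly_eq_0_iff_dvd)
    have "q \<noteq> 0" using Suc q by auto
    have "fpoly p H = (H - fls_const r) * fpoly q H"
      by (simp add: q algebra_simps)
    hence "fpoly q H = 0"
      using assms[of r] Suc by simp
    moreover have "Polynomial.degree q = n"
      using Suc(2) q \<open>q \<noteq> 0\<close> by (simp add: degree_mult_eq del: mult_pCons_left)
    ultimately have "q = 0" using Suc(1)[of q] by simp
    thus ?case using \<open>q \<noteq> 0\<close> by simp
  qed
qed simp

text \<open>\<open>c\<close> may be zero here, so this only bounds the order of \<open>f\<close> by \<open>n\<close> from below.\<close>
definition has_lead :: "'a :: zero fls \<Rightarrow> int \<Rightarrow> 'a \<Rightarrow> bool" where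
  "has_lead f n c \<longleftrightarrow> (\<forall>k<n. f $$ k = 0) \<and> f $$ n = c"

lemma has_lead_subdegree: "has_lead f (fls_subdegree f) (f $$ fls_subdegree f)"
  by (simp add: has_lead_def)

lemma has_lead_unique: "has_lead f n c \<Longrightarrow> has_lead f n d \<Longrightarrow> c = d"
  by (simp add: has_lead_def)

lemma has_lead_weaken: "has_lead f n c \<Longrightarrow> m < n \<Longrightarrow> has_lead f m 0"
  by (simp add: has_lead_def)

lemma has_lead_le: "has_lead f n c \<Longrightarrow> has_lead f m d \<Longrightarrow> c \<noteq> 0 \<Longrightarrow> m \<le> n"
  unfolding has_lead_def by (metis not_le)

lemma has_lead_subdegree_eq: "has_lead f n c \<Longrightarrow> c \<noteq> 0 \<Longrightarrow> fls_subdegree f = n"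
  by (intro fls_subdegree_eqI) (auto simp: has_lead_def)

lemma has_lead_const: "has_lead (fls_const c) 0 c"
  by (simp add: has_lead_def)

lemma has_lead_add:
  "has_lead f n c \<Longrightarrow> has_lead g n d \<Longrightarrow> has_lead (f + g) n (c + d)"
  for f :: "'a :: comm_ring_1 fls"
  by (simp add: has_lead_def)

lemma has_lead_diff:
  "has_lead f n c \<Longrightarrow> has_lead g n d \<Longrightarrow> has_lead (f - g) n (c - d)"
  for f :: "'a :: comm_ring_1 fls"
  by (simp add: has_lead_def)

lemma has_lead_mult:
  fixes f g :: "'a :: comm_ring_1 fls"
  assumes "has_lead f n c" "has_lead g m d"
  shows "has_lead (f * g) (n + m) (c * d)"
proof (cases "f = 0 \<or> g = 0")
  case False
  have sd: "n \<le> fls_subdegree f" "m \<le> fls_subdegree g"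
    using assms False by (auto simp: has_lead_def intro!: fls_subdegree_geI)
  show ?thesis
  proof (cases "n = fls_subdegree f \<and> m = fls_subdegree g")
    case True
    have "(f * g) $$ (n + m) = c * d"
      using assms True fls_times_base[of f g] by (simp add: has_lead_def)
    thus ?thesis using True by (simp add: has_lead_def fls_times_nth_eq0)
  next
    case *: False
    \<comment> \<open>If one of the bounds is not attained, the corresponding coefficient is 0, and
      the coefficient of the product at \<open>n + m\<close> vanishes as well.\<close>
    hence lt: "n + m < fls_subdegree f + fls_subdegree g" using sd by linarith
    have "n < fls_subdegree f \<or> m < fls_subdegree g" using * sd by linarith
    hence "c = 0 \<or> d = 0"
      using assms unfolding has_lead_def by (metis fls_eq0_below_subdegree)
    moreover have "(f * g) $$ k = 0" if "k \<le> n + m" for k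
      by (rule fls_times_nth_eq0) (use lt that in linarith)
    ultimately show ?thesis by (auto simp: has_lead_def)
  qed
qed (use assms in \<open>auto simp: has_lead_def\<close>)

lemma has_lead_power:
  fixes f :: "'a :: comm_ring_1 fls"
  assumes "has_lead f n c"
  shows "has_lead (f ^ k) (int k * n) (c ^ k)"
proof (induction k)
  case 0
  show ?case using has_lead_const[of "1 :: 'a"] by simp
next
  case (Suc k)
  show ?case using has_lead_mult[OF assms Suc] by (simp add: algebra_simps)
qed

lemma has_lead_inverse:
  fixes f :: "'a :: field fls"
  assumes "has_lead f n c" "c \<noteq> 0"
  shows "has_lead (inverse f) (- n) (inverse c)"
proof -
  have n: "fls_subdegree f = n" using assms by (rule has_lead_subdegree_eq)
  have "f \<noteq> 0" using assms by (auto simp: has_lead_def)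
  hence *: "inverse f \<noteq> 0" and sd: "fls_subdegree (inverse f) = - n"
    using n by auto
  have "has_lead (f * inverse f) (n + - n) (c * inverse f $$ - n)"
    using has_lead_mult[OF assms(1) has_lead_subdegree[of "inverse f"]] unfolding sd .
  hence "has_lead 1 0 (c * inverse f $$ - n)" using \<open>f \<noteq> 0\<close> by simp
  hence "c * inverse f $$ - n = 1" by (simp add: has_lead_def)
  hence "inverse f $$ - n = inverse c"
    by (rule inverse_unique[symmetric])
  thus ?thesis using has_lead_subdegree[of "inverse f"] unfolding sd by (simp only:)
qed

lemma has_lead_deriv:
  fixes f :: "'a :: comm_ring_1 fls"
  assumes "has_lead f n c"
  shows "has_lead (fls_deriv f) (n - 1) (of_int n * c)"
  using assms by (simp add: has_lead_def)

lemma has_lead_fpoly: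
  fixes H :: "'a :: comm_ring_1 fls"
  assumes "has_lead H 0 c"
  shows "has_lead (fpoly p H) 0 (poly p c)"
proof (induction p)
  case 0
  show ?case by (simp add: has_lead_def)
next
  case (pCons d p)
  show ?case
    using has_lead_add[OF has_lead_const[of d] has_lead_mult[OF assms pCons(2), simplified]] by simp
qed

section \<open>The generic point of a curve\<close>

text \<open>
  The generic point is expanded at infinity in a parameter \<open>t\<close> with \<open>x = t^-2\<close>.
\<close>
definition genX :: "'a :: field fls" where
  "genX = fls_X_inv ^ 2"

text \<open>Substituting x = t^-2 turns the cubic into t^-6 * (1 + a * t^4 + b * t^6). The constant
  function passed to \<open>fps_radical\<close> selects the square root with constant term 1, so y
  starts with t^-3.\<close>

definition genY :: "'a :: field_char_0 weierstrass \<Rightarrow> 'a fls" where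
  "genY E = fls_X_inv ^ 3 * fps_to_fls (fps_radical (\<lambda>_ _. 1) 2
     (1 + fps_const (coeff_a E) * fps_X ^ 4 + fps_const (coeff_b E) * fps_X ^ 6))"

abbreviation genA :: "'a :: field weierstrass \<Rightarrow> 'a fls" where
  "genA E \<equiv> fls_const (coeff_a E)"
abbreviation genB :: "'a :: field weierstrass \<Rightarrow> 'a fls" where
  "genB E \<equiv> fls_const (coeff_b E)"

lemma genY_sq: "genY E ^ 2 = genX ^ 3 + genA E * genX + genB E"
proof -
  define f where "f = 1 + fps_const (coeff_a E) * fps_X ^ 4 + fps_const (coeff_b E) * fps_X ^ 6"
  have "fps_radical (\<lambda>_ _. 1) (Suc 1) f ^ Suc 1 = f"
    by (subst power_radical[symmetric]) (auto simp: f_def)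
  hence "fps_to_fls (fps_radical (\<lambda>_ _. 1) 2 f) ^ 2 = fps_to_fls f"
    by (metis Suc_1 fps_to_fls_power)
  hence "genY E ^ 2 = fls_X_inv ^ 6 * fps_to_fls f"
    by (simp add: genY_def f_def[symmetric] power_mult_distrib flip: power_mult)
  also have "fps_to_fls f = 1 + genA E * fls_X ^ 4 + genB E * fls_X ^ 6"
    by (simp add: f_def fls_times_fps_to_fls fps_to_fls_power)
  also have "fls_X_inv ^ 6 * \<dots> = genX ^ 3 + genA E * genX + genB E"
  proof -
    have [simp]: "fls_X_inv * (fls_X :: 'a fls) = 1"
      by (metis fls_X_nonzero fls_inverse_X left_inverse)
    have "fls_X_inv ^ 6 * (1 + genA E * fls_X ^ 4 + genB E * fls_X ^ 6) =
      fls_X_inv ^ 6 + genA E * ((fls_X_inv * fls_X) ^ 4 * fls_X_inv ^ 2)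
        + genB E * (fls_X_inv * fls_X) ^ 6"
      unfolding power_mult_distrib by (simp add: algebra_simps flip: power_add)
    thus ?thesis by (simp add: genX_def flip: power_mult)
  qed
  finally show ?thesis .
qed

lemma subdegree_genX [simp]: "fls_subdegree (genX :: 'a :: field fls) = -2"
  by (simp add: genX_def)

lemma genX_nz [simp]: "(genX :: 'a :: field fls) \<noteq> 0"
  by (simp add: genX_def)

lemma genX_lead [simp]: "(genX :: 'a :: field fls) $$ - 2 = 1"
  by (simp add: genX_def)

lemma genX_nonconst: "(genX :: 'a :: field fls) \<noteq> fls_const c"
  by (metis subdegree_genX fls_const_subdegree neg_equal_0_iff_equal zero_neq_numeral)

lemma subdegree_genY [simp]: "fls_subdegree (genY E) = -3"
  and genY_lead [simp]: "genY E $$ - 3 = 1"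
  and genY_nz [simp]: "genY E \<noteq> 0"
proof -
  define S where "S = fps_radical (\<lambda>_ _. 1) 2
     (1 + fps_const (coeff_a E) * fps_X ^ 4 + fps_const (coeff_b E) * fps_X ^ 6)"
  have S0: "S $ 0 = 1"
    by (simp add: S_def fps_radical_nth_0)
  hence S: "fps_to_fls S \<noteq> 0" "fls_subdegree (fps_to_fls S) = 0"
    by (auto simp: fls_subdegree_fls_to_fps)
  have Y: "genY E = fls_X_inv ^ 3 * fps_to_fls S"
    by (simp add: genY_def S_def)
  show d: "fls_subdegree (genY E) = -3" "genY E \<noteq> 0"
    using S by (auto simp: Y)
  show "genY E $$ - 3 = 1"
    using fls_times_base[of "fls_X_inv ^ 3" "fps_to_fls S"] S S0 by (simp add: Y)
qed

lemma subdegree_fpoly_genX: "p \<noteq> 0 \<Longrightarrow> fls_subdegree (fpoly p genX) = - 2 * int (Polynomial.degree p)"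
  for p :: "'a :: field poly"
proof (induction p)
  case (pCons c p)
  show ?case
  proof (cases "p = 0")
    case False
    with pCons have IH: "fls_subdegree (fpoly p genX) = - 2 * int (Polynomial.degree p)" by simp
    have nz: "fpoly p genX \<noteq> 0"
    proof
      assume "fpoly p genX = 0"
      with IH have "Polynomial.degree p = 0" by simp
      then obtain d where "p = [:d:]" by (metis degree_0_id)
      thus False using False \<open>fpoly p genX = 0\<close> by simp
    qed
    hence "fls_subdegree (genX * fpoly p genX) = - 2 - 2 * int (Polynomial.degree p)"
      using IH by simp
    hence "fls_subdegree (fls_const c + genX * fpoly p genX) = - 2 - 2 * int (Polynomial.degree p)"
      using nz by (subst fls_subdegree_add_eq2) auto
    thus ?thesis using False by simp
  qed simp
qed simp

lemma fpoly_genX_eq_0 [simp]: "fpoly p genX = 0 \<longleftrightarrow> p = 0" for p :: "'a :: alg_closed_field poly"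
  using fpoly_eq_0_iff genX_nonconst by blast

definition cubic :: "'a :: comm_ring_1 weierstrass \<Rightarrow> 'a poly" where
  "cubic E = [:coeff_b E, coeff_a E, 0, 1:]"

lemma poly_cubic: "poly (cubic E) x = x ^ 3 + coeff_a E * x + coeff_b E"
  by (simp add: cubic_def power3_eq_cube algebra_simps)

lemma fpoly_cubic: "fpoly (cubic E) H = H ^ 3 + genA E * H + genB E"
  by (simp add: cubic_def power3_eq_cube algebra_simps)

lemma genY_sq': "genY E * genY E = fpoly (cubic E) genX"
  using genY_sq[of E] by (simp add: fpoly_cubic power2_eq_square)

text \<open>The degree of \<open>u * u\<close> is even and that of \<open>v * v * cubic E\<close> is
  odd. The expression is the norm of u + y * v down to polynomials in x, so this says that the
  function field is a genuine quadratic extension.\<close>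

lemma norm_eq_0D:
  fixes u v :: "'a :: field poly"
  assumes "u * u - v * v * cubic E = 0"
  shows "u = 0 \<and> v = 0"
proof -
  have eq: "u * u = v * v * cubic E"
    using assms by simp
  have nz: "cubic E \<noteq> 0" and d: "Polynomial.degree (cubic E) = 3"
    by (auto simp: cubic_def)
  have "v = 0"
  proof (rule ccontr)
    assume v: "v \<noteq> 0"
    hence u: "u \<noteq> 0" using eq nz by auto
    have "Polynomial.degree (u * u) = Polynomial.degree (v * v * cubic E)"
      using eq by simp
    hence "2 * Polynomial.degree u = 2 * Polynomial.degree v + 3"
      using u v nz d by (simp add: degree_mult_eq)
    thus False by presburger
  qed
  thus ?thesis using eq by simp
qed

section \<open>Almost all points of a curve\<close>

abbreviation pt :: "qbar \<times> qbar \<Rightarrow> point" where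
  "pt z \<equiv> Affine (fst z) (snd z)"

text \<open>Cofiniteness as a filter: finite exceptional sets are then merged by
  \<open>eventually_elim\<close>, and \<open>ae\<close> matches the finiteness clauses of
  \<open>rational_map_over\<close> and \<open>isogeny_scalar\<close>.\<close>

definition gen_pts :: "qbar weierstrass \<Rightarrow> (qbar \<times> qbar) filter" where
  "gen_pts E = inf cofinite (principal (affine_points E))"

abbreviation ae :: "qbar weierstrass \<Rightarrow> (qbar \<times> qbar \<Rightarrow> bool) \<Rightarrow> bool" where
  "ae E P \<equiv> eventually P (gen_pts E)"

lemma eventually_gen_pts:
  "ae E P \<longleftrightarrow> finite {z \<in> affine_points E. \<not> P z}"
  by (simp add: gen_pts_def eventually_inf_principal eventually_cofinite)

lemma gen_pts_on_curve: "ae E (\<lambda>z. z \<in> affine_points E)"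
  by (simp add: eventually_gen_pts)

lemma mem_affine_points: "z \<in> affine_points E \<longleftrightarrow> snd z ^ 2 = poly (cubic E) (fst z)"
  by (auto simp: affine_points_def poly_cubic split: prod.splits)

lemma ex_sqrt: "\<exists>y. y ^ 2 = c" for c :: qbar
proof -
  obtain y where "poly [:- c, 0, 1:] y = 0"
    using alg_closed_imp_poly_has_root[of "[:- c, 0, 1:]"] by auto
  thus ?thesis by (intro exI[of _ y]) (auto simp: power2_eq_square algebra_simps)
qed

lemma finite_sqrts: "finite {y :: qbar. y ^ 2 = c}"
proof -
  have "{y. y ^ 2 = c} = {y. poly [:- c, 0, 1:] y = 0}"
    by (auto simp: power2_eq_square)
  thus ?thesis using poly_roots_finite[of "[:- c, 0, 1:]"] by simp
qed

lemma eventually_gen_pts_fst: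
  assumes "finite {x. \<not> P x}"
  shows "ae E (\<lambda>z. P (fst z))"
proof -
  have "{z \<in> affine_points E. \<not> P (fst z)} \<subseteq>
      (\<Union>x\<in>{x. \<not> P x}. {x} \<times> {y. y ^ 2 = poly (cubic E) x})"
    by (auto simp: mem_affine_points)
  moreover have "finite \<dots>"
    using assms finite_sqrts by auto
  ultimately show ?thesis
    by (simp add: eventually_gen_pts finite_subset)
qed

lemma eventually_gen_pts_fst_D:
  assumes "ae E P"
  shows "finite {x. \<not> (\<forall>y. (x, y) \<in> affine_points E \<longrightarrow> P (x, y))}"
  by (rule finite_subset[OF _ finite_imageI[OF assms[unfolded eventually_gen_pts], of fst]]) force

lemma infinite_qbar: "infinite (UNIV :: qbar set)"
  by (simp add: infinite_UNIV_char_0)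

lemma gen_pts_obtain:
  assumes "ae E P"
  obtains z where "z \<in> affine_points E" "P z"
proof -
  obtain x where x: "\<forall>y. (x, y) \<in> affine_points E \<longrightarrow> P (x, y)"
    using ex_new_if_finite[OF infinite_qbar eventually_gen_pts_fst_D[OF assms]] by auto
  obtain y where "y ^ 2 = poly (cubic E) x"
    using ex_sqrt by blast
  thus ?thesis using x by (intro that[of "(x, y)"]) (auto simp: mem_affine_points)
qed

lemma gen_pts_nontrivial [simp]: "\<not> ae E (\<lambda>_. False)"
  using gen_pts_obtain by blast

lemma eventually_poly_nz: "p \<noteq> 0 \<Longrightarrow> ae E (\<lambda>z. poly p (fst z) \<noteq> 0)"
  by (rule eventually_gen_pts_fst[where P = "\<lambda>x. poly p x \<noteq> 0"]) (simp add: poly_roots_finite)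

lemma eventually_poly_0_D:
  assumes "ae E (\<lambda>z. poly p (fst z) = 0)"
  shows "p = 0"
proof (rule ccontr)
  assume "p \<noteq> 0"
  from assms eventually_poly_nz[OF this, of E] have "ae E (\<lambda>_. False)"
    by eventually_elim simp
  thus False by simp
qed

section \<open>Rational functions on a curve\<close>

text \<open>Modulo the curve equation every polynomial in x and y takes this form.
  \<open>nf u (- v)\<close> is its conjugate under negation of y, and the product of the two is a
  polynomial in x alone.\<close>

definition nf :: "qbar poly \<Rightarrow> qbar poly \<Rightarrow> qbar \<times> qbar \<Rightarrow> qbar" where
  "nf u v z = poly u (fst z) + snd z * poly v (fst z)"

definition gen_nf :: "qbar weierstrass \<Rightarrow> qbar poly \<Rightarrow> qbar poly \<Rightarrow> qbar fls" where
  "gen_nf E u v = fpoly u genX + genY E * fpoly v genX"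

lemma nf_norm:
  assumes "z \<in> affine_points E"
  shows "nf u v z * nf u (- v) z = poly (u * u - v * v * cubic E) (fst z)"
proof -
  have *: "poly (cubic E) (fst z) = snd z * snd z"
    using assms by (simp add: mem_affine_points power2_eq_square)
  show ?thesis unfolding nf_def poly_diff poly_mult * by (simp add: algebra_simps)
qed

lemma gen_nf_norm: "gen_nf E u v * gen_nf E u (- v) = fpoly (u * u - v * v * cubic E) genX"
proof -
  show ?thesis unfolding gen_nf_def fpoly_diff fpoly_mult fpoly_uminus genY_sq'[symmetric]
    by (simp add: algebra_simps)
qed

lemma gen_nf_eq_0 [simp]: "gen_nf E u v = 0 \<longleftrightarrow> u = 0 \<and> v = 0"
proof
  assume "gen_nf E u v = 0"
  hence "fpoly (u * u - v * v * cubic E) genX = 0"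
    unfolding gen_nf_norm[symmetric] by (rule mult_eq_0_iff[THEN iffD2, OF disjI1])
  hence "u * u - v * v * cubic E = 0"
    by (simp only: fpoly_genX_eq_0)
  thus "u = 0 \<and> v = 0" by (rule norm_eq_0D)
qed (simp add: gen_nf_def)

lemma eventually_nf_nz:
  assumes "u \<noteq> 0 \<or> v \<noteq> 0"
  shows "ae E (\<lambda>z. nf u v z \<noteq> 0)"
proof -
  have "u * u - v * v * cubic E \<noteq> 0"
    using norm_eq_0D[of u v E] assms by blast
  from eventually_poly_nz[OF this] gen_pts_on_curve show ?thesis
  proof eventually_elim
    case (elim z)
    thus ?case using nf_norm[OF elim(2), of u v] by auto
  qed
qed

lemma eventually_nf_0_iff: "ae E (\<lambda>z. nf u v z = 0) \<longleftrightarrow> u = 0 \<and> v = 0"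
proof
  assume *: "ae E (\<lambda>z. nf u v z = 0)"
  show "u = 0 \<and> v = 0"
  proof (rule ccontr)
    assume "\<not> ?thesis"
    hence "ae E (\<lambda>z. nf u v z \<noteq> 0)"
      by (intro eventually_nf_nz) blast
    with * have "ae E (\<lambda>_. False)" by eventually_elim simp
    thus False by simp
  qed
qed (simp add: nf_def)

text \<open>
  \<open>H\<close> is the value at the generic point of a rational function that agrees with \<open>h\<close> at almost all
  points of \<open>E\<close>.
\<close>
definition genrel :: "qbar weierstrass \<Rightarrow> (qbar \<times> qbar \<Rightarrow> qbar) \<Rightarrow> qbar fls \<Rightarrow> bool" where
  "genrel E h H \<longleftrightarrow> (\<exists>u v d. d \<noteq> 0 \<and>
     ae E (\<lambda>z. h z = nf u v z / poly d (fst z)) \<and>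
     H = gen_nf E u v / fpoly d genX)"

lemma genrelI:
  assumes "d \<noteq> 0" "ae E (\<lambda>z. h z = nf u v z / poly d (fst z))"
    and "H = gen_nf E u v / fpoly d genX"
  shows "genrel E h H"
  using assms unfolding genrel_def by blast

lemma genrelE:
  assumes "genrel E h H"
  obtains u v d where "d \<noteq> 0"
    "ae E (\<lambda>z. poly d (fst z) \<noteq> 0 \<and> h z = nf u v z / poly d (fst z))"
    "H = gen_nf E u v / fpoly d genX" "fpoly d genX \<noteq> 0"
proof -
  from assms obtain u v d where d: "d \<noteq> 0" and h: "H = gen_nf E u v / fpoly d genX"
    and ev: "ae E (\<lambda>z. h z = nf u v z / poly d (fst z))"
    unfolding genrel_def by blast
  from ev eventually_poly_nz[OF d]
  have "ae E (\<lambda>z. poly d (fst z) \<noteq> 0 \<and> h z = nf u v z / poly d (fst z))"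
    by eventually_elim simp
  with d h show ?thesis by (intro that) auto
qed

lemma genrel_const [intro]: "genrel E (\<lambda>_. c) (fls_const c)"
  by (rule genrelI[of 1 _ "[:c:]" 0]) (auto simp: nf_def gen_nf_def)

lemma genrel_fst [intro]: "genrel E fst genX"
  by (rule genrelI[of 1 _ "[:0, 1:]" 0]) (auto simp: nf_def gen_nf_def)

lemma genrel_snd [intro]: "genrel E snd (genY E)"
  by (rule genrelI[of 1 _ 0 1]) (auto simp: nf_def gen_nf_def)

lemma genrel_add [intro]:
  assumes "genrel E h H" "genrel E k K"
  shows "genrel E (\<lambda>z. h z + k z) (H + K)"
proof -
  from assms(1) obtain u v d where h: "d \<noteq> 0"
    "ae E (\<lambda>z. poly d (fst z) \<noteq> 0 \<and> h z = nf u v z / poly d (fst z))"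
    "H = gen_nf E u v / fpoly d genX" "fpoly d genX \<noteq> 0" by (rule genrelE)
  from assms(2) obtain r s e where k: "e \<noteq> 0"
    "ae E (\<lambda>z. poly e (fst z) \<noteq> 0 \<and> k z = nf r s z / poly e (fst z))"
    "K = gen_nf E r s / fpoly e genX" "fpoly e genX \<noteq> 0" by (rule genrelE)
  show ?thesis
  proof (rule genrelI[of "d * e" _ "u * e + r * d" "v * e + s * d"])
    have "gen_nf E (u * e + r * d) (v * e + s * d) =
        gen_nf E u v * fpoly e genX + gen_nf E r s * fpoly d genX"
      by (simp add: gen_nf_def algebra_simps)
    thus "H + K = gen_nf E (u * e + r * d) (v * e + s * d) / fpoly (d * e) genX"
      using h(4) k(4) by (simp add: h(3) k(3) add_frac_eq)
    show "ae E (\<lambda>z. h z + k z =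
        nf (u * e + r * d) (v * e + s * d) z / poly (d * e) (fst z))"
      using h(2) k(2)
    proof eventually_elim
      case (elim z)
      have "nf (u * e + r * d) (v * e + s * d) z =
          nf u v z * poly e (fst z) + nf r s z * poly d (fst z)"
        by (simp add: nf_def algebra_simps)
      thus ?case using elim by (simp add: add_frac_eq)
    qed
  qed (use h(1) k(1) in simp)
qed

lemma genrel_mult [intro]:
  assumes "genrel E h H" "genrel E k K"
  shows "genrel E (\<lambda>z. h z * k z) (H * K)"
proof -
  from assms(1) obtain u v d where h: "d \<noteq> 0"
    "ae E (\<lambda>z. poly d (fst z) \<noteq> 0 \<and> h z = nf u v z / poly d (fst z))"
    "H = gen_nf E u v / fpoly d genX" "fpoly d genX \<noteq> 0" by (rule genrelE)
  from assms(2) obtain r s e where k: "e \<noteq> 0"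
    "ae E (\<lambda>z. poly e (fst z) \<noteq> 0 \<and> k z = nf r s z / poly e (fst z))"
    "K = gen_nf E r s / fpoly e genX" "fpoly e genX \<noteq> 0" by (rule genrelE)
  show ?thesis
  proof (rule genrelI[of "d * e" _ "u * r + v * s * cubic E" "u * s + v * r"])
    have "gen_nf E u v * gen_nf E r s = gen_nf E (u * r + v * s * cubic E) (u * s + v * r)"
      unfolding gen_nf_def fpoly_add fpoly_mult genY_sq'[symmetric] by (simp add: algebra_simps)
    thus "H * K = gen_nf E (u * r + v * s * cubic E) (u * s + v * r) / fpoly (d * e) genX"
      by (simp add: h(3) k(3))
    show "ae E (\<lambda>z. h z * k z =
        nf (u * r + v * s * cubic E) (u * s + v * r) z / poly (d * e) (fst z))"
      using h(2) k(2) gen_pts_on_curve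
    proof eventually_elim
      case (elim z)
      have *: "poly (cubic E) (fst z) = snd z * snd z"
        using elim(3) by (simp add: mem_affine_points power2_eq_square)
      have "nf u v z * nf r s z = nf (u * r + v * s * cubic E) (u * s + v * r) z"
        unfolding nf_def poly_add poly_mult * by (simp add: algebra_simps)
      thus ?case using elim by simp
    qed
  qed (use h(1) k(1) in simp)
qed

text \<open>The denominator u + y * v is rationalised by its conjugate: the inverse of h is d * (u -
  y * v) / N with the norm \<open>N\<close>, a nonzero polynomial in x by
  \<open>norm_eq_0D\<close>.\<close>

lemma genrel_inverse:
  assumes "genrel E h H" "H \<noteq> 0"
  shows "genrel E (\<lambda>z. inverse (h z)) (inverse H)"
proof -
  from assms(1) obtain u v d where h: "d \<noteq> 0"
    "ae E (\<lambda>z. poly d (fst z) \<noteq> 0 \<and> h z = nf u v z / poly d (fst z))"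
    "H = gen_nf E u v / fpoly d genX" "fpoly d genX \<noteq> 0" by (rule genrelE)
  have uv: "u \<noteq> 0 \<or> v \<noteq> 0" using assms(2) h(3) by auto
  define N where "N = u * u - v * v * cubic E"
  have N: "N \<noteq> 0" using norm_eq_0D[of u v E] uv unfolding N_def by blast
  have g: "gen_nf E u v \<noteq> 0" "fpoly N genX \<noteq> 0" using uv N by auto
  show ?thesis
  proof (rule genrelI[of N _ "d * u" "- d * v"])
    have "gen_nf E (d * u) (- d * v) = fpoly d genX * gen_nf E u (- v)"
      by (simp add: gen_nf_def algebra_simps)
    moreover have "gen_nf E u v * gen_nf E u (- v) = fpoly N genX"
      by (simp add: gen_nf_norm N_def)
    ultimately have "gen_nf E u v * gen_nf E (d * u) (- d * v) = fpoly d genX * fpoly N genX"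
      by (metis mult.left_commute)
    thus "inverse H = gen_nf E (d * u) (- d * v) / fpoly N genX"
      using g by (simp add: h(3) frac_eq_eq mult.commute)
    show "ae E (\<lambda>z. inverse (h z) = nf (d * u) (- d * v) z / poly N (fst z))"
      using h(2) gen_pts_on_curve eventually_nf_nz[OF uv] eventually_poly_nz[OF N]
    proof eventually_elim
      case (elim z)
      have "nf (d * u) (- d * v) z = poly d (fst z) * nf u (- v) z"
        by (simp add: nf_def algebra_simps)
      moreover have "nf u v z * nf u (- v) z = poly N (fst z)"
        unfolding N_def by (rule nf_norm) fact
      ultimately have "nf u v z * nf (d * u) (- d * v) z = poly d (fst z) * poly N (fst z)"
        by (metis mult.left_commute)
      thus ?case using elim by (simp add: frac_eq_eq mult.commute)
    qed
  qed (use N in auto)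
qed

lemma genrel_uminus [intro]: "genrel E h H \<Longrightarrow> genrel E (\<lambda>z. - h z) (- H)"
  using genrel_mult[OF genrel_const[of E "- 1"], of h H] by simp

lemma genrel_diff [intro]: "genrel E h H \<Longrightarrow> genrel E k K \<Longrightarrow> genrel E (\<lambda>z. h z - k z) (H - K)"
  using genrel_add[of E h H "\<lambda>z. - k z" "- K"] by auto

lemma genrel_divide [intro]:
  "genrel E h H \<Longrightarrow> genrel E k K \<Longrightarrow> K \<noteq> 0 \<Longrightarrow> genrel E (\<lambda>z. h z / k z) (H / K)"
  using genrel_mult[of E h H "\<lambda>z. inverse (k z)" "inverse K"] genrel_inverse[of E k K]
  by (simp add: field_simps)

lemma genrel_power [intro]: "genrel E h H \<Longrightarrow> genrel E (\<lambda>z. h z ^ n) (H ^ n)"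
  by (induction n) (use genrel_const[of E 1] in auto)

lemma genrel_poly [intro]: "genrel E h H \<Longrightarrow> genrel E (\<lambda>z. poly p (h z)) (fpoly p H)"
  by (induction p) (use genrel_const[of E 0] in auto)

lemma genrel_nz:
  assumes "genrel E h H" "H \<noteq> 0"
  shows "ae E (\<lambda>z. h z \<noteq> 0)"
proof -
  from assms(1) obtain u v d where h: "d \<noteq> 0"
    "ae E (\<lambda>z. poly d (fst z) \<noteq> 0 \<and> h z = nf u v z / poly d (fst z))"
    "H = gen_nf E u v / fpoly d genX" "fpoly d genX \<noteq> 0" by (rule genrelE)
  have uv: "u \<noteq> 0 \<or> v \<noteq> 0" using assms(2) h(3) by auto
  show ?thesis
    using h(2) eventually_nf_nz[OF uv] by eventually_elim simp
qed

lemma genrel_0_D: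
  assumes "genrel E h 0"
  shows "ae E (\<lambda>z. h z = 0)"
proof -
  from assms(1) obtain u v d where h: "d \<noteq> 0"
    "ae E (\<lambda>z. poly d (fst z) \<noteq> 0 \<and> h z = nf u v z / poly d (fst z))"
    "0 = gen_nf E u v / fpoly d genX" "fpoly d genX \<noteq> 0" by (rule genrelE)
  have uv: "u = 0" "v = 0" using h(3,4) by auto
  show ?thesis
    using h(2) by eventually_elim (simp add: uv nf_def)
qed

lemma genrel_nzD:
  assumes "genrel E h H" "ae E (\<lambda>z. h z \<noteq> 0)"
  shows "H \<noteq> 0"
proof
  assume "H = 0"
  with assms(1) have "ae E (\<lambda>z. h z = 0)" by (simp add: genrel_0_D)
  with assms(2) have "ae E (\<lambda>_. False)" by eventually_elim simp
  thus False by simp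
qed

text \<open>The passage from points to series: an identity between rational functions that holds at
  almost all points holds between their Laurent expansions. \<open>genrel_eq\<close> is the way
  back.\<close>

lemma genrel_unique:
  assumes "genrel E h H" "genrel E k K" "ae E (\<lambda>z. h z = k z)"
  shows "H = K"
proof (rule ccontr)
  assume "H \<noteq> K"
  hence "ae E (\<lambda>z. h z - k z \<noteq> 0)"
    using genrel_nz[OF genrel_diff[OF assms(1,2)]] by simp
  with assms(3) have "ae E (\<lambda>_. False)"
    by eventually_elim simp
  thus False by simp
qed

lemma genrel_eq:
  assumes "genrel E h H" "genrel E k H"
  shows "ae E (\<lambda>z. h z = k z)"
  using genrel_0_D[of E "\<lambda>z. h z - k z"] genrel_diff[OF assms] by simp

lemma genrel_neq:
  assumes "genrel E h H" "genrel E k K" "H \<noteq> K"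
  shows "ae E (\<lambda>z. h z \<noteq> k z)"
  using genrel_nz[OF genrel_diff[OF assms(1,2)]] assms(3) by simp

lemma genrel_eval2: "\<exists>H. genrel E (\<lambda>z. eval2 p (fst z) (snd z)) H"
proof (induction p)
  case 0
  show ?case using genrel_const[of E 0] by (auto simp: eval2_def)
next
  case (pCons c p)
  then obtain H where H: "genrel E (\<lambda>z. eval2 p (fst z) (snd z)) H" by blast
  have "genrel E (\<lambda>z. poly c (fst z) + snd z * eval2 p (fst z) (snd z))
      (fpoly c genX + genY E * H)"
    by (intro genrel_add genrel_mult genrel_poly genrel_fst genrel_snd H)
  thus ?case by (auto simp: eval2_def)
qed

text \<open>The exceptional points of \<open>E'\<close> have only finitely many abscissae, and a
  nonconstant \<open>h\<close> takes each of these values at only finitely many points of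
  \<open>E\<close>.\<close>

lemma eventually_gen_pts_compose:
  assumes P: "ae E' P"
    and h: "genrel E h H" "\<And>c. H \<noteq> fls_const c"
    and hk: "ae E (\<lambda>z. (h z, k z) \<in> affine_points E')"
  shows "ae E (\<lambda>z. P (h z, k z))"
proof -
  define B where "B = {x. \<not> (\<forall>y. (x, y) \<in> affine_points E' \<longrightarrow> P (x, y))}"
  have "finite B"
    unfolding B_def by (rule eventually_gen_pts_fst_D[OF P])
  moreover have "ae E (\<lambda>z. h z \<noteq> e)" for e
    by (rule genrel_neq[OF h(1) genrel_const h(2)])
  ultimately have "ae E (\<lambda>z. \<forall>e\<in>B. h z \<noteq> e)"
    by (intro eventually_ball_finite) auto
  with hk show ?thesis
    by eventually_elim (auto simp: B_def)
qed

section \<open>Homomorphisms between groups of points\<close>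

lemma ec_group_simps [simp]:
  "Infinity \<in> carrier (ec_group E)"
  "Affine x y \<in> carrier (ec_group E) \<longleftrightarrow> (x, y) \<in> affine_points E"
  "monoid.mult (ec_group E) = ec_add E"
  "\<one>\<^bsub>ec_group E\<^esub> = Infinity"
  by (auto simp: ec_group_def)

lemma ec_add_Infinity_right [simp]: "ec_add E P Infinity = P"
  by (cases P) auto

lemma affine_points_iff: "(x, y) \<in> affine_points E \<longleftrightarrow> y ^ 2 = x ^ 3 + coeff_a E * x + coeff_b E"
  by (simp add: affine_points_def)

lemma affine_points_neg: "(x, - y) \<in> affine_points E \<longleftrightarrow> (x, y) \<in> affine_points E"
  by (simp add: affine_points_iff)

lemma ec_add_chord:
  assumes "x1 \<noteq> x2" "m = (y2 - y1) / (x2 - x1)"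
  shows "ec_add E (Affine x1 y1) (Affine x2 y2) =
    Affine (m ^ 2 - x1 - x2) (m * (x1 - (m ^ 2 - x1 - x2)) - y1)"
  using assms by (simp add: Let_def)

lemma ec_add_tangent:
  assumes "y \<noteq> 0" "m = (3 * x ^ 2 + coeff_a E) / (2 * y)"
  shows "ec_add E (Affine x y) (Affine x y) =
    Affine (m ^ 2 - x - x) (m * (x - (m ^ 2 - x - x)) - y)"
proof -
  have "y \<noteq> - y" using assms by (simp add: eq_neg_iff_add_eq_0 flip: mult_2)
  thus ?thesis using assms by (simp add: Let_def)
qed

text \<open>If the tangent at an affine point met the curve so that the double has the same
  abscissa, the formula would give the ordinate \<open>- y\<close>; so \<open>y = 0\<close>, where
  doubling yields \<open>Infinity\<close>. This makes homomorphisms preserve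
  \<open>Infinity\<close>.\<close>

lemma ec_add_double_eq_imp:
  assumes "ec_add E P P = P"
  shows "P = Infinity"
proof (cases P)
  case (Affine x y)
  show ?thesis
  proof (cases "y = 0")
    case False
    define m where "m = (3 * x ^ 2 + coeff_a E) / (2 * y)"
    have *: "m ^ 2 - x - x = x" "m * (x - (m ^ 2 - x - x)) - y = y"
      using assms ec_add_tangent[OF False m_def] by (auto simp: Affine)
    have "- y = y" using *(2) unfolding *(1) by simp
    hence "y = 0" by (metis add.right_inverse mult_2 mult_eq_0_iff zero_neq_numeral)
    with False show ?thesis by simp
  qed (use assms Affine in auto)
qed

lemma ec_add_eq_Infinity:
  assumes "ec_add E (Affine u v) P = Infinity"
  shows "P = Affine u (- v)"
  using assms by (cases P) (auto simp: Let_def split: if_splits)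

lemma ec_add_closed:
  assumes "P \<in> carrier (ec_group E)" "Q \<in> carrier (ec_group E)"
  shows "ec_add E P Q \<in> carrier (ec_group E)"
proof (cases P)
  case (Affine x1 y1)
  note P = this
  show ?thesis
  proof (cases Q)
    case (Affine x2 y2)
    have 1: "y1 ^ 2 = x1 ^ 3 + coeff_a E * x1 + coeff_b E"
      and 2: "y2 ^ 2 = x2 ^ 3 + coeff_a E * x2 + coeff_b E"
      using assms P Affine by (auto simp: affine_points_iff)
    consider "x1 \<noteq> x2" | "x1 = x2" "y1 = - y2" | "x1 = x2" "y1 \<noteq> - y2" by blast
    thus ?thesis
    proof cases
      case 1
      from ec_line.on_curve[OF ec_line_chord[OF \<open>y1 ^ 2 = _\<close> 2 1 refl]] show ?thesis
        by (simp only: P Affine ec_add_chord[OF 1 refl] ec_group_simps affine_points_iff)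
    next
      case 3
      have "(y1 - y2) * (y1 + y2) = 0"
        using 1 2 3 by (simp add: algebra_simps power2_eq_square)
      hence y: "y1 = y2" using 3 by (auto simp: add_eq_0_iff)
      hence nz: "y1 \<noteq> 0" using 3 by auto
      hence "2 * y1 \<noteq> 0" by simp
      from ec_line.on_curve[OF ec_line_tangent[OF 1 this refl]] show ?thesis
        unfolding P Affine y[symmetric] 3(1)[symmetric] ec_add_tangent[OF nz refl]
        by (simp only: ec_group_simps affine_points_iff)
    qed (simp add: P Affine)
  qed (use assms in simp)
qed (use assms in simp)

lemma ec_hom_Infinity:
  assumes "\<phi> \<in> hom (ec_group E) (ec_group E')"
  shows "\<phi> Infinity = Infinity"
  using hom_mult[OF assms, of Infinity Infinity] by (intro ec_add_double_eq_imp[of E']) simp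

lemma ec_hom_neg:
  assumes "\<phi> \<in> hom (ec_group E) (ec_group E')" "(x, y) \<in> affine_points E"
    and "\<phi> (Affine x y) = Affine u v"
  shows "\<phi> (Affine x (- y)) = Affine u (- v)"
proof -
  have "ec_add E' (Affine u v) (\<phi> (Affine x (- y))) = \<phi> (ec_add E (Affine x y) (Affine x (- y)))"
    using hom_mult[OF assms(1), of "Affine x y" "Affine x (- y)"] assms(2,3)
    by (simp add: affine_points_neg del: ec_add.simps)
  also have "\<dots> = Infinity"
    using ec_hom_Infinity[OF assms(1)] by simp
  finally show ?thesis by (rule ec_add_eq_Infinity)
qed

lemma eventually_gen_pts_neg:
  assumes "ae E P"
  shows "ae E (\<lambda>z. P (fst z, - snd z))"
proof -
  have "{z \<in> affine_points E. \<not> P (fst z, - snd z)} \<subseteq>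
      (\<lambda>z. (fst z, - snd z)) ` {z \<in> affine_points E. \<not> P z}"
  proof
    fix z assume z: "z \<in> {z \<in> affine_points E. \<not> P (fst z, - snd z)}"
    have "z = (\<lambda>z. (fst z, - snd z)) (fst z, - snd z)" by simp
    moreover have "(fst z, - snd z) \<in> {z \<in> affine_points E. \<not> P z}"
      using z by (simp add: mem_affine_points)
    ultimately show "z \<in> (\<lambda>z. (fst z, - snd z)) ` {z \<in> affine_points E. \<not> P z}" by (rule image_eqI)
  qed
  thus ?thesis using assms by (simp add: eventually_gen_pts finite_subset)
qed

text \<open>The left side is a difference of terms with equal poles at infinity. Eliminating the
  squares of \<open>y\<close> and \<open>y0\<close> by the curve equations leaves a numerator linear
  in \<open>x\<close> and \<open>y\<close>, so that the leading term -2 * y0 * y / x^2 becomes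
  visible.\<close>

lemma chord_diff:
  fixes a b x0 y0 x y :: "'a :: field"
  assumes "y ^ 2 = x ^ 3 + a * x + b" "y0 ^ 2 = x0 ^ 3 + a * x0 + b" "x \<noteq> x0"
  shows "((y - y0) / (x - x0)) ^ 2 - x0 - x - x0 =
    ((a + 3 * x0 ^ 2) * x + (2 * b + a * x0 - x0 ^ 3) - 2 * y0 * y) / (x - x0) ^ 2"
proof -
  have "(y - y0) ^ 2 - (x0 + x + x0) * (x - x0) ^ 2 =
      (a + 3 * x0 ^ 2) * x + (2 * b + a * x0 - x0 ^ 3) - 2 * y0 * y"
    using assms(1,2) by Groebner_Basis.algebra
  moreover have "((y - y0) / (x - x0)) ^ 2 - x0 - x - x0 =
      ((y - y0) ^ 2 - (x0 + x + x0) * (x - x0) ^ 2) / (x - x0) ^ 2"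
  proof -
    have "((y - y0) / (x - x0)) ^ 2 - x0 - x - x0 = (y - y0) ^ 2 / (x - x0) ^ 2 - (x0 + x + x0)"
      by (simp only: power_divide diff_diff_eq add.assoc)
    thus ?thesis using assms(3) by (simp add: divide_diff_eq_iff)
  qed
  ultimately show ?thesis by simp
qed

section \<open>Expansion of P0 + Q as Q tends to infinity\<close>

lemma has_lead_genX: "has_lead (genX :: 'a :: field fls) (- 2) 1"
  using has_lead_subdegree[of genX] by simp

lemma has_lead_genY: "has_lead (genY E) (- 3) 1"
  using has_lead_subdegree[of "genY E"] by simp

lemma nonconst_of_lead:
  fixes H :: "'a :: comm_ring_1 fls"
  assumes "has_lead (H - fls_const e) n c" "c \<noteq> 0" "n \<noteq> 0"
  shows "H \<noteq> fls_const d"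
proof
  assume "H = fls_const d"
  hence "has_lead (H - fls_const e) 0 (d - e)"
    using has_lead_const[of "d - e"] by (simp add: fls_const.hom_diff)
  moreover from this have "fls_subdegree (H - fls_const e) = 0"
    using \<open>H = _\<close> by (metis UNIV_I fls_const.hom_diff fls_const_subdegree)
  ultimately show False using has_lead_subdegree_eq[OF assms(1,2)] assms(3) by simp
qed

lemmas fls_const_homs = fls_const.hom_add fls_const.hom_diff fls_const.hom_mult
  fls_const.hom_power fls_const_numeral fls_const_uminus

definition genXadd :: "qbar weierstrass \<Rightarrow> qbar \<Rightarrow> qbar \<Rightarrow> qbar fls" where
  "genXadd E x0 y0 = ((genY E - fls_const y0) / (genX - fls_const x0)) ^ 2 - fls_const x0 - genX"

text \<open>In the numerator of \<open>chord_diff\<close> only the multiple of \<open>genY E\<close>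
  reaches order -3, and division by a series of order -4 moves it to order 1. The coefficient is the
  first-order displacement of (x0, y0), that is, the invariant vector field up to sign.\<close>

lemma genXadd_lead:
  assumes "(x0, y0) \<in> affine_points E"
  shows "has_lead (genXadd E x0 y0 - fls_const x0) 1 (- 2 * y0)"
proof -
  define a where "a = coeff_a E"
  define b where "b = coeff_b E"
  have c0: "fls_const y0 ^ 2 = fls_const x0 ^ 3 + fls_const a * fls_const x0 + fls_const b"
    using arg_cong[OF assms[unfolded affine_points_iff], of fls_const]
    by (simp only: a_def b_def fls_const_homs UNIV_I)
  have "genXadd E x0 y0 - fls_const x0 =
    ((fls_const a + 3 * fls_const x0 ^ 2) * genX
      + (2 * fls_const b + fls_const a * fls_const x0 - fls_const x0 ^ 3)
      - 2 * fls_const y0 * genY E) / (genX - fls_const x0) ^ 2"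
    unfolding genXadd_def
    by (rule chord_diff[OF genY_sq c0[unfolded a_def b_def], folded a_def b_def]) (rule genX_nonconst)
  also have "fls_const a + 3 * fls_const x0 ^ 2 = fls_const (a + 3 * x0 ^ 2)"
    by (simp add: fls_const_homs del: fls_const_mult_const)
  also have "2 * fls_const b + fls_const a * fls_const x0 - fls_const x0 ^ 3 =
      fls_const (2 * b + a * x0 - x0 ^ 3)"
    by (simp add: fls_const_homs del: fls_const_mult_const)
  also have "2 * fls_const y0 = fls_const (2 * y0)"
    by (simp add: fls_const_homs del: fls_const_mult_const)
  finally have eq: "genXadd E x0 y0 - fls_const x0 = (fls_const (a + 3 * x0 ^ 2) * genX
      + fls_const (2 * b + a * x0 - x0 ^ 3) - fls_const (2 * y0) * genY E)
      * inverse ((genX - fls_const x0) ^ 2)" (is "_ = (?A + ?B - ?C) * ?D")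
    by (simp add: divide_inverse)
  have A: "has_lead ?A (- 3) 0"
    by (rule has_lead_weaken[OF has_lead_mult[OF has_lead_const has_lead_genX]]) simp
  have B: "has_lead ?B (- 3) 0"
    by (rule has_lead_weaken[OF has_lead_const]) simp
  have C: "has_lead ?C (- 3) (2 * y0)"
    using has_lead_mult[OF has_lead_const has_lead_genY] by simp
  have "has_lead (genX - fls_const x0) (- 2) 1"
    using has_lead_diff[OF has_lead_genX has_lead_weaken[OF has_lead_const]] by fastforce
  from has_lead_inverse[OF has_lead_power[OF this, of 2]] have D: "has_lead ?D 4 1"
    by simp
  show ?thesis unfolding eq
    using has_lead_mult[OF has_lead_diff[OF has_lead_add[OF A B] C] D] by simp
qed

lemma genXadd_lead0:
  assumes "(x0, y0) \<in> affine_points E"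
  shows "has_lead (genXadd E x0 y0) 0 x0"
  using has_lead_add[OF has_lead_weaken[OF genXadd_lead[OF assms], of 0] has_lead_const[of x0]]
  by simp

lemma genXadd_nonconst:
  assumes "(x0, y0) \<in> affine_points E" "y0 \<noteq> 0"
  shows "genXadd E x0 y0 \<noteq> fls_const d"
  by (rule nonconst_of_lead[OF genXadd_lead[OF assms(1)]]) (use assms(2) in auto)

definition xadd :: "qbar \<Rightarrow> qbar \<Rightarrow> qbar \<times> qbar \<Rightarrow> qbar" where
  "xadd x0 y0 z = ((snd z - y0) / (fst z - x0)) ^ 2 - x0 - fst z"

definition yadd :: "qbar \<Rightarrow> qbar \<Rightarrow> qbar \<times> qbar \<Rightarrow> qbar" where
  "yadd x0 y0 z = (snd z - y0) / (fst z - x0) * (x0 - xadd x0 y0 z) - y0"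

lemma genrel_xadd: "genrel E (xadd x0 y0) (genXadd E x0 y0)"
  unfolding xadd_def genXadd_def
  by (intro genrel_diff genrel_power genrel_divide genrel_fst genrel_snd genrel_const)
    (use genX_nonconst in auto)

text \<open>Translation by a fixed point preserves almost-everywhere statements.
  \<open>y0 \<noteq> 0\<close> makes the linear coefficient -2 * y0 of \<open>genXadd\<close>
  nonzero and hence the translated abscissa nonconstant.\<close>

lemma eventually_translate:
  assumes "(x0, y0) \<in> affine_points E" "y0 \<noteq> 0" "ae E P"
  shows "ae E (\<lambda>z. ec_add E (Affine x0 y0) (pt z) =
      Affine (xadd x0 y0 z) (yadd x0 y0 z) \<and> P (xadd x0 y0 z, yadd x0 y0 z))"
proof -
  have "ae E (\<lambda>z. fst z \<noteq> x0)"
    by (rule genrel_neq[OF genrel_fst genrel_const genX_nonconst])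
  with gen_pts_on_curve
  have ev: "ae E (\<lambda>z. ec_add E (Affine x0 y0) (pt z) =
      Affine (xadd x0 y0 z) (yadd x0 y0 z) \<and> (xadd x0 y0 z, yadd x0 y0 z) \<in> affine_points E)"
  proof eventually_elim
    case (elim z)
    have "ec_add E (Affine x0 y0) (pt z) = Affine (xadd x0 y0 z) (yadd x0 y0 z)"
      unfolding yadd_def xadd_def by (rule ec_add_chord) (use elim in auto)
    moreover from this have "Affine (xadd x0 y0 z) (yadd x0 y0 z) \<in> carrier (ec_group E)"
      using ec_add_closed[of "Affine x0 y0" E "pt z"] elim assms(1) by simp
    ultimately show ?case by simp
  qed
  have "ae E (\<lambda>z. P (xadd x0 y0 z, yadd x0 y0 z))"
    by (rule eventually_gen_pts_compose[OF assms(3) genrel_xadd genXadd_nonconst[OF assms(1,2)]])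
      (use ev in eventually_elim, simp)
  with ev show ?thesis by eventually_elim simp
qed

section \<open>Rational homomorphisms in normal form\<close>

lemma rational_map_generic:
  assumes "rational_map_over k E \<phi>"
  obtains h g H G where "genrel E h H" "genrel E g G"
    "ae E (\<lambda>z. \<phi> (pt z) = Affine (h z) (g z))"
proof -
  from assms obtain p q r s where
    "finite {(x, y) \<in> affine_points E. \<not> (eval2 q x y \<noteq> 0 \<and> eval2 s x y \<noteq> 0 \<and>
       \<phi> (Affine x y) = Affine (eval2 p x y / eval2 q x y) (eval2 r x y / eval2 s x y))}"
    unfolding rational_map_over_def by blast
  moreover have "{(x, y) \<in> affine_points E. \<not> (eval2 q x y \<noteq> 0 \<and> eval2 s x y \<noteq> 0 \<and>
       \<phi> (Affine x y) = Affine (eval2 p x y / eval2 q x y) (eval2 r x y / eval2 s x y))} =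
    {z \<in> affine_points E. \<not> (eval2 q (fst z) (snd z) \<noteq> 0 \<and> eval2 s (fst z) (snd z) \<noteq> 0 \<and>
       \<phi> (pt z) = Affine (eval2 p (fst z) (snd z) / eval2 q (fst z) (snd z))
         (eval2 r (fst z) (snd z) / eval2 s (fst z) (snd z)))}"
    by auto
  ultimately have ev: "ae E (\<lambda>z. eval2 q (fst z) (snd z) \<noteq> 0 \<and> eval2 s (fst z) (snd z) \<noteq> 0 \<and>
       \<phi> (pt z) = Affine (eval2 p (fst z) (snd z) / eval2 q (fst z) (snd z))
         (eval2 r (fst z) (snd z) / eval2 s (fst z) (snd z)))"
    by (simp add: eventually_gen_pts)
  obtain P where P: "genrel E (\<lambda>z. eval2 p (fst z) (snd z)) P" using genrel_eval2 by blast
  obtain Q where Q: "genrel E (\<lambda>z. eval2 q (fst z) (snd z)) Q" using genrel_eval2 by blast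
  obtain R where R: "genrel E (\<lambda>z. eval2 r (fst z) (snd z)) R" using genrel_eval2 by blast
  obtain S where S: "genrel E (\<lambda>z. eval2 s (fst z) (snd z)) S" using genrel_eval2 by blast
  have "Q \<noteq> 0"
    by (rule genrel_nzD[OF Q]) (use ev in eventually_elim, simp)
  moreover have "S \<noteq> 0"
    by (rule genrel_nzD[OF S]) (use ev in eventually_elim, simp)
  moreover from ev have "ae E (\<lambda>z. \<phi> (pt z) =
      Affine (eval2 p (fst z) (snd z) / eval2 q (fst z) (snd z))
         (eval2 r (fst z) (snd z) / eval2 s (fst z) (snd z)))"
    by eventually_elim simp
  ultimately show ?thesis
    by (intro that[OF genrel_divide[OF P Q] genrel_divide[OF R S]])
qed

text \<open>
  A homomorphism that is given by rational functions commutes with negation, so its first coordinate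
  is even and its second coordinate is odd as a function of \<open>y\<close>.
\<close>
lemma hom_rational_nf:
  assumes hom: "\<phi> \<in> hom (ec_group E) (ec_group E')" and "rational_map_over k E \<phi>"
  obtains p q r s where "q \<noteq> 0" "s \<noteq> 0"
    "ae E (\<lambda>z. poly q (fst z) \<noteq> 0 \<and> poly s (fst z) \<noteq> 0 \<and> \<phi> (pt z) =
      Affine (poly p (fst z) / poly q (fst z)) (snd z * (poly r (fst z) / poly s (fst z))))"
proof -
  obtain h g H G where hg: "genrel E h H" "genrel E g G"
    and ev: "ae E (\<lambda>z. \<phi> (pt z) = Affine (h z) (g z))"
    using rational_map_generic[OF assms(2)] .
  from hg(1) obtain u v q where h: "q \<noteq> 0"
    "ae E (\<lambda>z. poly q (fst z) \<noteq> 0 \<and> h z = nf u v z / poly q (fst z))"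
    by (rule genrelE)
  from hg(2) obtain w r s where g: "s \<noteq> 0"
    "ae E (\<lambda>z. poly s (fst z) \<noteq> 0 \<and> g z = nf w r z / poly s (fst z))"
    by (rule genrelE)
  from h(2) g(2) ev have ev2: "ae E (\<lambda>z. poly q (fst z) \<noteq> 0 \<and> poly s (fst z) \<noteq> 0 \<and>
      \<phi> (pt z) = Affine (nf u v z / poly q (fst z)) (nf w r z / poly s (fst z)))"
    by eventually_elim simp
  from ev2 eventually_gen_pts_neg[OF ev2] gen_pts_on_curve
  have ev3: "ae E (\<lambda>z. nf 0 (v + v) z = 0 \<and> nf (w + w) 0 z = 0)"
  proof eventually_elim
    case (elim z)
    have "\<phi> (Affine (fst z) (- snd z)) =
        Affine (nf u v z / poly q (fst z)) (- (nf w r z / poly s (fst z)))"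
      by (rule ec_hom_neg[OF hom]) (use elim in auto)
    with elim have "nf u v (fst z, - snd z) / poly q (fst z) = nf u v z / poly q (fst z)"
      and "nf w r (fst z, - snd z) / poly s (fst z) = (- nf w r z) / poly s (fst z)"
      by auto
    with elim have "nf u v (fst z, - snd z) = nf u v z" "nf w r (fst z, - snd z) = - nf w r z"
      unfolding divide_cancel_right by blast+
    thus ?case by (auto simp: nf_def algebra_simps)
  qed
  have "ae E (\<lambda>z. nf 0 (v + v) z = 0)" "ae E (\<lambda>z. nf (w + w) 0 z = 0)"
    using ev3 by (auto elim: eventually_mono)
  hence "v + v = 0" "w + w = 0"
    unfolding eventually_nf_0_iff by auto
  moreover have "t = 0" if "t + t = 0" for t :: "qbar poly"
    using that by (metis mult_2 mult_eq_0_iff zero_neq_numeral)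
  ultimately have "v = 0" "w = 0" by auto
  with ev2 have "ae E (\<lambda>z. poly q (fst z) \<noteq> 0 \<and> poly s (fst z) \<noteq> 0 \<and> \<phi> (pt z) =
      Affine (poly u (fst z) / poly q (fst z)) (snd z * (poly r (fst z) / poly s (fst z))))"
    by (simp add: nf_def)
  with h(1) g(1) show ?thesis by (rule that)
qed

section \<open>The scalar of an isogeny\<close>

abbreviation wron :: "qbar poly \<Rightarrow> qbar poly \<Rightarrow> qbar poly" where
  "wron p q \<equiv> pderiv p * q - p * pderiv q"

locale rational_hom =
  fixes E E' :: "qbar weierstrass" and \<phi> :: "point \<Rightarrow> point" and p q r s :: "qbar poly"
  assumes hom: "\<phi> \<in> hom (ec_group E) (ec_group E')"
    and q_nz: "q \<noteq> 0" and s_nz: "s \<noteq> 0"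
    and generic: "ae E (\<lambda>z. poly q (fst z) \<noteq> 0 \<and> poly s (fst z) \<noteq> 0 \<and>
      \<phi> (pt z) = Affine (poly p (fst z) / poly q (fst z))
        (snd z * (poly r (fst z) / poly s (fst z))))"
begin

definition f :: "qbar \<times> qbar \<Rightarrow> qbar" where
  "f z = poly p (fst z) / poly q (fst z)"
definition g :: "qbar \<times> qbar \<Rightarrow> qbar" where
  "g z = snd z * (poly r (fst z) / poly s (fst z))"
definition H :: "qbar fls" where
  "H = fpoly p genX / fpoly q genX"
definition G :: "qbar fls" where
  "G = genY E * (fpoly r genX / fpoly s genX)"

lemma genrel_f: "genrel E f H"
  unfolding f_def H_def using q_nz by (intro genrel_divide genrel_poly genrel_fst) auto

lemma genrel_g: "genrel E g G"
  unfolding g_def G_def using s_nz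
  by (intro genrel_mult genrel_divide genrel_poly genrel_fst genrel_snd) auto

lemma generic_fg: "ae E (\<lambda>z. poly q (fst z) \<noteq> 0 \<and> \<phi> (pt z) = Affine (f z) (g z) \<and>
    (f z, g z) \<in> affine_points E')"
  using generic gen_pts_on_curve
proof eventually_elim
  case (elim z)
  hence "\<phi> (pt z) = Affine (f z) (g z)"
    by (simp add: f_def g_def)
  moreover have "\<phi> (pt z) \<in> carrier (ec_group E')"
    using hom_in_carrier[OF hom, of "pt z"] elim by simp
  ultimately show ?case using elim by auto
qed

lemma G_sq: "G ^ 2 = H ^ 3 + genA E' * H + genB E'"
proof (rule genrel_unique)
  show "genrel E (\<lambda>z. g z ^ 2) (G ^ 2)"
    by (intro genrel_power genrel_g)
  show "genrel E (\<lambda>z. f z ^ 3 + coeff_a E' * f z + coeff_b E') (H ^ 3 + genA E' * H + genB E')"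
    by (intro genrel_power genrel_add genrel_mult genrel_const genrel_f)
  show "ae E (\<lambda>z. g z ^ 2 = f z ^ 3 + coeff_a E' * f z + coeff_b E')"
    using generic_fg by eventually_elim (simp add: affine_points_iff)
qed

lemma odd_subdegree_G: "G \<noteq> 0 \<Longrightarrow> odd (fls_subdegree G)"
  unfolding G_def by (auto simp: fls_divide_subdegree subdegree_fpoly_genX)

text \<open>If \<open>H\<close> has no pole, neither has \<open>G\<close>, by the curve equation. A
  nonzero \<open>G\<close> has odd order, being \<open>genY E\<close> times a quotient of
  polynomials in t^-2, so its constant term vanishes: a finite limit of the image at infinity has
  ordinate 0.\<close>

lemma G_0_of_lead:
  assumes "has_lead H 0 c"
  shows "has_lead G 0 0"
proof (cases "G = 0")
  case False
  have "has_lead (fls_const (coeff_a E') * H) 0 (coeff_a E' * c)"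
    using has_lead_mult[OF has_lead_const assms] by simp
  with has_lead_power[OF assms, of 3]
  have lead: "has_lead (G ^ 2) 0 (c ^ 3 + coeff_a E' * c + coeff_b E')"
    unfolding G_sq by (intro has_lead_add has_lead_const) auto
  have "has_lead (G ^ 2) (2 * fls_subdegree G) ((G $$ fls_subdegree G) ^ 2)"
    using has_lead_power[OF has_lead_subdegree[of G], of 2] by simp
  from has_lead_le[OF this lead] False have "fls_subdegree G \<ge> 0"
    by simp
  moreover have "fls_subdegree G \<noteq> 0"
    using odd_subdegree_G[OF False] by auto
  ultimately show ?thesis
    by (intro has_lead_weaken[OF has_lead_subdegree]) simp
qed (simp add: has_lead_def)

text \<open>A constant abscissa \<open>e\<close> makes \<open>G ^ 2\<close> constant, hence of even
  order 0 unless \<open>G = 0\<close>, while the order of a nonzero \<open>G\<close> is odd. So the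
  map would be constantly \<open>Affine e 0\<close> almost everywhere, which additivity
  forbids.\<close>

lemma H_nonconst: "H \<noteq> fls_const e"
proof
  assume H: "H = fls_const e"
  define d where "d = e ^ 3 + coeff_a E' * e + coeff_b E'"
  have G: "G ^ 2 = fls_const d"
    unfolding G_sq H d_def by (simp only: fls_const_homs UNIV_I)
  have "G = 0"
  proof (rule ccontr)
    assume "G \<noteq> 0"
    have "2 * fls_subdegree G = fls_subdegree (fls_const d)"
      unfolding G[symmetric] by (simp add: fls_subdegree_pow)
    with odd_subdegree_G[OF \<open>G \<noteq> 0\<close>] show False by simp
  qed
  have "ae E (\<lambda>z. f z = e)"
    by (rule genrel_eq[OF genrel_f[unfolded H] genrel_const])
  moreover have "ae E (\<lambda>z. g z = 0)"
    by (rule genrel_0_D[OF genrel_g[unfolded \<open>G = 0\<close>]])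
  ultimately have ev: "ae E (\<lambda>z. \<phi> (pt z) = Affine e 0)"
    using generic_fg by eventually_elim simp
  have "ae E (\<lambda>z. snd z \<noteq> 0 \<and> \<phi> (pt z) = Affine e 0)"
    using ev genrel_nz[OF genrel_snd genY_nz] by eventually_elim simp
  then obtain z0 where z0: "z0 \<in> affine_points E" "snd z0 \<noteq> 0"
    "\<phi> (pt z0) = Affine e 0"
    by (rule gen_pts_obtain) auto
  have on0: "(fst z0, snd z0) \<in> affine_points E" using z0 by simp
  \<comment> \<open>Evaluate the map at z0 + z: additivity gives the double of
    \<open>Affine e 0\<close>, which is \<open>Infinity\<close>, but at almost every translate the
    value is again \<open>Affine e 0\<close>.\<close>
  from eventually_translate[OF on0 z0(2) ev] ev gen_pts_on_curve
  have "ae E (\<lambda>_. False)"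
  proof eventually_elim
    case (elim z)
    have "\<phi> (ec_add E (pt z0) (pt z)) =
        ec_add E' (Affine e 0) (Affine e 0)"
      using hom_mult[OF hom, of "pt z0" "pt z"]
        on0 elim z0(3) by simp
    moreover have "\<phi> (ec_add E (pt z0) (pt z)) = Affine e 0"
      using elim by simp
    ultimately show ?case by simp
  qed
  thus False by simp
qed

text \<open>
  Compare the expansions at \<open>Q = \<infinity>\<close> of both sides of \<open>x (\<phi> (P0 + Q)) = x (\<phi> P0 + \<phi> Q)\<close>.
\<close>
lemma translate_eq:
  assumes on: "(x0, y0) \<in> affine_points E" and "y0 \<noteq> 0" and "poly q x0 \<noteq> 0"
    and \<phi>0: "\<phi> (Affine x0 y0) = Affine f0 g0" and on': "(f0, g0) \<in> affine_points E'"
    and f0: "f0 = poly p x0 / poly q x0"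
  shows "fpoly (p - smult f0 q) (genXadd E x0 y0) * (H - fls_const f0) ^ 2 =
    fpoly q (genXadd E x0 y0) *
      (fls_const (coeff_a E' + 3 * f0 ^ 2) * H
        + fls_const (2 * coeff_b E' + coeff_a E' * f0 - f0 ^ 3) - fls_const (2 * g0) * G)"
proof -
  define T where "T = genXadd E x0 y0"
  have T: "T \<noteq> fls_const d" for d
    unfolding T_def by (rule genXadd_nonconst[OF assms(1,2)])
  have qT: "fpoly q T \<noteq> 0"
    using fpoly_eq_0_iff[OF T] q_nz by blast
  have Hf0: "H - fls_const f0 \<noteq> 0" using H_nonconst[of f0] by simp
  have "fpoly p T / fpoly q T = ((G - fls_const g0) / (H - fls_const f0)) ^ 2 - fls_const f0 - H"
  proof (rule genrel_unique)
    show "genrel E (\<lambda>z. poly p (xadd x0 y0 z) / poly q (xadd x0 y0 z)) (fpoly p T / fpoly q T)"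
      unfolding T_def using qT[unfolded T_def]
      by (intro genrel_divide genrel_poly genrel_xadd)
    show "genrel E (\<lambda>z. ((g z - g0) / (f z - f0)) ^ 2 - f0 - f z)
      (((G - fls_const g0) / (H - fls_const f0)) ^ 2 - fls_const f0 - H)"
      by (intro genrel_diff genrel_power genrel_divide genrel_f genrel_g genrel_const) fact
    have "ae E (\<lambda>z. f z \<noteq> f0)"
      by (rule genrel_neq[OF genrel_f genrel_const H_nonconst])
    with eventually_translate[OF assms(1,2) generic_fg] generic_fg gen_pts_on_curve
    show "ae E (\<lambda>z. poly p (xadd x0 y0 z) / poly q (xadd x0 y0 z) =
      ((g z - g0) / (f z - f0)) ^ 2 - f0 - f z)"
    proof eventually_elim
      case (elim z)
      have "\<phi> (ec_add E (Affine x0 y0) (pt z)) =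
          ec_add E' (Affine f0 g0) (Affine (f z) (g z))"
        using hom_mult[OF hom, of "Affine x0 y0" "pt z"] on elim \<phi>0
        by (simp del: ec_add.simps)
      also have "\<dots> = Affine (((g z - g0) / (f z - f0)) ^ 2 - f0 - f z)
          ((g z - g0) / (f z - f0) * (f0 - (((g z - g0) / (f z - f0)) ^ 2 - f0 - f z)) - g0)"
        by (rule ec_add_chord) (use elim in auto)
      finally have "f (xadd x0 y0 z, yadd x0 y0 z) = ((g z - g0) / (f z - f0)) ^ 2 - f0 - f z"
        using elim by simp
      thus ?case by (simp add: f_def)
    qed
  qed
  hence "fpoly p T / fpoly q T - fls_const f0 =
    ((G - fls_const g0) / (H - fls_const f0)) ^ 2 - fls_const f0 - H - fls_const f0"
    by simp
  also have "\<dots> = ((genA E' + 3 * fls_const f0 ^ 2) * H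
      + (2 * genB E' + genA E' * fls_const f0 - fls_const f0 ^ 3)
      - 2 * fls_const g0 * G) / (H - fls_const f0) ^ 2"
  proof (rule chord_diff[OF G_sq _ H_nonconst])
    show "fls_const g0 ^ 2 = fls_const f0 ^ 3 + genA E' * fls_const f0 + genB E'"
      using arg_cong[OF on'[unfolded affine_points_iff], of fls_const]
      by (simp only: fls_const_homs UNIV_I)
  qed
  also have "fpoly p T / fpoly q T - fls_const f0 = fpoly (p - smult f0 q) T / fpoly q T"
    using qT by (simp add: divide_diff_eq_iff)
  finally have "fpoly (p - smult f0 q) T * (H - fls_const f0) ^ 2 = ((genA E' + 3 * fls_const f0 ^ 2) * H
      + (2 * genB E' + genA E' * fls_const f0 - fls_const f0 ^ 3)
      - 2 * fls_const g0 * G) * fpoly q T"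
    using qT Hf0 by (subst (asm) frac_eq_eq) auto
  thus ?thesis
    unfolding T_def[symmetric] by (simp only: fls_const_homs UNIV_I mult.commute)
qed

definition wronskian :: "qbar poly" where
  "wronskian = wron p q"

lemma deriv_H: "fls_deriv H = fpoly wronskian genX * fls_deriv genX / fpoly q genX ^ 2"
proof -
  have q: "fpoly q genX \<noteq> 0" using q_nz by simp
  have "fls_deriv (H * fpoly q genX) = fls_deriv (fpoly p genX)"
    using q by (simp add: H_def)
  hence "fls_deriv H * fpoly q genX = fpoly (pderiv p) genX * fls_deriv genX
      - H * (fpoly (pderiv q) genX * fls_deriv genX)"
    by (simp add: fls_deriv_fpoly algebra_simps)
  hence "fls_deriv H * fpoly q genX * fpoly q genX =
      fpoly (pderiv p) genX * fls_deriv genX * fpoly q genX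
      - (H * fpoly q genX) * (fpoly (pderiv q) genX * fls_deriv genX)"
    by Groebner_Basis.algebra
  also have "H * fpoly q genX = fpoly p genX" using q by (simp add: H_def)
  finally have "fls_deriv H * fpoly q genX ^ 2 = fpoly wronskian genX * fls_deriv genX"
    by (simp add: wronskian_def power2_eq_square algebra_simps)
  thus ?thesis using q by (simp add: eq_divide_eq)
qed

lemma deriv_H_nz: "fls_deriv H \<noteq> 0"
  using H_nonconst by (metis fls_deriv_eq_0_iff)

lemma wronskian_nz: "wronskian \<noteq> 0"
  using deriv_H_nz unfolding deriv_H by auto

text \<open>\<open>S\<close> is the common value of the two sides of \<open>translate_eq\<close>,
  expanded in two ways. Since \<open>p - smult f0 q\<close> vanishes at \<open>x0\<close> with
  cofactor \<open>wronskian / q\<close> there, the left side starts with the displacement -2 * y0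
  times that cofactor. The orders \<open>n\<close> and \<open>k\<close> stay free, so that the
  finite and the polar case share the lemma.\<close>

lemma translate_lead:
  assumes on: "(x0, y0) \<in> affine_points E" and "y0 \<noteq> 0" and q0: "poly q x0 \<noteq> 0"
    and "\<phi> (Affine x0 y0) = Affine f0 g0" and "(f0, g0) \<in> affine_points E'"
    and f0: "f0 = poly p x0 / poly q x0"
    and H: "has_lead (H - fls_const f0) n c"
    and R: "has_lead (fls_const (coeff_a E' + 3 * f0 ^ 2) * H
        + fls_const (2 * coeff_b E' + coeff_a E' * f0 - f0 ^ 3) - fls_const (2 * g0) * G) k d"
  obtains S where "has_lead S (1 + 2 * n) (- 2 * y0 * (poly wronskian x0 / poly q x0) * c ^ 2)"
    "has_lead S k (poly q x0 * d)"
proof -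
  have "poly (p - smult f0 q) x0 = 0" using q0 by (simp add: f0)
  then obtain t where t: "p - smult f0 q = [:- x0, 1:] * t"
    unfolding poly_eq_0_iff_dvd dvd_def by blast
  have "pderiv p - smult f0 (pderiv q) = pderiv ([:- x0, 1:] * t)"
    unfolding t[symmetric] by (simp add: pderiv_diff pderiv_smult)
  from arg_cong[OF this, of "\<lambda>u. poly u x0"]
  have "poly (pderiv p) x0 - f0 * poly (pderiv q) x0 =
      poly (pderiv ([:- x0, 1:] * t)) x0"
    by simp
  also have "\<dots> = poly t x0"
    by (simp add: pderiv_mult pderiv_pCons del: mult_pCons_left)
  finally have t0: "poly t x0 = poly wronskian x0 / poly q x0"
    using q0 by (simp add: f0 wronskian_def field_simps)
  have fp: "fpoly (p - smult f0 q) T = (T - fls_const x0) * fpoly t T" for T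
    unfolding t by (simp add: algebra_simps)
  note L = genXadd_lead0[OF on]
  have "has_lead ((genXadd E x0 y0 - fls_const x0) * fpoly t (genXadd E x0 y0) * (H - fls_const f0) ^ 2)
      (1 + 0 + int 2 * n) (- 2 * y0 * poly t x0 * c ^ 2)"
    by (intro has_lead_mult genXadd_lead[OF on] has_lead_fpoly[OF L] has_lead_power[OF H])
  moreover have "has_lead (fpoly q (genXadd E x0 y0) * (fls_const (coeff_a E' + 3 * f0 ^ 2) * H
        + fls_const (2 * coeff_b E' + coeff_a E' * f0 - f0 ^ 3) - fls_const (2 * g0) * G))
      (0 + k) (poly q x0 * d)"
    by (intro has_lead_mult has_lead_fpoly[OF L] R)
  ultimately show ?thesis
    using translate_eq[OF assms(1-6)] that unfolding fp t0 by simp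
qed

lemma eventually_good: "ae E (\<lambda>z. z \<in> affine_points E \<and> snd z \<noteq> 0 \<and> poly q (fst z) \<noteq> 0 \<and>
    \<phi> (pt z) = Affine (f z) (g z) \<and> (f z, g z) \<in> affine_points E')"
  using gen_pts_on_curve genrel_nz[OF genrel_snd genY_nz] generic_fg by eventually_elim simp

text \<open>
  Otherwise \<open>\<phi> Q\<close> tends to a finite point \<open>T\<close> as \<open>Q\<close> tends to infinity, and
  \<open>\<phi> P0 = \<phi> P0 + T\<close> for almost all \<open>P0\<close>.
\<close>
lemma subdegree_H_neg: "fls_subdegree H < 0"
proof (rule ccontr)
  assume "\<not> ?thesis"
  hence H0: "has_lead H 0 (H $$ 0)" by (auto simp: has_lead_def)
  note G0 = G_0_of_lead[OF H0]
  define h where "h = H $$ 0"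
  \<comment> \<open>The constant term of the last factor in \<open>translate_eq\<close>, as a
    polynomial in \<open>f z\<close>. The left side has order at least 1, so \<open>c\<close>
    vanishes at \<open>f z\<close> for almost all z and hence at the nonconstant \<open>H\<close>;
    but its leading coefficient is -1.\<close>
  define c where "c = [:2 * coeff_b E' + coeff_a E' * h, coeff_a E', 3 * h, - 1:]"
  have "ae E (\<lambda>z. poly c (f z) = 0)"
    using eventually_good
  proof eventually_elim
    case (elim z)
    have "has_lead (H - fls_const (f z)) 0 (h - f z)"
      unfolding h_def by (intro has_lead_diff H0 has_lead_const)
    moreover have "has_lead (fls_const (coeff_a E' + 3 * f z ^ 2) * H
        + fls_const (2 * coeff_b E' + coeff_a E' * f z - f z ^ 3) - fls_const (2 * g z) * G) 0
      ((coeff_a E' + 3 * f z ^ 2) * h + (2 * coeff_b E' + coeff_a E' * f z - f z ^ 3) - 2 * g z * 0)"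
      using has_lead_mult[OF has_lead_const H0] has_lead_mult[OF has_lead_const G0] unfolding h_def
      by (intro has_lead_diff has_lead_add has_lead_const) simp_all
    moreover have "f z = poly p (fst z) / poly q (fst z)" by (simp add: f_def)
    ultimately obtain S where S: "has_lead S (1 + 2 * 0)
        (- 2 * snd z * (poly wronskian (fst z) / poly q (fst z)) * (h - f z) ^ 2)"
      "has_lead S 0 (poly q (fst z) * ((coeff_a E' + 3 * f z ^ 2) * h +
        (2 * coeff_b E' + coeff_a E' * f z - f z ^ 3) - 2 * g z * 0))"
      using translate_lead[of "fst z" "snd z" "f z" "g z"] elim by (metis prod.collapse)
    have "poly q (fst z) * ((coeff_a E' + 3 * f z ^ 2) * h +
        (2 * coeff_b E' + coeff_a E' * f z - f z ^ 3) - 2 * g z * 0) = 0"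
      by (rule has_lead_unique[OF S(2) has_lead_weaken[OF S(1)]]) simp
    hence "(coeff_a E' + 3 * f z ^ 2) * h + (2 * coeff_b E' + coeff_a E' * f z - f z ^ 3) = 0"
      using elim by simp
    thus ?case by (simp add: c_def algebra_simps power2_eq_square power3_eq_cube)
  qed
  hence "fpoly c H = 0"
    by (intro genrel_unique[OF genrel_poly[OF genrel_f] genrel_const[of E 0, simplified]])
  hence "c = 0"
    using fpoly_eq_0_iff[OF H_nonconst] by blast
  thus False by (simp add: c_def)
qed

lemma scalar_exists:
  obtains l where "l \<noteq> 0" "fls_subdegree H = - 2"
    "ae E (\<lambda>z. g z = 1 / l * snd z * (poly wronskian (fst z) / poly q (fst z) ^ 2))"
proof -
  define n where "n = fls_subdegree H"
  define m where "m = fls_subdegree G"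
  define \<xi> where "\<xi> = H $$ n"
  define \<eta> where "\<eta> = G $$ m"
  have n: "n < 0" unfolding n_def by (rule subdegree_H_neg)
  have "H \<noteq> 0" using H_nonconst[of 0] by simp
  hence \<xi>: "\<xi> \<noteq> 0" by (simp add: \<xi>_def n_def)
  have H: "has_lead H n \<xi>" using has_lead_subdegree by (simp add: n_def \<xi>_def)
  have G: "has_lead G m \<eta>" using has_lead_subdegree by (simp add: m_def \<eta>_def)
  have "has_lead (genA E' * H) (3 * n) 0"
    by (rule has_lead_weaken[OF has_lead_mult[OF has_lead_const H]]) (use n in simp)
  moreover have "has_lead (genB E') (3 * n) 0"
    by (rule has_lead_weaken[OF has_lead_const]) (use n in simp)
  ultimately have G2: "has_lead (G ^ 2) (3 * n) (\<xi> ^ 3)"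
    unfolding G_sq using has_lead_add[OF has_lead_add[OF has_lead_power[OF H, of 3]]] by fastforce
  have "G \<noteq> 0"
    using G2 \<xi> by (auto simp: has_lead_def)
  hence \<eta>: "\<eta> \<noteq> 0" by (simp add: \<eta>_def m_def)
  have mn: "2 * m = 3 * n"
    using has_lead_subdegree_eq[OF G2] \<xi> by (simp add: m_def fls_subdegree_pow)
  have eq: "ae E (\<lambda>z. \<exists>S. z \<in> affine_points E \<and> snd z \<noteq> 0 \<and> poly q (fst z) \<noteq> 0 \<and>
     has_lead S (1 + 2 * n) (- 2 * snd z * (poly wronskian (fst z) / poly q (fst z)) * \<xi> ^ 2) \<and>
     has_lead S m (poly q (fst z) * (- 2 * g z * \<eta>)))"
    using eventually_good
  proof eventually_elim
    case (elim z)
    have "has_lead (fls_const (f z)) n 0"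
      by (rule has_lead_weaken[OF has_lead_const]) (use n in simp)
    from has_lead_diff[OF H this] have "has_lead (H - fls_const (f z)) n \<xi>" by simp
    moreover have "has_lead (fls_const (coeff_a E' + 3 * f z ^ 2) * H) m 0"
      by (rule has_lead_weaken[OF has_lead_mult[OF has_lead_const H]]) (use n mn in simp)
    moreover have "has_lead (fls_const (2 * coeff_b E' + coeff_a E' * f z - f z ^ 3)) m 0"
      by (rule has_lead_weaken[OF has_lead_const]) (use n mn in simp)
    moreover have "has_lead (fls_const (2 * g z) * G) m (2 * g z * \<eta>)"
      using has_lead_mult[OF has_lead_const G] by simp
    ultimately have "has_lead (H - fls_const (f z)) n \<xi>"
      "has_lead (fls_const (coeff_a E' + 3 * f z ^ 2) * H
        + fls_const (2 * coeff_b E' + coeff_a E' * f z - f z ^ 3) - fls_const (2 * g z) * G) m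
        (0 + 0 - 2 * g z * \<eta>)"
      by (blast intro: has_lead_diff has_lead_add)+
    moreover have "f z = poly p (fst z) / poly q (fst z)" by (simp add: f_def)
    ultimately obtain S where "has_lead S (1 + 2 * n)
        (- 2 * snd z * (poly wronskian (fst z) / poly q (fst z)) * \<xi> ^ 2)"
      "has_lead S m (poly q (fst z) * (0 + 0 - 2 * g z * \<eta>))"
      using translate_lead[of "fst z" "snd z" "f z" "g z"] elim by (metis prod.collapse)
    thus ?case using elim by auto
  qed
  have "n = - 2"
  proof (rule ccontr)
    assume "n \<noteq> - 2"
    \<comment> \<open>\<open>2 * m = 3 * n\<close> with \<open>n < 0\<close> means n = -2 * j and m
      = -3 * j for some j >= 1, and 1 - 4 * j < -3 * j as soon as j > 1.\<close>
    hence lt: "1 + 2 * n < m" using n mn by presburger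
    from eq have "ae E (\<lambda>z. poly wronskian (fst z) = 0)"
    proof eventually_elim
      case (elim z)
      then obtain S where S: "snd z \<noteq> 0" "poly q (fst z) \<noteq> 0"
        "has_lead S (1 + 2 * n) (- 2 * snd z * (poly wronskian (fst z) / poly q (fst z)) * \<xi> ^ 2)"
        "has_lead S m (poly q (fst z) * (- 2 * g z * \<eta>))" by blast
      from has_lead_unique[OF S(3) has_lead_weaken[OF S(4) lt]] S(1,2) \<xi> show ?case by simp
    qed
    with wronskian_nz eventually_poly_0_D show False by blast
  qed
  hence m: "m = 1 + 2 * n" using mn by simp
  \<comment> \<open>With \<open>m = 1 + 2 * n\<close> both expansions of \<open>S\<close> give its
    coefficient at the same order. Cancelling the factor -2 leaves \<open>\<eta> / \<xi> ^ 2\<close>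
    as the scalar.\<close>
  from eq have "ae E (\<lambda>z. g z = 1 / (\<eta> / \<xi> ^ 2) * snd z *
      (poly wronskian (fst z) / poly q (fst z) ^ 2))"
  proof eventually_elim
    case (elim z)
    then obtain S where S: "snd z \<noteq> 0" "poly q (fst z) \<noteq> 0"
      "has_lead S (1 + 2 * n) (- 2 * snd z * (poly wronskian (fst z) / poly q (fst z)) * \<xi> ^ 2)"
      "has_lead S m (poly q (fst z) * (- 2 * g z * \<eta>))" by blast
    have "2 * (snd z * (poly wronskian (fst z) / poly q (fst z)) * \<xi> ^ 2) = 2 * (poly q (fst z) * (g z * \<eta>))"
      using has_lead_unique[OF S(3) S(4)[unfolded m]] by (simp add: algebra_simps)
    hence "snd z * (poly wronskian (fst z) / poly q (fst z)) * \<xi> ^ 2 = poly q (fst z) * (g z * \<eta>)"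
      by (simp only: mult_cancel_left) simp
    thus ?case using S(2) \<xi> \<eta> by (simp add: field_simps power2_eq_square)
  qed
  moreover have "\<eta> / \<xi> ^ 2 \<noteq> 0" using \<eta> \<xi> by simp
  moreover have "fls_subdegree H = - 2" using \<open>n = - 2\<close> by (simp add: n_def)
  ultimately show ?thesis by (intro that)
qed

end

section \<open>Normal form of an isogeny and uniqueness of its scalar\<close>

abbreviation form_pt :: "qbar poly \<Rightarrow> qbar poly \<Rightarrow> qbar \<Rightarrow> qbar \<times> qbar \<Rightarrow> point" where
  "form_pt p q l z \<equiv> Affine (poly p (fst z) / poly q (fst z))
     (1 / l * snd z * (poly (wron p q) (fst z) / poly q (fst z) ^ 2))"

text \<open>\<open>isogeny_scalar\<close> with numerator and denominator exposed, so that they can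
  be conjugated and compared. \<open>p\<close> and \<open>q\<close> may have common factors.\<close>

definition isog_form :: "qbar weierstrass \<Rightarrow> (point \<Rightarrow> point) \<Rightarrow> qbar poly \<Rightarrow> qbar poly \<Rightarrow> qbar \<Rightarrow> bool" where
  "isog_form E \<phi> p q l \<longleftrightarrow> q \<noteq> 0 \<and> l \<noteq> 0 \<and>
     ae E (\<lambda>z. poly q (fst z) \<noteq> 0 \<and> \<phi> (pt z) =
       form_pt p q l z)"

lemma isogeny_scalar_iff: "isogeny_scalar E \<phi> l \<longleftrightarrow> (\<exists>p q. isog_form E \<phi> p q l)"
proof -
  have "{(x, y) \<in> affine_points E. \<not> (poly q x \<noteq> 0 \<and> \<phi> (Affine x y) = Affine (poly p x / poly q x)
      (1 / l * y * (poly (wron p q) x / poly q x ^ 2)))} =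
    {z \<in> affine_points E. \<not> (poly q (fst z) \<noteq> 0 \<and> \<phi> (pt z) =
       form_pt p q l z)}" for p q
    by auto
  thus ?thesis
    by (simp only: isogeny_scalar_def isog_form_def eventually_gen_pts) blast
qed

text \<open>
  The pullback of the invariant differential \<open>dx / y\<close> along \<open>\<phi>\<close> is \<open>l\<close> times the invariant
  differential.
\<close>
definition generic_scalar :: "qbar weierstrass \<Rightarrow> (point \<Rightarrow> point) \<Rightarrow> qbar \<Rightarrow> bool" where
  "generic_scalar E \<phi> l \<longleftrightarrow> (\<exists>h g H G. genrel E h H \<and> genrel E g G \<and>
     ae E (\<lambda>z. \<phi> (pt z) = Affine (h z) (g z)) \<and>
     fls_deriv H * genY E = fls_const l * G * fls_deriv genX)"

lemma generic_scalarI: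
  assumes "genrel E h H" "genrel E g G"
    "ae E (\<lambda>z. \<phi> (pt z) = Affine (h z) (g z))"
    "fls_deriv H * genY E = fls_const l * G * fls_deriv genX"
  shows "generic_scalar E \<phi> l"
  unfolding generic_scalar_def by (intro exI conjI) fact+

lemma fls_deriv_divide:
  fixes f g :: "'a :: field_char_0 fls"
  assumes "g \<noteq> 0"
  shows "fls_deriv (f / g) = (fls_deriv f * g - f * fls_deriv g) / g ^ 2"
proof -
  have f: "f = f / g * g" using assms by simp
  have "fls_deriv f = fls_deriv (f / g) * g + f / g * fls_deriv g"
    by (subst f, subst fls_deriv_mult) (simp add: algebra_simps)
  hence "fls_deriv f * g - f * fls_deriv g = fls_deriv (f / g) * g ^ 2"
    using assms by (simp add: algebra_simps power2_eq_square)
  thus ?thesis using assms by (simp add: eq_divide_eq)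
qed

lemma isog_form_genrel:
  assumes "isog_form E \<phi> p q l"
  defines "H \<equiv> fpoly p genX / fpoly q genX"
  defines "W \<equiv> wron p q"
  defines "G \<equiv> fls_const (1 / l) * genY E * (fpoly W genX / fpoly q genX ^ 2)"
  shows "genrel E (\<lambda>z. poly p (fst z) / poly q (fst z)) H"
    and "genrel E (\<lambda>z. 1 / l * snd z * (poly W (fst z) / poly q (fst z) ^ 2)) G"
    and "ae E (\<lambda>z. \<phi> (pt z) = Affine (poly p (fst z) / poly q (fst z))
      (1 / l * snd z * (poly W (fst z) / poly q (fst z) ^ 2)))"
    and "fls_deriv H * genY E = fls_const l * G * fls_deriv genX"
proof -
  have q: "q \<noteq> 0" "fpoly q genX \<noteq> 0" and l: "l \<noteq> 0"
    using assms by (auto simp: isog_form_def)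
  show "genrel E (\<lambda>z. poly p (fst z) / poly q (fst z)) H"
    unfolding H_def using q by (intro genrel_divide genrel_poly genrel_fst)
  show "genrel E (\<lambda>z. 1 / l * snd z * (poly W (fst z) / poly q (fst z) ^ 2)) G"
    unfolding G_def using q
    by (intro genrel_divide genrel_poly genrel_fst genrel_mult genrel_const genrel_snd genrel_power) auto
  show "ae E (\<lambda>z. \<phi> (pt z) = Affine (poly p (fst z) / poly q (fst z))
      (1 / l * snd z * (poly W (fst z) / poly q (fst z) ^ 2)))"
    using assms(1) unfolding isog_form_def W_def by (auto elim: eventually_mono)
  have "fls_deriv H = fpoly W genX * fls_deriv genX / fpoly q genX ^ 2"
    unfolding H_def W_def fls_deriv_divide[OF q(2)] fls_deriv_fpoly by (simp add: algebra_simps)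
  moreover have "fls_const l * G = genY E * (fpoly W genX / fpoly q genX ^ 2)"
  proof -
    have "fls_const l * (fls_const (1 / l) * genY E * (fpoly W genX / fpoly q genX ^ 2)) =
      (fls_const l * fls_const (1 / l)) * genY E * (fpoly W genX / fpoly q genX ^ 2)"
      by (simp only: mult.assoc)
    thus ?thesis using l unfolding G_def by simp
  qed
  ultimately show "fls_deriv H * genY E = fls_const l * G * fls_deriv genX"
    by (simp add: mult_ac)
qed

lemma generic_scalar_of_form:
  assumes "isog_form E \<phi> p q l"
  shows "generic_scalar E \<phi> l"
  by (rule generic_scalarI[OF isog_form_genrel[OF assms]])

lemma isogeny_obtain_form:
  assumes "isogeny_over k E E' \<phi>"
  obtains p q l where "isog_form E \<phi> p q l" "fls_subdegree (fpoly p genX / fpoly q genX) = - 2"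
proof -
  have hom: "\<phi> \<in> hom (ec_group E) (ec_group E')" and "rational_map_over k E \<phi>"
    using assms by (auto simp: isogeny_over_def)
  then obtain p q r s where "q \<noteq> 0" "s \<noteq> 0"
    "ae E (\<lambda>z. poly q (fst z) \<noteq> 0 \<and> poly s (fst z) \<noteq> 0 \<and> \<phi> (pt z) =
      Affine (poly p (fst z) / poly q (fst z)) (snd z * (poly r (fst z) / poly s (fst z))))"
    by (rule hom_rational_nf)
  then interpret rational_hom E E' \<phi> p q r s
    using hom by unfold_locales
  obtain l where l: "l \<noteq> 0" "fls_subdegree H = - 2"
    "ae E (\<lambda>z. g z = 1 / l * snd z * (poly wronskian (fst z) / poly q (fst z) ^ 2))"
    by (rule scalar_exists)
  have "isog_form E \<phi> p q l"
    unfolding isog_form_def using q_nz l(1)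
  proof (intro conjI)
    show "ae E (\<lambda>z. poly q (fst z) \<noteq> 0 \<and> \<phi> (pt z) =
       form_pt p q l z)"
      using generic_fg l(3) by eventually_elim (simp add: f_def wronskian_def)
  qed
  thus ?thesis using l(2) by (intro that) (simp_all add: H_def)
qed

lemma genrel_affine_unique:
  assumes "genrel E h H" "genrel E g G" "genrel E h' H'" "genrel E g' G'"
    and "ae E (\<lambda>z. \<phi> (pt z) = Affine (h z) (g z))"
    and "ae E (\<lambda>z. \<phi> (pt z) = Affine (h' z) (g' z))"
  shows "H = H'" "G = G'"
proof -
  have ev: "ae E (\<lambda>z. h z = h' z \<and> g z = g' z)"
    using assms(5,6) by eventually_elim simp
  show "H = H'"
    by (rule genrel_unique[OF assms(1,3)]) (use ev in eventually_elim, simp)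
  show "G = G'"
    by (rule genrel_unique[OF assms(2,4)]) (use ev in eventually_elim, simp)
qed

lemma isogeny_form_subdegree:
  assumes "isogeny_over k E E' \<phi>" "isog_form E \<phi> p q l"
  shows "fls_subdegree (fpoly p genX / fpoly q genX) = - 2"
proof -
  obtain p' q' l' where *: "isog_form E \<phi> p' q' l'" "fls_subdegree (fpoly p' genX / fpoly q' genX) = - 2"
    using isogeny_obtain_form[OF assms(1)] .
  show ?thesis
    using genrel_affine_unique(1)[OF isog_form_genrel(1,2)[OF assms(2)] isog_form_genrel(1,2)[OF *(1)]
        isog_form_genrel(3)[OF assms(2)] isog_form_genrel(3)[OF *(1)]] *(2) by simp
qed

text \<open>\<open>H\<close> and \<open>G\<close> depend on the map alone. The order -2 of
  \<open>H\<close> makes it nonconstant, so its derivative is nonzero and the differential relation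
  determines the scalar.\<close>

lemma generic_scalar_unique:
  assumes "isogeny_over k E E' \<phi>" "generic_scalar E \<phi> l" "generic_scalar E \<phi> m"
  shows "l = m"
proof -
  from assms(2) obtain h g H G where 1: "genrel E h H" "genrel E g G"
    "ae E (\<lambda>z. \<phi> (pt z) = Affine (h z) (g z))"
    "fls_deriv H * genY E = fls_const l * G * fls_deriv genX"
    unfolding generic_scalar_def by blast
  from assms(3) obtain h' g' H' G' where 2: "genrel E h' H'" "genrel E g' G'"
    "ae E (\<lambda>z. \<phi> (pt z) = Affine (h' z) (g' z))"
    "fls_deriv H' * genY E = fls_const m * G' * fls_deriv genX"
    unfolding generic_scalar_def by blast
  obtain p q n where 3: "isog_form E \<phi> p q n" "fls_subdegree (fpoly p genX / fpoly q genX) = - 2"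
    using isogeny_obtain_form[OF assms(1)] .
  have "H = fpoly p genX / fpoly q genX"
    by (rule genrel_affine_unique(1)[OF 1(1,2) isog_form_genrel(1,2)[OF 3(1)] 1(3)
          isog_form_genrel(3)[OF 3(1)]])
  hence "fls_subdegree H = - 2" using 3(2) by simp
  hence "H \<noteq> fls_const c" for c by auto
  hence "fls_deriv H \<noteq> 0" by (metis fls_deriv_eq_0_iff)
  hence "fls_deriv H * genY E \<noteq> 0" by simp
  moreover have "H = H'" "G = G'"
    by (rule genrel_affine_unique[OF 1(1,2) 2(1,2) 1(3) 2(3)])+
  ultimately have "fls_const l = fls_const m"
    using 1(4) 2(4) by auto
  from arg_cong[OF this, of "\<lambda>u. u $$ 0"] show ?thesis by simp
qed

lemma isogeny_has_scalar:
  assumes "isogeny_over k E E' \<phi>"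
  obtains l where "l \<noteq> 0" "isogeny_scalar E \<phi> l" "generic_scalar E \<phi> l"
    "\<And>m. isogeny_scalar E \<phi> m \<longleftrightarrow> m = l" "\<And>m. generic_scalar E \<phi> m \<longleftrightarrow> m = l"
proof -
  obtain p q l where l: "isog_form E \<phi> p q l"
    using isogeny_obtain_form[OF assms] by blast
  hence "l \<noteq> 0" "isogeny_scalar E \<phi> l" "generic_scalar E \<phi> l"
    using generic_scalar_of_form by (auto simp: isogeny_scalar_iff isog_form_def)
  moreover have "m = l" if "isogeny_scalar E \<phi> m" for m
    using generic_scalar_unique[OF assms _ \<open>generic_scalar E \<phi> l\<close>] that generic_scalar_of_form
    by (auto simp: isogeny_scalar_iff)
  moreover have "m = l" if "generic_scalar E \<phi> m" for m
    using generic_scalar_unique[OF assms that \<open>generic_scalar E \<phi> l\<close>] .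
  ultimately show ?thesis using that by blast
qed

text \<open>
  \<open>f\<close> is determined by the differential equation \<open>(x^3 + a x + b) f'^2 = l^2 (f^3 + A f + B)\<close> together
  with its simple pole at infinity.
\<close>
lemma isog_form_unique:
  assumes iso: "isogeny_over k E E' \<phi>1" "isogeny_over k' E E' \<phi>2"
    and form: "isog_form E \<phi>1 p1 q1 l" "isog_form E \<phi>2 p2 q2 l"
  shows "p1 * q2 = p2 * q1"
proof -
  define X' :: "qbar fls" where "X' = fls_deriv genX"
  have key: "\<exists>\<xi>. \<xi> \<noteq> 0 \<and> l ^ 2 * \<xi> = 1 \<and> has_lead (fpoly p genX / fpoly q genX) (- 2) \<xi> \<and>
      (let H = fpoly p genX / fpoly q genX in fls_deriv H ^ 2 * genY E ^ 2 =
       fls_const (l ^ 2) * X' ^ 2 * (H ^ 3 + genA E' * H + genB E'))"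
    if iso: "isogeny_over k E E' \<phi>" and form: "isog_form E \<phi> p q l" for k \<phi> p q
  proof -
    define H where "H = fpoly p genX / fpoly q genX"
    define G where "G = fls_const (1 / l) * genY E *
      (fpoly (wron p q) genX / fpoly q genX ^ 2)"
    note gen = isog_form_genrel[OF form, folded H_def G_def]
    define \<xi> where "\<xi> = H $$ - 2"
    have sd: "fls_subdegree H = - 2"
      unfolding H_def by (rule isogeny_form_subdegree[OF iso form])
    hence "H \<noteq> 0" by auto
    hence \<xi>: "\<xi> \<noteq> 0" using sd unfolding \<xi>_def by (metis nth_fls_subdegree_nonzero)
    have H: "has_lead H (- 2) \<xi>" using has_lead_subdegree[of H] by (simp add: sd \<xi>_def)
    have "G ^ 2 = H ^ 3 + genA E' * H + genB E'"
    proof (rule genrel_unique)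
      show "genrel E (\<lambda>z. (1 / l * snd z * (poly (wron p q) (fst z)
            / poly q (fst z) ^ 2)) ^ 2) (G ^ 2)"
        by (intro genrel_power gen)
      show "genrel E (\<lambda>z. (poly p (fst z) / poly q (fst z)) ^ 3
            + coeff_a E' * (poly p (fst z) / poly q (fst z)) + coeff_b E')
          (H ^ 3 + genA E' * H + genB E')"
        by (intro genrel_power genrel_add genrel_mult genrel_const gen)
      show "ae E (\<lambda>z. (1 / l * snd z * (poly (wron p q) (fst z)
            / poly q (fst z) ^ 2)) ^ 2 = (poly p (fst z) / poly q (fst z)) ^ 3
            + coeff_a E' * (poly p (fst z) / poly q (fst z)) + coeff_b E')"
        using gen(3) gen_pts_on_curve
      proof eventually_elim
        case (elim z)
        have "\<phi> (pt z) \<in> carrier (ec_group E')"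
          using iso hom_in_carrier[of \<phi> "ec_group E" "ec_group E'" "pt z"] elim
          by (simp add: isogeny_over_def)
        thus ?case unfolding elim(1) ec_group_simps affine_points_iff .
      qed
    qed
    moreover have "fls_deriv H ^ 2 * genY E ^ 2 = fls_const (l ^ 2) * X' ^ 2 * G ^ 2"
      using arg_cong[OF gen(4), of "\<lambda>u. u ^ 2"]
      by (simp only: power_mult_distrib X'_def fls_const_power mult_ac)
    ultimately have eq: "fls_deriv H ^ 2 * genY E ^ 2 =
        fls_const (l ^ 2) * X' ^ 2 * (H ^ 3 + genA E' * H + genB E')" by simp
    have X': "has_lead X' (- 3) (- 2)"
      using has_lead_deriv[OF has_lead_genX] by (simp add: X'_def)
    have dH: "has_lead (fls_deriv H) (- 3) (- 2 * \<xi>)"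
      using has_lead_deriv[OF H] by simp
    have L: "has_lead (fls_deriv H ^ 2 * genY E ^ 2) (int 2 * - 3 + int 2 * - 3) ((- 2 * \<xi>) ^ 2 * 1 ^ 2)"
      by (intro has_lead_mult has_lead_power dH has_lead_genY)
    have "has_lead (genA E' * H) (- 6) 0" "has_lead (genB E') (- 6) 0"
      using has_lead_weaken[OF has_lead_mult[OF has_lead_const H], of "- 6"]
        has_lead_weaken[OF has_lead_const, of "- 6"] by auto
    moreover have "has_lead (H ^ 3) (- 6) (\<xi> ^ 3)"
      using has_lead_power[OF H, of 3] by simp
    ultimately have "has_lead (H ^ 3 + genA E' * H + genB E') (- 6) (\<xi> ^ 3 + 0 + 0)"
      by (intro has_lead_add)
    hence "has_lead (fls_const (l ^ 2) * X' ^ 2 * (H ^ 3 + genA E' * H + genB E'))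
        (0 + int 2 * - 3 + - 6) (l ^ 2 * (- 2) ^ 2 * (\<xi> ^ 3 + 0 + 0))"
      by (intro has_lead_mult has_lead_power has_lead_const X')
    \<comment> \<open>At order -12 the left side has coefficient 4 * \<xi>^2 and the right side 4 *
      l^2 * \<xi>^3. So the scalar fixes the coefficient of the pole of \<open>H\<close>.\<close>
    from has_lead_unique[OF L[unfolded eq, simplified] this[simplified]]
    have "4 * \<xi> ^ 2 * (l ^ 2 * \<xi>) = 4 * \<xi> ^ 2 * 1"
      by (simp add: power2_eq_square power3_eq_cube mult_ac)
    hence "l ^ 2 * \<xi> = 1" using \<xi> by simp
    with \<xi> H eq show ?thesis unfolding H_def Let_def by blast
  qed
  define H1 where "H1 = fpoly p1 genX / fpoly q1 genX"
  define H2 where "H2 = fpoly p2 genX / fpoly q2 genX"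
  obtain \<xi> where \<xi>: "\<xi> \<noteq> 0" "l ^ 2 * \<xi> = 1" "has_lead H1 (- 2) \<xi>"
    and eq1: "fls_deriv H1 ^ 2 * genY E ^ 2 = fls_const (l ^ 2) * X' ^ 2 * (H1 ^ 3 + genA E' * H1 + genB E')"
    using key[OF iso(1) form(1)] unfolding Let_def H1_def by blast
  obtain \<xi>' where "l ^ 2 * \<xi>' = 1" and H2': "has_lead H2 (- 2) \<xi>'"
    and eq2: "fls_deriv H2 ^ 2 * genY E ^ 2 = fls_const (l ^ 2) * X' ^ 2 * (H2 ^ 3 + genA E' * H2 + genB E')"
    using key[OF iso(2) form(2)] unfolding Let_def H2_def by blast
  have "l \<noteq> 0" using form by (simp add: isog_form_def)
  hence "\<xi>' = \<xi>" using \<xi>(2) \<open>l ^ 2 * \<xi>' = 1\<close>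
    by (metis mult_left_cancel power_not_zero)
  note H2 = H2'[unfolded this]
  have "H1 = H2"
  proof (rule ccontr)
    define D where "D = H1 - H2"
    define j where "j = fls_subdegree D"
    define d where "d = D $$ j"
    assume "H1 \<noteq> H2"
    hence "D \<noteq> 0" by (simp add: D_def)
    hence d: "d \<noteq> 0" unfolding d_def j_def by (rule nth_fls_subdegree_nonzero)
    have D: "has_lead D j d" unfolding d_def j_def by (rule has_lead_subdegree)
    have "has_lead D (- 2) 0" using has_lead_diff[OF \<xi>(3) H2] by (simp add: D_def)
    hence "j \<noteq> - 2" "- 2 \<le> j"
      using d has_lead_le[OF D] by (auto simp: has_lead_def d_def)
    have X': "has_lead X' (- 3) (- 2)"
      using has_lead_deriv[OF has_lead_genX] by (simp add: X'_def)
    have dD: "fls_deriv D = fls_deriv H1 - fls_deriv H2"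
      by (simp add: D_def)
    have E: "fls_deriv D * (fls_deriv H1 + fls_deriv H2) * genY E ^ 2 =
        fls_const (l ^ 2) * X' ^ 2 * (D * (H1 ^ 2 + H1 * H2 + H2 ^ 2 + genA E'))"
      using eq1 eq2 unfolding dD unfolding D_def by Groebner_Basis.algebra
    have 1: "has_lead (fls_deriv H1 + fls_deriv H2) (- 3) (- 4 * \<xi>)"
      using has_lead_add[OF has_lead_deriv[OF \<xi>(3)] has_lead_deriv[OF H2]] by simp
    have L: "has_lead (fls_deriv D * (fls_deriv H1 + fls_deriv H2) * genY E ^ 2)
        (j - 1 + - 3 + int 2 * - 3) (of_int j * d * (- 4 * \<xi>) * 1 ^ 2)"
      by (intro has_lead_mult has_lead_power has_lead_genY 1 has_lead_deriv D)
    have "has_lead (genA E') (- 4) 0"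
      by (rule has_lead_weaken[OF has_lead_const]) simp
    moreover have "has_lead (H1 ^ 2) (- 4) (\<xi> ^ 2)" "has_lead (H2 ^ 2) (- 4) (\<xi> ^ 2)"
      "has_lead (H1 * H2) (- 4) (\<xi> * \<xi>)"
      using has_lead_power[OF \<xi>(3), of 2] has_lead_power[OF H2, of 2] has_lead_mult[OF \<xi>(3) H2]
      by simp_all
    ultimately have "has_lead (H1 ^ 2 + H1 * H2 + H2 ^ 2 + genA E') (- 4) (\<xi> ^ 2 + \<xi> * \<xi> + \<xi> ^ 2 + 0)"
      by (intro has_lead_add)
    hence "has_lead (fls_const (l ^ 2) * X' ^ 2 * (D * (H1 ^ 2 + H1 * H2 + H2 ^ 2 + genA E')))
        (0 + int 2 * - 3 + (j + - 4)) (l ^ 2 * (- 2) ^ 2 * (d * (\<xi> ^ 2 + \<xi> * \<xi> + \<xi> ^ 2 + 0)))"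
      by (intro has_lead_mult has_lead_power has_lead_const X' D)
    hence R: "has_lead (fls_const (l ^ 2) * X' ^ 2 * (D * (H1 ^ 2 + H1 * H2 + H2 ^ 2 + genA E')))
        (j - 1 + - 3 + int 2 * - 3) (l ^ 2 * (- 2) ^ 2 * (d * (\<xi> ^ 2 + \<xi> * \<xi> + \<xi> ^ 2 + 0)))"
      by simp
    \<comment> \<open>The difference of the two differential equations is linear in \<open>D\<close>
      up to common factors, and its leading coefficients force the order j = -3. But both series
      start with the same multiple of t^-2, so \<open>D\<close> has order above -2.\<close>
    have "of_int j * d * (- 4 * \<xi>) * 1 ^ 2 = l ^ 2 * (- 2) ^ 2 * (d * (\<xi> ^ 2 + \<xi> * \<xi> + \<xi> ^ 2 + 0))"
      by (rule has_lead_unique[OF L[unfolded E] R])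
    hence "(4 * d * \<xi>) * (- of_int j) = (4 * d * \<xi>) * (3 * (l ^ 2 * \<xi>))"
      by (simp add: power2_eq_square algebra_simps)
    moreover have "4 * d * \<xi> \<noteq> 0" using d \<xi>(1) by simp
    ultimately have "- of_int j = (3 :: qbar)" unfolding \<xi>(2) by (metis mult_left_cancel mult_1_right)
    hence "of_int (- j) = (of_int 3 :: qbar)" by simp
    hence "- j = 3" by (simp only: of_int_eq_iff)
    thus False using \<open>- 2 \<le> j\<close> by simp
  qed
  hence "fpoly p1 genX * fpoly q2 genX = fpoly p2 genX * fpoly q1 genX"
    using form unfolding H1_def H2_def isog_form_def by (simp add: frac_eq_eq)
  hence "fpoly (p1 * q2 - p2 * q1) genX = 0" by simp
  thus ?thesis by (simp only: fpoly_genX_eq_0 eq_iff_diff_eq_0[symmetric])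
qed

section \<open>Composition and multiplication maps\<close>

lemma rational_map_over_UNIV_I:
  assumes "genrel E h H" "genrel E g G"
    and "ae E (\<lambda>z. \<phi> (pt z) = Affine (h z) (g z))"
  shows "rational_map_over UNIV E \<phi>"
proof -
  from assms(1) obtain u v d where h: "d \<noteq> 0"
    "ae E (\<lambda>z. poly d (fst z) \<noteq> 0 \<and> h z = nf u v z / poly d (fst z))"
    by (rule genrelE)
  from assms(2) obtain r s e where g: "e \<noteq> 0"
    "ae E (\<lambda>z. poly e (fst z) \<noteq> 0 \<and> g z = nf r s z / poly e (fst z))"
    by (rule genrelE)
  have nf: "eval2 [:u, v:] x y = nf u v (x, y)" "eval2 [:d:] x y = poly d x" for u v d x y
    by (auto simp: eval2_def nf_def)
  have "ae E (\<lambda>z. eval2 [:d:] (fst z) (snd z) \<noteq> 0 \<and> eval2 [:e:] (fst z) (snd z) \<noteq> 0 \<and>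
    \<phi> (pt z) = Affine (eval2 [:u, v:] (fst z) (snd z) / eval2 [:d:] (fst z) (snd z))
     (eval2 [:r, s:] (fst z) (snd z) / eval2 [:e:] (fst z) (snd z)))"
    using h(2) g(2) assms(3) unfolding nf by eventually_elim simp
  hence "finite {(x, y) \<in> affine_points E. \<not> (eval2 [:d:] x y \<noteq> 0 \<and> eval2 [:e:] x y \<noteq> 0 \<and>
    \<phi> (Affine x y) = Affine (eval2 [:u, v:] x y / eval2 [:d:] x y)
      (eval2 [:r, s:] x y / eval2 [:e:] x y))}"
    unfolding eventually_gen_pts by (rule back_subst[of finite]) auto
  thus ?thesis
    unfolding rational_map_over_def coeffs_in_def by blast
qed

lemma isogenyI:
  assumes "\<phi> \<in> hom (ec_group E) (ec_group E')" "genrel E h H" "genrel E g G"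
    and ev: "ae E (\<lambda>z. \<phi> (pt z) = Affine (h z) (g z))"
  shows "isogeny E E' \<phi>"
proof -
  obtain z where "z \<in> affine_points E" "\<phi> (pt z) = Affine (h z) (g z)"
    using gen_pts_obtain[OF ev] by blast
  hence "\<exists>P\<in>carrier (ec_group E). \<phi> P \<noteq> Infinity"
    by (intro bexI[of _ "pt z"]) auto
  with assms(1) rational_map_over_UNIV_I[OF assms(2-4)] show ?thesis
    by (simp add: isogeny_over_def)
qed

text \<open>Chain rule for the pullback of the differential. The scalar is asserted as
  \<open>generic_scalar\<close> because the coordinates arise as polynomials in the coordinates of
  the first map, not as fractions in x with the derivative in the second coordinate.\<close>

lemma isogeny_compose:
  assumes iso: "isogeny E E' \<phi>" "isogeny E' E'' \<psi>"
    and "isogeny_scalar E \<phi> l" "isogeny_scalar E' \<psi> m"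
  shows "isogeny E E'' (\<lambda>P. \<psi> (\<phi> P))" "generic_scalar E (\<lambda>P. \<psi> (\<phi> P)) (l * m)"
proof -
  obtain p q where \<phi>: "isog_form E \<phi> p q l"
    using assms(3) unfolding isogeny_scalar_iff by blast
  obtain r s where \<psi>: "isog_form E' \<psi> r s m"
    using assms(4) unfolding isogeny_scalar_iff by blast
  have hom: "\<phi> \<in> hom (ec_group E) (ec_group E')" "\<psi> \<in> hom (ec_group E') (ec_group E'')"
    using iso by (auto simp: isogeny_over_def)
  hence hom': "(\<lambda>P. \<psi> (\<phi> P)) \<in> hom (ec_group E) (ec_group E'')"
    using hom_compose[OF hom] by (simp add: comp_def)
  define h where "h = (\<lambda>z :: qbar \<times> qbar. poly p (fst z) / poly q (fst z))"
  define g where "g = (\<lambda>z. 1 / l * snd z * (poly (wron p q) (fst z)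
            / poly q (fst z) ^ 2))"
  define H where "H = fpoly p genX / fpoly q genX"
  define G where "G = fls_const (1 / l) * genY E *
      (fpoly (wron p q) genX / fpoly q genX ^ 2)"
  have gen: "genrel E h H" "genrel E g G"
    "ae E (\<lambda>z. \<phi> (pt z) = Affine (h z) (g z))"
    "fls_deriv H * genY E = fls_const l * G * fls_deriv genX"
    unfolding h_def g_def H_def G_def by (fact isog_form_genrel[OF \<phi>])+
  define W where "W = wron r s"
  have "fls_subdegree H = - 2"
    unfolding H_def by (rule isogeny_form_subdegree[OF iso(1) \<phi>])
  hence Hc: "H \<noteq> fls_const c" for c
    by auto
  have s: "fpoly s H \<noteq> 0"
    using fpoly_eq_0_iff[OF Hc] \<psi> unfolding isog_form_def by blast
  have "ae E (\<lambda>z. (h z, g z) \<in> affine_points E')"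
    using gen(3) gen_pts_on_curve
  proof eventually_elim
    case (elim z)
    have "\<phi> (pt z) \<in> carrier (ec_group E')"
      by (rule hom_in_carrier[OF hom(1)]) (use elim(2) in simp)
    thus ?case unfolding elim(1) ec_group_simps .
  qed
  from eventually_gen_pts_compose[OF isog_form_genrel(3)[OF \<psi>, folded W_def] gen(1) Hc this] gen(3)
  have ev: "ae E (\<lambda>z. \<psi> (\<phi> (pt z)) = Affine (poly r (h z) / poly s (h z))
      (1 / m * g z * (poly W (h z) / poly s (h z) ^ 2)))"
    by eventually_elim simp
  have g1: "genrel E (\<lambda>z. poly r (h z) / poly s (h z)) (fpoly r H / fpoly s H)"
    using s by (intro genrel_divide genrel_poly gen)
  have g2: "genrel E (\<lambda>z. 1 / m * g z * (poly W (h z) / poly s (h z) ^ 2))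
      (fls_const (1 / m) * G * (fpoly W H / fpoly s H ^ 2))"
    using s by (intro genrel_divide genrel_poly gen genrel_mult genrel_const genrel_power) auto
  show "isogeny E E'' (\<lambda>P. \<psi> (\<phi> P))"
    by (rule isogenyI[OF hom' g1 g2 ev])
  have m: "m \<noteq> 0" using \<psi> by (simp add: isog_form_def)
  have "fls_const m * fls_const (1 / m) = 1" using m by simp
  hence c: "fls_const (l * m) * fls_const (1 / m) = fls_const l"
    using m by simp
  have "fls_deriv (fpoly r H / fpoly s H) = fpoly W H * fls_deriv H / fpoly s H ^ 2"
    unfolding W_def fls_deriv_divide[OF s] fls_deriv_fpoly by (simp add: algebra_simps)
  hence "fls_deriv (fpoly r H / fpoly s H) * genY E = fpoly W H / fpoly s H ^ 2 * (fls_deriv H * genY E)"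
    by simp
  also have "\<dots> = fpoly W H / fpoly s H ^ 2 * (fls_const (l * m) * fls_const (1 / m) * G * fls_deriv genX)"
    unfolding gen(4) c ..
  also have "\<dots> = fls_const (l * m) * (fls_const (1 / m) * G * (fpoly W H / fpoly s H ^ 2)) * fls_deriv genX"
    by (simp only: mult_ac)
  finally show "generic_scalar E (\<lambda>P. \<psi> (\<phi> P)) (l * m)"
    by (rule generic_scalarI[OF g1 g2 ev])
qed

section \<open>Multiplication maps and the invariant differential\<close>

lemma inv_diff_generic:
  "inv_diff (genA E) (fls_deriv genX / genY E) 1 genX (genY E)"
proof -
  have "fls_deriv (genY E ^ 2) = fls_deriv (genX ^ 3 + genA E * genX + genB E)"
    by (simp only: genY_sq)
  hence "2 * fls_deriv (genY E) * genY E = (3 * genX ^ 2 + genA E) * fls_deriv genX"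
    by (simp add: power2_eq_square power3_eq_cube algebra_simps)
  thus ?thesis
    by (simp add: inv_diff_def eq_divide_eq)
qed

lemma ec_nat_pow_closed:
  assumes "P \<in> carrier (ec_group E)"
  shows "P [^]\<^bsub>ec_group E\<^esub> (n :: nat) \<in> carrier (ec_group E)"
  by (induction n) (auto simp: nat_pow_def intro!: ec_add_closed assms)

lemma ec_nat_pow_Suc: "P [^]\<^bsub>ec_group E\<^esub> Suc n = ec_add E (P [^]\<^bsub>ec_group E\<^esub> n) P"
  by (simp add: nat_pow_def)

text \<open>Induction by adding the generic point to its multiple (H, G). Equal abscissae leave G =
  genY or G = -genY, that is, doubling or \<open>Infinity\<close>; otherwise the chord applies. The
  integer \<open>c\<close> is existential: after a power that is \<open>Infinity\<close> almost
  everywhere it restarts at 1.\<close>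

lemma ec_nat_pow_generic:
  fixes E :: "qbar weierstrass" and n :: nat
  defines "w \<equiv> fls_deriv genX / genY E"
  shows "ae E (\<lambda>z. pt z [^]\<^bsub>ec_group E\<^esub> n = Infinity) \<or>
    (\<exists>h g H G c. genrel E h H \<and> genrel E g G \<and>
       ae E (\<lambda>z. pt z [^]\<^bsub>ec_group E\<^esub> n = Affine (h z) (g z)) \<and>
       inv_diff (genA E) w (of_int c) H G)"
proof (induction n)
  case 0
  show ?case by (simp add: nat_pow_def)
next
  case (Suc n)
  define Pn where "Pn = (\<lambda>n z. pt z [^]\<^bsub>ec_group E\<^esub> (n :: nat))"
  have Suc_eq: "Pn (Suc n) z = ec_add E (Pn n z) (pt z)" for z
    unfolding Pn_def by (rule ec_nat_pow_Suc)
  note base = inv_diff_generic[of E, folded w_def]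
  consider "ae E (\<lambda>z. Pn n z = Infinity)"
    | h g H G c where "genrel E h H" "genrel E g G"
       "ae E (\<lambda>z. Pn n z = Affine (h z) (g z))"
       "inv_diff (genA E) w (of_int c) H G"
    using Suc unfolding Pn_def by blast
  hence "ae E (\<lambda>z. Pn (Suc n) z = Infinity) \<or>
    (\<exists>h g H G c. genrel E h H \<and> genrel E g G \<and>
       ae E (\<lambda>z. Pn (Suc n) z = Affine (h z) (g z)) \<and>
       inv_diff (genA E) w (of_int c) H G)"
  proof cases
    case 1
    hence "ae E (\<lambda>z. Pn (Suc n) z = pt z)"
      by eventually_elim (simp add: Suc_eq)
    moreover have "inv_diff (genA E) w (of_int 1) genX (genY E)" using base by simp
    ultimately show ?thesis using genrel_fst genrel_snd by blast
  next
    case (2 h g H G c)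
    have "G ^ 2 = H ^ 3 + genA E * H + genB E"
    proof (rule genrel_unique)
      show "genrel E (\<lambda>z. g z ^ 2) (G ^ 2)"
        by (intro genrel_power 2)
      show "genrel E (\<lambda>z. h z ^ 3 + coeff_a E * h z + coeff_b E) (H ^ 3 + genA E * H + genB E)"
        by (intro genrel_power genrel_add genrel_mult genrel_const 2)
      show "ae E (\<lambda>z. g z ^ 2 = h z ^ 3 + coeff_a E * h z + coeff_b E)"
        using 2(3) gen_pts_on_curve
      proof eventually_elim
        case (elim z)
        have "Pn n z \<in> carrier (ec_group E)"
          unfolding Pn_def by (rule ec_nat_pow_closed) (use elim in simp)
        thus ?case unfolding elim(1) ec_group_simps affine_points_iff .
      qed
    qed
    note G_sq = this
    show ?thesis
    proof (cases "H = genX")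
      case False
      define M where "M = (genY E - G) / (genX - H)"
      define m where "m = (\<lambda>z. (snd z - g z) / (fst z - h z))"
      have line: "ec_line (genA E) (genB E) H G genX (genY E) M (M ^ 2 - H - genX)
          (M * (H - (M ^ 2 - H - genX)) - G)"
        by (rule ec_line_chord[OF G_sq genY_sq False M_def])
      have m: "genrel E m M"
        unfolding m_def M_def using False by (intro genrel_divide genrel_diff genrel_fst genrel_snd 2) auto
      have "ae E (\<lambda>z. h z \<noteq> fst z)"
        by (rule genrel_neq[OF 2(1) genrel_fst False])
      with 2(3) have ev: "ae E (\<lambda>z. Pn (Suc n) z = Affine (m z ^ 2 - h z - fst z)
          (m z * (h z - (m z ^ 2 - h z - fst z)) - g z))"
      proof eventually_elim
        case (elim z)
        show ?case unfolding Suc_eq elim(1)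
          by (rule ec_add_chord) (use elim in \<open>auto simp: m_def\<close>)
      qed
      have "inv_diff (genA E) w (of_int c + 1) (M ^ 2 - H - genX)
          (M * (H - (M ^ 2 - H - genX)) - G)"
        by (rule inv_diff_chord[OF line False 2(4) base])
      hence i: "inv_diff (genA E) w (of_int (c + 1)) (M ^ 2 - H - genX)
          (M * (H - (M ^ 2 - H - genX)) - G)"
        by simp
      have h': "genrel E (\<lambda>z. m z ^ 2 - h z - fst z) (M ^ 2 - H - genX)"
        by (intro genrel_diff genrel_power m 2 genrel_fst)
      have g': "genrel E (\<lambda>z. m z * (h z - (m z ^ 2 - h z - fst z)) - g z)
          (M * (H - (M ^ 2 - H - genX)) - G)"
        by (intro genrel_diff genrel_mult genrel_power m 2 genrel_fst)
      from h' g' ev i show ?thesis by blast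
    next
      case True
      have "G ^ 2 = genY E ^ 2" unfolding G_sq True genY_sq ..
      hence "G = genY E \<or> G = - genY E" by (simp add: power2_eq_iff)
      thus ?thesis
      proof
        assume G: "G = - genY E"
        have "ae E (\<lambda>z. h z = fst z)"
          by (rule genrel_eq[OF 2(1)[unfolded True] genrel_fst])
        moreover have "ae E (\<lambda>z. g z = - snd z)"
          by (rule genrel_eq[OF 2(2)[unfolded G] genrel_uminus[OF genrel_snd]])
        ultimately have "ae E (\<lambda>z. Pn (Suc n) z = Infinity)"
          using 2(3) by eventually_elim (simp add: Suc_eq)
        thus ?thesis by blast
      next
        assume G: "G = genY E"
        define M where "M = (3 * genX ^ 2 + genA E) / (2 * genY E)"
        define m where "m = (\<lambda>z. (3 * fst z ^ 2 + coeff_a E) / (2 * snd z))"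
        have line: "ec_line (genA E) (genB E) genX (genY E) genX (genY E) M (M ^ 2 - genX - genX)
            (M * (genX - (M ^ 2 - genX - genX)) - genY E)"
          by (rule ec_line_tangent[OF genY_sq _ M_def]) simp
        have "genrel E m ((fls_const 3 * genX ^ 2 + genA E) / (fls_const 2 * genY E))"
          unfolding m_def
          by (intro genrel_divide genrel_add genrel_mult genrel_power genrel_fst genrel_snd genrel_const)
            simp
        hence m: "genrel E m M" by (simp add: M_def)
        have "ae E (\<lambda>z. h z = fst z)"
          by (rule genrel_eq[OF 2(1)[unfolded True] genrel_fst])
        moreover have "ae E (\<lambda>z. g z = snd z)"
          by (rule genrel_eq[OF 2(2)[unfolded G] genrel_snd])
        moreover have "ae E (\<lambda>z. snd z \<noteq> 0)"
          by (rule genrel_nz[OF genrel_snd genY_nz])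
        ultimately have ev: "ae E (\<lambda>z. Pn (Suc n) z = Affine (m z ^ 2 - fst z - fst z)
            (m z * (fst z - (m z ^ 2 - fst z - fst z)) - snd z))"
          using 2(3)
        proof eventually_elim
          case (elim z)
          show ?case unfolding Suc_eq elim(4) elim(1,2)
            by (rule ec_add_tangent) (use elim in \<open>auto simp: m_def\<close>)
        qed
        have "inv_diff (genA E) w (1 + 1) (M ^ 2 - genX - genX)
            (M * (genX - (M ^ 2 - genX - genX)) - genY E)"
          by (rule inv_diff_tangent[OF line genY_nz fls_deriv_const base])
        hence i: "inv_diff (genA E) w (of_int 2) (M ^ 2 - genX - genX)
            (M * (genX - (M ^ 2 - genX - genX)) - genY E)"
          by simp
        have h': "genrel E (\<lambda>z. m z ^ 2 - fst z - fst z) (M ^ 2 - genX - genX)"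
          by (intro genrel_diff genrel_power m genrel_fst)
        have g': "genrel E (\<lambda>z. m z * (fst z - (m z ^ 2 - fst z - fst z)) - snd z)
            (M * (genX - (M ^ 2 - genX - genX)) - genY E)"
          by (intro genrel_diff genrel_mult genrel_power m genrel_fst genrel_snd)
        from h' g' ev i show ?thesis by blast
      qed
    qed
  qed
  thus ?case unfolding Pn_def .
qed

lemma ec_inv_Affine:
  assumes "(x, y) \<in> affine_points E"
  shows "inv\<^bsub>ec_group E\<^esub> (Affine x y) = Affine x (- y)"
  unfolding m_inv_def
proof (rule the_equality)
  fix P assume "P \<in> carrier (ec_group E) \<and> Affine x y \<otimes>\<^bsub>ec_group E\<^esub> P = \<one>\<^bsub>ec_group E\<^esub> \<and>
    P \<otimes>\<^bsub>ec_group E\<^esub> Affine x y = \<one>\<^bsub>ec_group E\<^esub>"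
  thus "P = Affine x (- y)"
    by (intro ec_add_eq_Infinity[of E x y]) simp
qed (use assms in \<open>simp add: affine_points_neg\<close>)

lemma ec_inv_Infinity: "inv\<^bsub>ec_group E\<^esub> Infinity = Infinity"
  unfolding m_inv_def by (rule the_equality) auto

lemma multiplication_scalar:
  assumes "isogeny E E \<psi>" "\<And>P. P \<in> carrier (ec_group E) \<Longrightarrow> \<psi> P = P [^]\<^bsub>ec_group E\<^esub> (n :: int)"
    and "generic_scalar E \<psi> l"
  shows "\<exists>c :: int. l = of_int c"
proof -
  define k where "k = (if n < 0 then nat (- n) else nat n)"
  have \<psi>: "ae E (\<lambda>z. \<psi> (pt z) =
      (if n < 0 then inv\<^bsub>ec_group E\<^esub> (pt z [^]\<^bsub>ec_group E\<^esub> k) else pt z [^]\<^bsub>ec_group E\<^esub> k) \<and> pt z [^]\<^bsub>ec_group E\<^esub> k \<in> carrier (ec_group E))"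
    using gen_pts_on_curve
  proof eventually_elim
    case (elim z)
    hence "pt z \<in> carrier (ec_group E)" by simp
    from assms(2)[OF this] have "\<psi> (pt z) =
        (if n < 0 then inv\<^bsub>ec_group E\<^esub> (pt z [^]\<^bsub>ec_group E\<^esub> k)
         else pt z [^]\<^bsub>ec_group E\<^esub> k)"
      unfolding int_pow_def2 k_def by (cases "n < 0") simp_all
    with ec_nat_pow_closed[OF \<open>Affine _ _ \<in> _\<close>, of k] show ?case by blast
  qed
  obtain h0 g0 where aff: "ae E (\<lambda>z. \<psi> (pt z) = Affine (h0 z) (g0 z))"
    using assms(3) unfolding generic_scalar_def by blast
  \<comment> \<open>A map with a generic scalar has affine values almost everywhere, which excludes
    the first alternative of \<open>ec_nat_pow_generic\<close>.\<close>
  have notinf: "\<not> ae E (\<lambda>z. pt z [^]\<^bsub>ec_group E\<^esub> k = Infinity)"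
  proof
    assume "ae E (\<lambda>z. pt z [^]\<^bsub>ec_group E\<^esub> k = Infinity)"
    with \<psi> aff have "ae E (\<lambda>_. False)"
    proof eventually_elim
      case (elim z)
      from elim(2) show ?case unfolding elim(1) elim(3) ec_inv_Infinity
        using elim by (metis ec_inv_Infinity point.distinct(1))
    qed
    thus False by simp
  qed
  obtain h g H G c where gen: "genrel E h H" "genrel E g G"
    "ae E (\<lambda>z. pt z [^]\<^bsub>ec_group E\<^esub> k = Affine (h z) (g z))"
    "inv_diff (genA E) (fls_deriv genX / genY E) (of_int c) H G"
    using ec_nat_pow_generic[of E k] by (elim disjE exE conjE) (erule notE[OF notinf], rule that)
  have d: "fls_deriv H * genY E = fls_const (of_int c) * G * fls_deriv genX"
    using gen(4) by (simp add: inv_diff_def fls_of_int)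
  show ?thesis
  proof (cases "n < 0")
    case True
    have "ae E (\<lambda>z. \<psi> (pt z) = Affine (h z) (- g z))"
      using \<psi> gen(3)
    proof eventually_elim
      case (elim z)
      hence "(h z, g z) \<in> affine_points E" by (metis ec_group_simps(2))
      from ec_inv_Affine[OF this] elim True show ?case by metis
    qed
    moreover have "fls_deriv H * genY E = fls_const (of_int (- c)) * (- G) * fls_deriv genX"
      unfolding d by simp
    ultimately have "generic_scalar E \<psi> (of_int (- c))"
      by (rule generic_scalarI[OF gen(1) genrel_uminus[OF gen(2)]])
    from generic_scalar_unique[OF assms(1,3) this] show ?thesis by blast
  next
    case False
    have "ae E (\<lambda>z. \<psi> (pt z) = Affine (h z) (g z))"
      using \<psi> gen(3) by eventually_elim (use False in metis)
    hence "generic_scalar E \<psi> (of_int c)"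
      by (rule generic_scalarI[OF gen(1,2) _ d])
    from generic_scalar_unique[OF assms(1,3) this] show ?thesis by blast
  qed
qed

lemma noCM_scalar:
  assumes "\<not> has_CM E" "isogeny E E \<psi>" "generic_scalar E \<psi> l"
  obtains c :: int where "l = of_int c"
  using assms multiplication_scalar[OF assms(2) _ assms(3)] unfolding has_CM_def by blast

section \<open>Conjugation by automorphisms of the algebraic closure\<close>

primrec map_pt :: "(qbar \<Rightarrow> qbar) \<Rightarrow> point \<Rightarrow> point" where
  "map_pt \<tau> Infinity = Infinity"
| "map_pt \<tau> (Affine x y) = Affine (\<tau> x) (\<tau> y)"

text \<open>Automorphisms of the full closure rather than of a number field, because they are
  applied to the coordinates of arbitrary points. They fix the rationals by
  \<open>rat_fixed\<close>.\<close>

locale qbar_aut =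
  fixes \<tau> :: "qbar \<Rightarrow> qbar"
  assumes bij: "bij \<tau>"
    and add: "\<tau> (x + y) = \<tau> x + \<tau> y"
    and mult: "\<tau> (x * y) = \<tau> x * \<tau> y"
begin

lemma one: "\<tau> 1 = 1"
proof -
  obtain e where "\<tau> e = 1" using bij_is_surj[OF bij] by (metis surjD)
  thus ?thesis using mult[of e 1] by simp
qed

sublocale ring_hom_on UNIV \<tau>
  by unfold_locales (auto simp: add mult one)

lemma polys_in_UNIV [simp]: "polys_in r"
  by (simp add: polys_in_def)

lemma eq_iff [simp]: "\<tau> x = \<tau> y \<longleftrightarrow> x = y"
  using bij by (auto simp: bij_def inj_def)

lemma eq_0_iff [simp]: "\<tau> x = 0 \<longleftrightarrow> x = 0"
  using eq_iff[of x 0] unfolding hom_zero .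

lemma divide: "\<tau> (x / y) = \<tau> x / \<tau> y"
proof (cases "y = 0")
  case False
  have "\<tau> (x / y) * \<tau> y = \<tau> x" using False by (simp flip: mult)
  thus ?thesis using False by (simp add: eq_divide_eq)
qed (simp add: hom_zero)

lemma of_nat: "\<tau> (of_nat n) = of_nat n"
  by (induction n) (auto simp: hom_zero one add)

lemma numeral: "\<tau> (numeral n) = numeral n"
  using of_nat[of "numeral n"] by simp

lemma of_int: "\<tau> (of_int n) = of_int n"
  using of_nat[of "nat n"] of_nat[of "nat (- n)"] hom_uminus[of "of_int (- n)"]
  by (cases "n \<ge> 0") simp_all

lemma of_rat: "\<tau> (of_rat r) = of_rat r"
proof (cases r)
  case (Fract a b)
  thus ?thesis by (simp add: of_rat_rat divide of_int)
qed

lemma rat_fixed: "q \<in> \<rat> \<Longrightarrow> \<tau> q = q"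
  by (auto elim!: Rats_cases simp: of_rat)

lemma map_poly_rat: "(\<And>i. Polynomial.coeff p i \<in> \<rat>) \<Longrightarrow> map_poly \<tau> p = p"
  by (intro poly_eqI) (simp add: coeff_map_poly hom_zero rat_fixed)

lemmas homs = add hom_diff mult divide hom_power one hom_zero hom_uminus numeral

abbreviation inverse_aut (\<open>\<tau>i\<close>) where
  "\<tau>i \<equiv> inv_into UNIV \<tau>"

lemma inv_aut: "qbar_aut \<tau>i"
proof
  show "bij \<tau>i" using bij by (rule bij_imp_bij_inv)
  have s: "\<tau> (\<tau>i x) = x" for x
    using bij by (simp add: bij_is_surj surj_f_inv_f)
  fix x y
  have "\<tau> (\<tau>i (x + y)) = \<tau> (\<tau>i x + \<tau>i y)" by (simp only: add s)
  thus "\<tau>i (x + y) = \<tau>i x + \<tau>i y" by simp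
  have "\<tau> (\<tau>i (x * y)) = \<tau> (\<tau>i x * \<tau>i y)" by (simp only: mult s)
  thus "\<tau>i (x * y) = \<tau>i x * \<tau>i y" by simp
qed

lemma aut_right_inverse [simp]: "\<tau> (\<tau>i x) = x"
  using bij by (simp add: bij_is_surj surj_f_inv_f)

lemma aut_left_inverse [simp]: "\<tau>i (\<tau> x) = x"
  using bij by (simp add: bij_is_inj)

lemma map_pt_inv [simp]: "map_pt \<tau> (map_pt \<tau>i P) = P" "map_pt \<tau>i (map_pt \<tau> P) = P"
  by (cases P; simp)+

lemma map_pt_add: "map_pt \<tau> (ec_add E P Q) = ec_add (conj_curve \<tau> E) (map_pt \<tau> P) (map_pt \<tau> Q)"
proof (cases P)
  case (Affine x1 y1)
  note P = this
  show ?thesis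
  proof (cases Q)
    case (Affine x2 y2)
    have "\<tau> y1 = - \<tau> y2 \<longleftrightarrow> y1 = - y2" by (simp flip: hom_uminus)
    thus ?thesis
      by (cases E) (simp add: P Affine Let_def homs)
  qed (simp add: P)
qed simp

lemma affine_points_conj [simp]:
  "(\<tau> x, \<tau> y) \<in> affine_points (conj_curve \<tau> E) \<longleftrightarrow> (x, y) \<in> affine_points E"
proof -
  have "\<tau> y ^ 2 = \<tau> x ^ 3 + \<tau> (coeff_a E) * \<tau> x + \<tau> (coeff_b E) \<longleftrightarrow>
      \<tau> (y ^ 2) = \<tau> (x ^ 3 + coeff_a E * x + coeff_b E)"
    by (simp only: homs UNIV_I)
  thus ?thesis by (simp add: affine_points_iff weierstrass.map_sel)
qed

lemma map_pt_carrier [simp]: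
  "map_pt \<tau> P \<in> carrier (ec_group (conj_curve \<tau> E)) \<longleftrightarrow> P \<in> carrier (ec_group E)"
  by (cases P) auto

lemma map_pt_inv_carrier [simp]:
  "map_pt \<tau>i P \<in> carrier (ec_group E) \<longleftrightarrow> P \<in> carrier (ec_group (conj_curve \<tau> E))"
  using map_pt_carrier[of "map_pt \<tau>i P" E] by simp

lemma map_pt_inv_add: "map_pt \<tau>i (ec_add (conj_curve \<tau> E) P Q) =
    ec_add E (map_pt \<tau>i P) (map_pt \<tau>i Q)"
  using map_pt_add[of E "map_pt \<tau>i P" "map_pt \<tau>i Q"] by (metis map_pt_inv)

lemma eventually_gen_pts_conj:
  assumes "ae E (\<lambda>z. P (\<tau> (fst z), \<tau> (snd z)))"
  shows "ae (conj_curve \<tau> E) P"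
proof -
  have "{w \<in> affine_points (conj_curve \<tau> E). \<not> P w} \<subseteq>
      (\<lambda>z. (\<tau> (fst z), \<tau> (snd z))) ` {z \<in> affine_points E. \<not> P (\<tau> (fst z), \<tau> (snd z))}"
  proof
    fix w assume w: "w \<in> {w \<in> affine_points (conj_curve \<tau> E). \<not> P w}"
    define z where "z = (\<tau>i (fst w), \<tau>i (snd w))"
    have "(\<tau> (fst z), \<tau> (snd z)) = w" by (simp add: z_def)
    thus "w \<in> (\<lambda>z. (\<tau> (fst z), \<tau> (snd z))) ` {z \<in> affine_points E. \<not> P (\<tau> (fst z), \<tau> (snd z))}"
      using w affine_points_conj[of "fst z" "snd z" E] by (intro image_eqI[of _ _ z]) auto
  qed
  thus ?thesis using assms by (simp add: eventually_gen_pts finite_subset)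
qed

text \<open>On points, applying \<tau> to the coefficients of a map amounts to this transport of
  structure; \<open>isog_form_conj\<close> makes that precise.\<close>

definition conj_map :: "(point \<Rightarrow> point) \<Rightarrow> point \<Rightarrow> point" where
  "conj_map \<phi> P = map_pt \<tau> (\<phi> (map_pt \<tau>i P))"

lemma map_pderiv: "map_poly \<tau> (pderiv p) = pderiv (map_poly \<tau> p)"
  by (intro poly_eqI) (simp add: coeff_map_poly hom_zero coeff_pderiv mult add of_nat one)

lemma map_poly_eq_0_iff [simp]: "map_poly \<tau> p = 0 \<longleftrightarrow> p = 0"
  by (intro Polynomial.map_poly_eq_0_iff) (auto simp: hom_zero)

lemma isog_form_conj:
  assumes "isog_form E \<phi> p q l"
  shows "isog_form (conj_curve \<tau> E) (conj_map \<phi>) (map_poly \<tau> p) (map_poly \<tau> q) (\<tau> l)"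
  unfolding isog_form_def
proof (intro conjI)
  show "map_poly \<tau> q \<noteq> 0" "\<tau> l \<noteq> 0" using assms by (auto simp: isog_form_def)
  have hp: "poly (map_poly \<tau> r) (\<tau> x) = \<tau> (poly r x)" for r x
    by (simp add: hom_poly)
  define W where "W = wron p q"
  have W: "pderiv (map_poly \<tau> p) * map_poly \<tau> q - map_poly \<tau> p * pderiv (map_poly \<tau> q)
      = map_poly \<tau> W"
    unfolding W_def by (simp add: map_diff map_mult map_pderiv)
  have "ae E (\<lambda>z. poly q (fst z) \<noteq> 0 \<and> \<phi> (pt z) =
      Affine (poly p (fst z) / poly q (fst z)) (1 / l * snd z * (poly W (fst z) / poly q (fst z) ^ 2)))"
    using assms by (simp add: isog_form_def W_def)
  hence "ae E (\<lambda>z. poly (map_poly \<tau> q) (\<tau> (fst z)) \<noteq> 0 \<and>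
      conj_map \<phi> (Affine (\<tau> (fst z)) (\<tau> (snd z))) =
      Affine (poly (map_poly \<tau> p) (\<tau> (fst z)) / poly (map_poly \<tau> q) (\<tau> (fst z)))
        (1 / \<tau> l * \<tau> (snd z) * (poly (map_poly \<tau> W) (\<tau> (fst z))
          / poly (map_poly \<tau> q) (\<tau> (fst z)) ^ 2)))"
  proof eventually_elim
    case (elim z)
    thus ?case by (simp add: conj_map_def hp homs)
  qed
  thus "ae (conj_curve \<tau> E) (\<lambda>z. poly (map_poly \<tau> q) (fst z) \<noteq> 0 \<and> conj_map \<phi> (pt z) =
      Affine (poly (map_poly \<tau> p) (fst z) / poly (map_poly \<tau> q) (fst z))
        (1 / \<tau> l * snd z * (poly (pderiv (map_poly \<tau> p) * map_poly \<tau> q -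
            map_poly \<tau> p * pderiv (map_poly \<tau> q)) (fst z)
          / poly (map_poly \<tau> q) (fst z) ^ 2)))"
    unfolding W by (intro eventually_gen_pts_conj) simp
qed

lemma isogeny_conj:
  assumes iso: "isogeny E E' \<phi>"
  shows "isogeny (conj_curve \<tau> E) (conj_curve \<tau> E') (conj_map \<phi>)"
proof -
  obtain p q l where form: "isog_form E \<phi> p q l"
    using isogeny_obtain_form[OF iso] by blast
  have hom: "\<phi> \<in> hom (ec_group E) (ec_group E')"
    using iso by (simp add: isogeny_over_def)
  have "conj_map \<phi> \<in> hom (ec_group (conj_curve \<tau> E)) (ec_group (conj_curve \<tau> E'))"
  proof (rule homI)
    fix P assume "P \<in> carrier (ec_group (conj_curve \<tau> E))"
    thus "conj_map \<phi> P \<in> carrier (ec_group (conj_curve \<tau> E'))"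
      using hom_in_carrier[OF hom] by (simp add: conj_map_def)
  next
    fix P Q assume "P \<in> carrier (ec_group (conj_curve \<tau> E))" "Q \<in> carrier (ec_group (conj_curve \<tau> E))"
    thus "conj_map \<phi> (P \<otimes>\<^bsub>ec_group (conj_curve \<tau> E)\<^esub> Q) =
        conj_map \<phi> P \<otimes>\<^bsub>ec_group (conj_curve \<tau> E')\<^esub> conj_map \<phi> Q"
      using Group.hom_mult[OF hom, of "map_pt \<tau>i P" "map_pt \<tau>i Q"]
      by (simp add: conj_map_def map_pt_inv_add map_pt_add)
  qed
  from isogenyI[OF this isog_form_genrel(1-3)[OF isog_form_conj[OF form]]] show ?thesis .
qed

lemma isogeny_scalar_conj:
  "isogeny_scalar E \<phi> l \<Longrightarrow> isogeny_scalar (conj_curve \<tau> E) (conj_map \<phi>) (\<tau> l)"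
  unfolding isogeny_scalar_iff using isog_form_conj by blast

end

section \<open>Descent of isogenies\<close>

text \<open>The quotient of \<open>wron p q\<close> by the square of \<open>q\<close> is the
  derivative of p / q, so it depends on the fraction only.\<close>

lemma isog_form_cong:
  assumes form: "isog_form E \<phi> p q l" and "s \<noteq> 0" and eq: "p * s = r * q"
  shows "isog_form E \<phi> r s l"
proof -
  have q: "q \<noteq> 0" and l: "l \<noteq> 0" using form by (auto simp: isog_form_def)
  have "pderiv (p * s) = pderiv (r * q)" by (simp only: eq)
  hence d: "pderiv p * s + p * pderiv s =
      pderiv r * q + r * pderiv q"
    by (simp add: pderiv_mult algebra_simps)
  have W: "(wron r s) * q ^ 2 =
      (wron p q) * s ^ 2"
    using d eq by Groebner_Basis.algebra
  have "ae E (\<lambda>z. poly q (fst z) \<noteq> 0 \<and> \<phi> (pt z) =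
       form_pt p q l z)"
    using form by (simp add: isog_form_def)
  hence "ae E (\<lambda>z. poly s (fst z) \<noteq> 0 \<and> \<phi> (pt z) =
       form_pt r s l z)"
    using eventually_poly_nz[OF \<open>s \<noteq> 0\<close>]
  proof eventually_elim
    case (elim z)
    have "poly p (fst z) * poly s (fst z) = poly r (fst z) * poly q (fst z)"
      using arg_cong[OF eq, of "\<lambda>u. poly u (fst z)"] by simp
    hence 1: "poly p (fst z) / poly q (fst z) = poly r (fst z) / poly s (fst z)"
      using elim by (simp add: frac_eq_eq)
    have "poly (wron r s) (fst z) * poly q (fst z) ^ 2 =
      poly (wron p q) (fst z) * poly s (fst z) ^ 2"
      using arg_cong[OF W, of "\<lambda>u. poly u (fst z)"] by (simp only: poly_mult poly_power)
    hence 2: "poly (wron p q) (fst z) / poly q (fst z) ^ 2 =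
      poly (wron r s) (fst z) / poly s (fst z) ^ 2"
      using elim by (subst frac_eq_eq) simp_all
    show ?case using elim unfolding 1 2 by blast
  qed
  with l \<open>s \<noteq> 0\<close> show ?thesis by (simp add: isog_form_def)
qed

lemma least_degree_poly:
  fixes P :: "qbar poly \<Rightarrow> bool"
  assumes "P p"
  obtains m where "P m" "\<And>q. P q \<Longrightarrow> Polynomial.degree m \<le> Polynomial.degree q"
proof -
  define n where "n = (LEAST n. \<exists>p. P p \<and> Polynomial.degree p = n)"
  have "\<exists>p. P p \<and> Polynomial.degree p = n"
    unfolding n_def by (rule LeastI[of _ "Polynomial.degree p"], intro exI conjI) (rule assms, rule refl)
  then obtain m where m: "P m" "Polynomial.degree m = n" by blast
  have "n \<le> Polynomial.degree q" if "P q" for q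
    unfolding n_def by (rule Least_le, intro exI conjI) (rule that, rule refl)
  with m show ?thesis by (metis that)
qed

text \<open>A monic denominator of least degree serves as lowest terms: two such pairs for one
  fraction coincide, since their difference would represent it with a smaller denominator.\<close>

lemma isog_form_reduced:
  assumes "isog_form E \<phi> p0 q0 l"
  obtains p q where "isog_form E \<phi> p q l" "lead_coeff q = 1"
    "\<And>r s. isog_form E \<phi> r s l \<Longrightarrow> Polynomial.degree q \<le> Polynomial.degree s"
proof -
  obtain q where "\<exists>p. isog_form E \<phi> p q l"
    and least: "\<And>s. \<exists>r. isog_form E \<phi> r s l \<Longrightarrow> Polynomial.degree q \<le> Polynomial.degree s"
    by (rule least_degree_poly[of "\<lambda>q. \<exists>p. isog_form E \<phi> p q l" q0]) (use assms in blast)+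
  then obtain p where form: "isog_form E \<phi> p q l" by blast
  have "q \<noteq> 0" using form by (simp add: isog_form_def)
  define c where "c = inverse (lead_coeff q)"
  have c: "c \<noteq> 0" using \<open>q \<noteq> 0\<close> by (simp add: c_def)
  have "isog_form E \<phi> (Polynomial.smult c p) (Polynomial.smult c q) l"
    by (rule isog_form_cong[OF form]) (use c \<open>q \<noteq> 0\<close> in simp_all)
  moreover have "lead_coeff (Polynomial.smult c q) = 1"
    using \<open>q \<noteq> 0\<close> by (simp add: c_def)
  moreover have "Polynomial.degree (Polynomial.smult c q) \<le> Polynomial.degree s"
    if "isog_form E \<phi> r s l" for r s
    using least[of s] that c by auto
  ultimately show ?thesis by (rule that)
qed

lemma isogeny_descent:
  assumes iso: "isogeny E E' \<phi>" and scalar: "isogeny_scalar E \<phi> l" and l: "l \<in> K"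
    and K: "0 \<in> K" "1 \<in> K" "\<And>x y. x \<in> K \<Longrightarrow> y \<in> K \<Longrightarrow> x - y \<in> K"
      "\<And>x y. x \<in> K \<Longrightarrow> y \<in> K \<Longrightarrow> x * y \<in> K" "\<And>x. x \<in> K \<Longrightarrow> inverse x \<in> K"
    and E: "coeff_a E \<in> K" "coeff_b E \<in> K" and E': "coeff_a E' \<in> K" "coeff_b E' \<in> K"
    and fixed: "\<And>x. (\<And>\<tau>. qbar_aut \<tau> \<Longrightarrow> (\<And>k. k \<in> K \<Longrightarrow> \<tau> k = k) \<Longrightarrow> \<tau> x = x) \<Longrightarrow> x \<in> K"
  shows "isogeny_over K E E' \<phi>"
proof -
  obtain p0 q0 where "isog_form E \<phi> p0 q0 l"
    using scalar by (auto simp: isogeny_scalar_iff)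
  then obtain p q where form: "isog_form E \<phi> p q l" and monic: "lead_coeff q = 1"
    and min: "\<And>r s. isog_form E \<phi> r s l \<Longrightarrow> Polynomial.degree q \<le> Polynomial.degree s"
    by (rule isog_form_reduced) blast
  have q: "q \<noteq> 0" and l0: "l \<noteq> 0" using form by (auto simp: isog_form_def)
  have inv: "map_poly \<tau> p = p \<and> map_poly \<tau> q = q"
    if "qbar_aut \<tau>" and fixK: "\<And>k. k \<in> K \<Longrightarrow> \<tau> k = k" for \<tau>
  proof -
    interpret qbar_aut \<tau> by fact
    have "conj_curve \<tau> E = E" "conj_curve \<tau> E' = E'"
      using E E' fixK by (auto intro!: weierstrass.expand simp: weierstrass.map_sel)
    hence c: "isogeny E E' (conj_map \<phi>)" "isog_form E (conj_map \<phi>) (map_poly \<tau> p) (map_poly \<tau> q) l"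
      using isogeny_conj[OF iso] isog_form_conj[OF form] fixK[OF l] by auto
    have eq: "p * map_poly \<tau> q = map_poly \<tau> p * q"
      by (rule isog_form_unique[OF iso c(1) form c(2)])
    have "map_poly \<tau> q = q"
    proof (rule ccontr)
      assume ne: "map_poly \<tau> q \<noteq> q"
      have deg: "Polynomial.degree (map_poly \<tau> q) = Polynomial.degree q"
        by (rule degree_map_poly) simp
      have lc: "lead_coeff (map_poly \<tau> q) = 1"
        unfolding deg using monic by (simp add: coeff_map_poly hom_zero one)
      \<comment> \<open>By \<open>eq\<close>, r / s is again the fraction p / q. Both denominators
        are monic of the same degree, so \<open>s\<close> has smaller degree than \<open>q\<close>,
        against minimality.\<close>
      define s where "s = q - map_poly \<tau> q"
      define r where "r = p - map_poly \<tau> p"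
      have s: "s \<noteq> 0" using ne by (simp add: s_def)
      have "isog_form E \<phi> r s l"
        by (rule isog_form_cong[OF form s]) (use eq in \<open>simp add: r_def s_def algebra_simps\<close>)
      hence ge: "Polynomial.degree q \<le> Polynomial.degree s" by (rule min)
      have "Polynomial.coeff s (Polynomial.degree q) = 0"
        using monic lc by (simp add: s_def deg)
      moreover have "Polynomial.degree s \<le> Polynomial.degree q"
        unfolding s_def by (rule degree_diff_le) (use deg in auto)
      ultimately show False using ge s by (metis le_antisym leading_coeff_0_iff)
    qed
    with eq q show ?thesis by simp
  qed
  have in_K: "Polynomial.coeff p i \<in> K" "Polynomial.coeff q i \<in> K" for i
  proof -
    have "\<tau> (Polynomial.coeff p i) = Polynomial.coeff p i"
      "\<tau> (Polynomial.coeff q i) = Polynomial.coeff q i"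
      if "qbar_aut \<tau>" "\<And>k. k \<in> K \<Longrightarrow> \<tau> k = k" for \<tau>
    proof -
      interpret qbar_aut \<tau> by fact
      from inv[OF that] have "Polynomial.coeff (map_poly \<tau> p) i = Polynomial.coeff p i"
        "Polynomial.coeff (map_poly \<tau> q) i = Polynomial.coeff q i" by auto
      thus "\<tau> (Polynomial.coeff p i) = Polynomial.coeff p i"
        "\<tau> (Polynomial.coeff q i) = Polynomial.coeff q i"
        by (simp_all add: coeff_map_poly hom_zero)
    qed
    thus "Polynomial.coeff p i \<in> K" "Polynomial.coeff q i \<in> K" by (auto intro!: fixed)
  qed
  have um: "- x \<in> K" if "x \<in> K" for x using K(3)[OF K(1) that] by simp
  have pl: "x + y \<in> K" if "x \<in> K" "y \<in> K" for x y using K(3)[OF that(1) um[OF that(2)]] by simp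
  interpret K: ring_hom_on K id
    by unfold_locales (use K um pl in auto)
  have nat: "of_nat n \<in> K" for n
    by (induction n) (use K pl in auto)
  have dK: "K.polys_in (pderiv u)" if "K.polys_in u" for u
    unfolding K.polys_in_def coeff_pderiv
    using that nat K(4) by (auto simp: K.polys_in_def simp del: of_nat_Suc)
  have pq: "K.polys_in p" "K.polys_in q" using in_K by (auto simp: K.polys_in_def)
  \<comment> \<open>The second coordinate is y * W / q^2. Absorbing the factor 1 / l into
    \<open>W\<close> keeps its coefficients in \<open>K\<close> because \<open>l\<close> lies in
    \<open>K\<close>.\<close>
  define W where "W = Polynomial.smult (inverse l) (wron p q)"
  have W: "K.polys_in W"
    unfolding W_def by (intro K.polys_in_smult K.polys_in_diff K.polys_in_mult dK pq K(5) l)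
  have q2: "K.polys_in (q ^ 2)"
    unfolding power2_eq_square by (intro K.polys_in_mult pq)
  have const: "coeffs_in K [:u:]" "coeffs_in K [:0, u:]" if "K.polys_in u" for u
    using that K(1) by (auto simp: coeffs_in_def K.polys_in_def coeff_pCons split: nat.splits)
  have ev: "eval2 [:u:] x y = poly u x" "eval2 [:0, u:] x y = y * poly u x" for u x y
    by (auto simp: eval2_def)
  have "ae E (\<lambda>z. poly q (fst z) \<noteq> 0 \<and> \<phi> (pt z) =
       form_pt p q l z)"
    using form by (simp add: isog_form_def)
  hence "ae E (\<lambda>z. eval2 [:q:] (fst z) (snd z) \<noteq> 0 \<and> eval2 [:q ^ 2:] (fst z) (snd z) \<noteq> 0 \<and>
    \<phi> (pt z) = Affine (eval2 [:p:] (fst z) (snd z) / eval2 [:q:] (fst z) (snd z))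
     (eval2 [:0, W:] (fst z) (snd z) / eval2 [:q ^ 2:] (fst z) (snd z)))"
  proof eventually_elim
    case (elim z)
    have "1 / l * snd z * (poly (wron p q) (fst z)
            / poly q (fst z) ^ 2) = snd z * poly W (fst z) / poly (q ^ 2) (fst z)"
      unfolding W_def poly_smult poly_power by (simp add: divide_inverse mult_ac)
    thus ?case using elim unfolding ev by simp
  qed
  hence "finite {(x, y) \<in> affine_points E. \<not> (eval2 [:q:] x y \<noteq> 0 \<and> eval2 [:q ^ 2:] x y \<noteq> 0 \<and>
    \<phi> (Affine x y) = Affine (eval2 [:p:] x y / eval2 [:q:] x y)
      (eval2 [:0, W:] x y / eval2 [:q ^ 2:] x y))}"
    unfolding eventually_gen_pts by (rule back_subst[of finite]) auto
  hence "rational_map_over K E \<phi>"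
    unfolding rational_map_over_def using const(1)[OF pq(1)] const(1)[OF pq(2)] const(2)[OF W] const(1)[OF q2]
    by blast
  with iso show ?thesis by (simp add: isogeny_over_def)
qed

section \<open>Extension of embeddings\<close>

lemma to_ac_rat: "to_ac r = (of_rat r :: qbar)"
proof (cases r)
  case (Fract a b)
  thus ?thesis by (simp add: Fract_of_int_quotient of_rat_divide)
qed

lemma qbar_algebraic:
  fixes x :: qbar
  obtains p :: "qbar poly" where "p \<noteq> 0" "\<And>i. Polynomial.coeff p i \<in> \<rat>" "poly p x = 0"
proof -
  obtain p :: "rat poly" where p: "p \<noteq> 0" "poly (map_poly to_ac p) x = 0"
    by (rule alg_closure_algebraic)
  show ?thesis
  proof (rule that)
    show "map_poly to_ac p \<noteq> 0"
      using p(1) by (simp add: Polynomial.map_poly_eq_0_iff)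
    show "Polynomial.coeff (map_poly to_ac p) i \<in> \<rat>" for i
      by (simp add: coeff_map_poly to_ac_rat)
  qed fact
qed

text \<open>
  Partial embeddings are represented by their graphs, so that chains have unions. Since every element
  is algebraic over the rationals, a subring that contains the rationals is a field.
\<close>
definition embedding_graph :: "(qbar \<times> qbar) set \<Rightarrow> bool" where
  "embedding_graph G \<longleftrightarrow>
     (\<forall>r. (of_rat r, of_rat r) \<in> G) \<and>
     (\<forall>x x' y y'. (x, x') \<in> G \<longrightarrow> (y, y') \<in> G \<longrightarrow> (x - y, x' - y') \<in> G \<and> (x * y, x' * y') \<in> G) \<and>
     (\<forall>y. (0, y) \<in> G \<longrightarrow> y = 0)"

locale subring_hom = ring_hom_on F \<tau> for F :: "qbar set" and \<tau> :: "qbar \<Rightarrow> qbar" +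
  assumes rat_mem: "\<rat> \<subseteq> F"
begin

text \<open>Write a nonzero rational polynomial of least degree vanishing at \<open>z\<close> as c +
  x * m'. Minimality gives \<open>c \<noteq> 0\<close>, and the inverse of \<open>z\<close> is then
  -m'(z) / c, a polynomial expression in \<open>z\<close>.\<close>

lemma inverse_mem:
  assumes "z \<in> F"
  shows "inverse z \<in> F"
proof (cases "z = 0")
  case False
  obtain p0 :: "qbar poly" where "p0 \<noteq> 0" "\<And>i. Polynomial.coeff p0 i \<in> \<rat>" "poly p0 z = 0"
    by (rule qbar_algebraic[of z]) blast
  hence "p0 \<noteq> 0 \<and> polys_in p0 \<and> poly p0 z = 0" using rat_mem by (auto simp: polys_in_def)
  hence "p0 \<noteq> 0 \<and> (\<forall>i. Polynomial.coeff p0 i \<in> \<rat>) \<and> poly p0 z = 0"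
    using \<open>\<And>i. Polynomial.coeff p0 i \<in> \<rat>\<close> by blast
  then obtain m where m: "m \<noteq> 0 \<and> (\<forall>i. Polynomial.coeff m i \<in> \<rat>) \<and> poly m z = 0"
    and least: "\<And>q. q \<noteq> 0 \<and> (\<forall>i. Polynomial.coeff q i \<in> \<rat>) \<and> poly q z = 0 \<Longrightarrow>
      Polynomial.degree m \<le> Polynomial.degree q"
    by (rule least_degree_poly) blast
  obtain c m' where c: "m = pCons c m'" by (cases m)
  have cr: "c \<in> \<rat>" "\<And>i. Polynomial.coeff m' i \<in> \<rat>"
    using m by (metis c coeff_pCons_0, metis c coeff_pCons_Suc m)
  have eq: "c + z * poly m' z = 0" using m by (simp add: c)
  have "c \<noteq> 0"
  proof
    assume "c = 0"
    hence "m' \<noteq> 0" "poly m' z = 0" using m c eq False by auto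
    hence "Polynomial.degree m \<le> Polynomial.degree m'" using cr(2) by (intro least) blast
    thus False using c \<open>m' \<noteq> 0\<close> by simp
  qed
  hence "z * (poly m' z * (- inverse c)) = 1"
    using eq by (simp add: field_simps add_eq_0_iff)
  hence "inverse z = poly m' z * (- inverse c)" by (rule inverse_unique)
  moreover have "polys_in m'" using cr(2) rat_mem by (auto simp: polys_in_def)
  moreover have "- inverse c \<in> F" using cr(1) rat_mem by auto
  ultimately show ?thesis using assms by (metis mult_mem poly_mem)
qed (simp add: zero_mem)

lemma minimal_poly:
  fixes x :: qbar
  obtains m where "polys_in m" "lead_coeff m = 1" "poly m x = 0"
    "\<And>p. polys_in p \<Longrightarrow> p \<noteq> 0 \<Longrightarrow> poly p x = 0 \<Longrightarrow> Polynomial.degree m \<le> Polynomial.degree p"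
proof -
  obtain p0 :: "qbar poly" where "p0 \<noteq> 0" "\<And>i. Polynomial.coeff p0 i \<in> \<rat>" "poly p0 x = 0"
    by (rule qbar_algebraic[of x]) blast
  hence "polys_in p0 \<and> p0 \<noteq> 0 \<and> poly p0 x = 0" using rat_mem by (auto simp: polys_in_def)
  then obtain m where m: "polys_in m \<and> m \<noteq> 0 \<and> poly m x = 0"
    and least: "\<And>q. polys_in q \<and> q \<noteq> 0 \<and> poly q x = 0 \<Longrightarrow> Polynomial.degree m \<le> Polynomial.degree q"
    by (rule least_degree_poly) blast
  define c where "c = inverse (lead_coeff m)"
  have c: "c \<noteq> 0" "c \<in> F"
    using m inverse_mem by (auto simp: c_def polys_in_def)
  show ?thesis
  proof (rule that)
    show "polys_in (Polynomial.smult c m)" using m c by (simp add: polys_in_smult)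
    show "lead_coeff (Polynomial.smult c m) = 1" using m by (simp add: c_def)
    show "poly (Polynomial.smult c m) x = 0" using m by simp
    show "Polynomial.degree (Polynomial.smult c m) \<le> Polynomial.degree p"
      if "polys_in p" "p \<noteq> 0" "poly p x = 0" for p
      using least[of p] that c by simp
  qed
qed

lemma polys_in_monom: "c \<in> F \<Longrightarrow> polys_in (Polynomial.monom c n)"
  by (simp add: polys_in_def zero_mem)

text \<open>Division by the monic \<open>m\<close>, one leading term at a time: every polynomial
  over \<open>F\<close> vanishing at \<open>x\<close> is a multiple of \<open>m\<close>, and so its
  image vanishes at every root of the image of \<open>m\<close>.\<close>

lemma conjugate_root:
  assumes m: "polys_in m" "lead_coeff m = 1" "\<And>p. polys_in p \<Longrightarrow> p \<noteq> 0 \<Longrightarrow> poly p x = 0 \<Longrightarrow>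
      Polynomial.degree m \<le> Polynomial.degree p"
    and root: "poly m x = 0" "poly (map_poly \<tau> m) x' = 0"
    and p: "polys_in p" "poly p x = 0"
  shows "poly (map_poly \<tau> p) x' = 0"
  using p
proof (induction "Polynomial.degree p" arbitrary: p rule: less_induct)
  case less
  show ?case
  proof (cases "p = 0")
    case False
    define n where "n = Polynomial.degree p"
    define c where "c = lead_coeff p"
    define t where "t = Polynomial.monom c (n - Polynomial.degree m)"
    have le: "Polynomial.degree m \<le> n"
      unfolding n_def using m(3)[of p] less False by blast
    have "c \<in> F" using less by (simp add: c_def polys_in_def)
    hence t: "polys_in t" unfolding t_def by (rule polys_in_monom)
    define p1 where "p1 = p - t * m"
    have p1: "polys_in p1" "poly p1 x = 0"
      using less t m(1) root by (auto simp: p1_def intro!: polys_in_diff polys_in_mult)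
    have "c \<noteq> 0" using False by (simp add: c_def)
    have "m \<noteq> 0" using m(2) by auto
    have "t \<noteq> 0" using \<open>c \<noteq> 0\<close> by (simp add: t_def)
    have deg: "Polynomial.degree (t * m) = n"
      using \<open>m \<noteq> 0\<close> \<open>t \<noteq> 0\<close> le \<open>c \<noteq> 0\<close> by (simp add: degree_mult_eq t_def degree_monom_eq)
    have "lead_coeff (t * m) = c"
      using m(2) \<open>c \<noteq> 0\<close> by (simp add: lead_coeff_mult t_def degree_monom_eq)
    hence "Polynomial.coeff p1 n = 0"
      by (simp add: p1_def deg c_def n_def)
    moreover have "Polynomial.degree p1 \<le> n"
      unfolding p1_def by (rule degree_diff_le) (use deg n_def in auto)
    ultimately have "p1 = 0 \<or> Polynomial.degree p1 < n"
      by (intro eq_zero_or_degree_less)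
    hence "poly (map_poly \<tau> p1) x' = 0"
      using less(1)[of p1] p1 by (auto simp: n_def)
    moreover have "p = p1 + t * m" by (simp add: p1_def)
    ultimately show ?thesis
      using p1 t m(1) root(2) by (simp add: map_add map_mult polys_in_mult)
  qed simp
qed

text \<open>The assignment p(x) to (\<tau> p)(x') on the ring generated by \<open>x\<close> over
  \<open>F\<close>. As a graph it can be written down without choosing \<open>p\<close>; the premise
  \<open>conj\<close> is precisely its single-valuedness.\<close>

lemma extend_graph:
  assumes conj: "\<forall>p. polys_in p \<longrightarrow> poly p x = 0 \<longrightarrow> poly (map_poly \<tau> p) x' = 0"
    and rat: "\<And>r. \<tau> (of_rat r) = of_rat r"
  obtains G where "embedding_graph G" "\<And>z. z \<in> F \<Longrightarrow> (z, \<tau> z) \<in> G" "(x, x') \<in> G"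
proof -
  define G where "G = {(poly p x, poly (map_poly \<tau> p) x') |p. polys_in p}"
  have GI: "(u, v) \<in> G" if "polys_in p" "u = poly p x" "v = poly (map_poly \<tau> p) x'" for u v p
    using that by (auto simp: G_def)
  show ?thesis
  proof (rule that)
    show "(z, \<tau> z) \<in> G" if "z \<in> F" for z
      by (rule GI[of "[:z:]"]) (use that in auto)
    show "(x, x') \<in> G"
      by (rule GI[of "[:0, 1:]"]) (auto simp: zero_mem one_mem hom_zero hom_one)
    show "embedding_graph G"
      unfolding embedding_graph_def
    proof (intro conjI allI impI)
      show "(of_rat r, of_rat r) \<in> G" for r
        by (rule GI[of "[:of_rat r:]"]) (use rat_mem in \<open>auto simp: rat\<close>)
      fix y assume "(0, y) \<in> G"
      thus "y = 0" using conj by (auto simp: G_def)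
    next
      fix u u' v v' assume "(u, u') \<in> G" "(v, v') \<in> G"
      then obtain p q where pq: "polys_in p" "polys_in q" "u = poly p x" "v = poly q x"
        "u' = poly (map_poly \<tau> p) x'" "v' = poly (map_poly \<tau> q) x'" by (auto simp: G_def)
      show "(u - v, u' - v') \<in> G"
        by (rule GI[of "p - q"]) (use pq in \<open>auto simp: map_diff intro!: polys_in_diff\<close>)
      show "(u * v, u' * v') \<in> G"
        by (rule GI[of "p * q"]) (use pq in \<open>auto simp: map_mult intro!: polys_in_mult\<close>)
    qed
  qed
qed

end

lemma embedding_graph_hom:
  assumes "embedding_graph G"
  obtains \<tau> where "subring_hom (Domain G) \<tau>" "\<And>x y. (x, y) \<in> G \<Longrightarrow> \<tau> x = y"
    "\<And>r. \<tau> (of_rat r) = of_rat r"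
proof -
  define \<tau> where "\<tau> = (\<lambda>x. THE y. (x, y) \<in> G)"
  have G: "(of_rat r, of_rat r) \<in> G"
    "(x, x') \<in> G \<Longrightarrow> (y, y') \<in> G \<Longrightarrow> (x - y, x' - y') \<in> G"
    "(x, x') \<in> G \<Longrightarrow> (y, y') \<in> G \<Longrightarrow> (x * y, x' * y') \<in> G"
    "(0, y) \<in> G \<Longrightarrow> y = 0" for x x' y y' r
    using assms(1) unfolding embedding_graph_def by blast+
  have uniq: "y = y'" if "(x, y) \<in> G" "(x, y') \<in> G" for x y y'
    using G(2)[OF that] G(4)[of "y - y'"] by simp
  have \<tau>: "\<tau> x = y" if "(x, y) \<in> G" for x y
    unfolding \<tau>_def using that uniq by blast
  have mem: "(x, \<tau> x) \<in> G" if "x \<in> Domain G" for x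
    using that \<tau> by auto
  have rat: "\<tau> (of_rat r) = of_rat r" for r
    by (rule \<tau>) (rule G)
  have G01: "(0, 0) \<in> G" "(1, 1) \<in> G" using G(1)[of 0] G(1)[of 1] by auto
  have neg: "(- x, - y) \<in> G" if "(x, y) \<in> G" for x y using G(2)[OF G01(1) that] by simp
  have add: "(x + y, x' + y') \<in> G" if "(x, x') \<in> G" "(y, y') \<in> G" for x x' y y'
    using G(2)[OF that(1) neg[OF that(2)]] by simp
  have "subring_hom (Domain G) \<tau>"
  proof
    show "0 \<in> Domain G" "1 \<in> Domain G" using G01 by blast+
    show "\<tau> 1 = 1" by (rule \<tau>) (rule G01)
    show "\<rat> \<subseteq> Domain G" using G(1) by (auto elim!: Rats_cases)
    fix x assume x: "x \<in> Domain G"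
    show "- x \<in> Domain G" using neg[OF mem[OF x]] by blast
    fix y assume y: "y \<in> Domain G"
    show "x + y \<in> Domain G" using add[OF mem[OF x] mem[OF y]] by blast
    show "x * y \<in> Domain G" using G(3)[OF mem[OF x] mem[OF y]] by blast
    show "\<tau> (x + y) = \<tau> x + \<tau> y" by (rule \<tau>) (rule add[OF mem[OF x] mem[OF y]])
    show "\<tau> (x * y) = \<tau> x * \<tau> y" by (rule \<tau>) (rule G(3)[OF mem[OF x] mem[OF y]])
  qed
  thus ?thesis using \<tau> rat by (rule that)
qed

text \<open>A maximal graph, obtained by Zorn, is defined everywhere: an element \<open>x\<close>
  outside its domain could be sent to a root of the image of its minimal polynomial, which exists
  because the closure is algebraically closed.\<close>

theorem embedding_extends:
  assumes "embedding_graph G0"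
  obtains \<tau> where "qbar_aut \<tau>" "\<And>x y. (x, y) \<in> G0 \<Longrightarrow> \<tau> x = y"
proof -
  define A where "A = {G. embedding_graph G \<and> G0 \<subseteq> G}"
  have "\<exists>M\<in>A. \<forall>Y\<in>A. M \<subseteq> Y \<longrightarrow> Y = M"
  proof (rule subset_Zorn_nonempty)
    show "A \<noteq> {}" using assms by (auto simp: A_def)
    fix C assume C: "C \<noteq> {}" "subset.chain A C"
    have CA: "\<And>G. G \<in> C \<Longrightarrow> embedding_graph G \<and> G0 \<subseteq> G"
      using C(2) by (auto simp: A_def subset.chain_def)
    have two: "\<exists>G\<in>C. a \<in> G \<and> b \<in> G" if "a \<in> \<Union>C" "b \<in> \<Union>C" for a b
      using that subset.chain_total[OF C(2)] by blast
    have "embedding_graph (\<Union>C)"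
      unfolding embedding_graph_def
    proof (intro conjI allI impI)
      show "(of_rat r, of_rat r) \<in> \<Union>C" for r
        using C(1) CA unfolding embedding_graph_def by blast
      show "y = 0" if "(0, y) \<in> \<Union>C" for y
        using that CA unfolding embedding_graph_def by blast
      fix x x' y y' assume "(x, x') \<in> \<Union>C" "(y, y') \<in> \<Union>C"
      then obtain G where "G \<in> C" "(x, x') \<in> G" "(y, y') \<in> G" using two by blast
      thus "(x - y, x' - y') \<in> \<Union>C" "(x * y, x' * y') \<in> \<Union>C"
        using CA unfolding embedding_graph_def by blast+
    qed
    moreover have "G0 \<subseteq> \<Union>C" using C(1) CA by blast
    ultimately show "\<Union>C \<in> A" by (simp add: A_def)
  qed
  then obtain M where MA: "M \<in> A" and maxA: "\<And>Y. Y \<in> A \<Longrightarrow> M \<subseteq> Y \<Longrightarrow> Y = M"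
    by (metis (no_types, lifting))
  have M: "embedding_graph M" "G0 \<subseteq> M" using MA by (simp_all add: A_def)
  have max: "Y = M" if "embedding_graph Y" "M \<subseteq> Y" for Y
    by (rule maxA) (use that M(2) in \<open>auto simp: A_def\<close>)
  obtain \<tau> where hom: "subring_hom (Domain M) \<tau>" "\<And>x y. (x, y) \<in> M \<Longrightarrow> \<tau> x = y"
    "\<And>r. \<tau> (of_rat r) = of_rat r"
    by (rule embedding_graph_hom[OF M(1)]) blast
  interpret subring_hom "Domain M" \<tau> by (rule hom)
  have UNIV: "Domain M = UNIV"
  proof (rule ccontr)
    assume "Domain M \<noteq> UNIV"
    then obtain x where x: "x \<notin> Domain M" by blast
    obtain m where m: "polys_in m" "lead_coeff m = 1" "poly m x = 0"
      "\<And>p. polys_in p \<Longrightarrow> p \<noteq> 0 \<Longrightarrow> poly p x = 0 \<Longrightarrow> Polynomial.degree m \<le> Polynomial.degree p"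
      by (rule minimal_poly[of x]) blast
    have "Polynomial.degree (map_poly \<tau> m) = Polynomial.degree m"
      by (rule map_poly_degree_eq) (use m(2) hom_one in simp)
    moreover have "Polynomial.degree m \<noteq> 0"
    proof
      assume "Polynomial.degree m = 0"
      then obtain c where "m = [:c:]" by (metis degree_0_id)
      thus False using m(2,3) by simp
    qed
    ultimately obtain x' where x': "poly (map_poly \<tau> m) x' = 0"
      using alg_closed_imp_poly_has_root[of "map_poly \<tau> m"] by auto
    obtain G where G: "embedding_graph G" "\<And>z. z \<in> Domain M \<Longrightarrow> (z, \<tau> z) \<in> G" "(x, x') \<in> G"
      using extend_graph[OF _ hom(3), of x x'] conjugate_root[OF m(1,2,4,3) x'] by blast
    have "M \<subseteq> G"
    proof (rule subrelI)
      fix u v assume "(u, v) \<in> M"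
      thus "(u, v) \<in> G" using G(2)[of u] hom(2)[of u v] by auto
    qed
    hence "G = M" by (intro max G(1))
    thus False using G(3) x by blast
  qed
  have inj: "\<tau> x = \<tau> y \<longleftrightarrow> x = y" for x y
  proof
    assume "\<tau> x = \<tau> y"
    hence z: "\<tau> (x - y) = 0" by (simp add: hom_diff UNIV)
    show "x = y"
    proof (rule ccontr)
      assume "x \<noteq> y"
      hence "\<tau> ((x - y) * inverse (x - y)) = 1" by (simp add: hom_one)
      thus False using z by (simp add: hom_mult UNIV)
    qed
  qed simp
  \<comment> \<open>\<tau> maps the finite set of roots of a rational polynomial injectively into
    itself, hence onto; \<open>y\<close> is such a root.\<close>
  have surj: "\<exists>x. \<tau> x = y" for y
  proof -
    obtain p :: "qbar poly" where p: "p \<noteq> 0" "\<And>i. Polynomial.coeff p i \<in> \<rat>" "poly p y = 0"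
      by (rule qbar_algebraic[of y]) blast
    have map_p: "map_poly \<tau> p = p"
    proof (rule poly_eqI)
      fix i
      obtain r where "Polynomial.coeff p i = of_rat r" using p(2)[of i] by (rule Rats_cases)
      thus "Polynomial.coeff (map_poly \<tau> p) i = Polynomial.coeff p i"
        by (simp add: coeff_map_poly hom_zero hom(3))
    qed
    define R where "R = {x. poly p x = 0}"
    have "finite R" using p(1) by (simp add: R_def poly_roots_finite)
    moreover have "\<tau> ` R \<subseteq> R"
    proof
      fix w assume "w \<in> \<tau> ` R"
      then obtain x where x: "poly p x = 0" "w = \<tau> x" by (auto simp: R_def)
      have "\<tau> (poly p x) = poly (map_poly \<tau> p) (\<tau> x)"
        by (rule hom_poly) (auto simp: polys_in_def UNIV)
      thus "w \<in> R" using x map_p by (simp add: R_def hom_zero)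
    qed
    moreover have "inj_on \<tau> R" using inj by (auto simp: inj_on_def)
    ultimately have "\<tau> ` R = R" by (rule endo_inj_surj)
    moreover have "y \<in> R" using p(3) by (simp add: R_def)
    ultimately have "y \<in> \<tau> ` R" by (simp only:)
    thus ?thesis by (metis imageE)
  qed
  have "qbar_aut \<tau>"
  proof
    show "bij \<tau>" unfolding bij_def inj_def surj_def using inj surj by metis
  qed (simp_all add: hom_add hom_mult UNIV)
  thus ?thesis using that hom(2) M(2) by blast
qed

text \<open>If \<open>x\<close> is not in \<open>K\<close>, its minimal polynomial over
  \<open>K\<close> has degree at least 2. In characteristic 0 the root \<open>x\<close> is simple,
  so there is a second root, and the embedding over \<open>K\<close> that sends \<open>x\<close>
  there extends to an automorphism moving \<open>x\<close>.\<close>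

lemma fixed_field:
  assumes rat: "\<rat> \<subseteq> K" and K: "\<And>x y. x \<in> K \<Longrightarrow> y \<in> K \<Longrightarrow> x - y \<in> K"
      "\<And>x y. x \<in> K \<Longrightarrow> y \<in> K \<Longrightarrow> x * y \<in> K"
    and fixed: "\<And>\<tau>. qbar_aut \<tau> \<Longrightarrow> (\<And>k. k \<in> K \<Longrightarrow> \<tau> k = k) \<Longrightarrow> \<tau> x = x"
  shows "x \<in> K"
proof (rule ccontr)
  assume x: "x \<notin> K"
  have K01: "0 \<in> K" "1 \<in> K" using rat by auto
  have um: "- u \<in> K" if "u \<in> K" for u using K(1)[OF K01(1) that] by simp
  have pl: "u + v \<in> K" if "u \<in> K" "v \<in> K" for u v using K(1)[OF that(1) um[OF that(2)]] by simp
  interpret subring_hom K id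
    by unfold_locales (simp_all add: K01 um pl K(2) rat)
  obtain m where m: "polys_in m" "lead_coeff m = 1" "poly m x = 0"
      "\<And>p. polys_in p \<Longrightarrow> p \<noteq> 0 \<Longrightarrow> poly p x = 0 \<Longrightarrow> Polynomial.degree m \<le> Polynomial.degree p"
    by (rule minimal_poly[of x]) blast
  obtain h where h: "m = [:- x, 1:] * h"
    using m(3) unfolding poly_eq_0_iff_dvd dvd_def by blast
  have "h \<noteq> 0" using h m(2) by auto
  have dm: "Polynomial.degree m = Suc (Polynomial.degree h)"
    unfolding h using \<open>h \<noteq> 0\<close> by (subst degree_mult_eq) auto
  have "Polynomial.degree h \<noteq> 0"
  proof
    assume "Polynomial.degree h = 0"
    then obtain c where c: "h = [:c:]" by (metis degree_0_id)
    have "m = [:- x * c, c:]" unfolding h c by simp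
    moreover have "c \<noteq> 0" using \<open>h \<noteq> 0\<close> c by simp
    ultimately have "Polynomial.coeff m 0 = - x" using m(2) by simp
    thus False using m(1) x um[of "- x"] unfolding polys_in_def by (metis add.inverse_inverse)
  qed
  then obtain x' where x': "poly h x' = 0"
    using alg_closed_imp_poly_has_root[of h] by auto
  have "poly h x \<noteq> 0"
  proof
    assume "poly h x = 0"
    hence "poly (pderiv m) x = 0"
      unfolding h by (simp add: pderiv_mult pderiv_pCons del: mult_pCons_left)
    moreover have "polys_in (pderiv m)"
    proof -
      have "of_nat n \<in> K" for n using rat by auto
      thus ?thesis using m(1) unfolding polys_in_def coeff_pderiv by (blast intro: K(2))
    qed
    moreover have "pderiv m \<noteq> 0"
      using dm by (simp add: pderiv_eq_0_iff)
    ultimately have "Polynomial.degree m \<le> Polynomial.degree (pderiv m)"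
      by (intro m(4))
    thus False using dm by (simp add: degree_pderiv)
  qed
  hence "x' \<noteq> x" using x' by auto
  have root: "poly (map_poly id m) x' = 0" using x' by (simp add: h)
  have rat_id: "id (of_rat r) = (of_rat r :: qbar)" for r by simp
  obtain G where G: "embedding_graph G" "\<And>z. z \<in> K \<Longrightarrow> (z, id z) \<in> G" "(x, x') \<in> G"
    using extend_graph[OF _ rat_id, of x x'] conjugate_root[OF m(1,2,4,3) root] by blast
  obtain \<tau> where \<tau>: "qbar_aut \<tau>" "\<And>x y. (x, y) \<in> G \<Longrightarrow> \<tau> x = y"
    by (rule embedding_extends[OF G(1)]) blast
  have "\<tau> k = k" if "k \<in> K" for k
    using \<tau>(2)[OF G(2)[OF that]] by simp
  hence "\<tau> x = x" by (rule fixed[OF \<tau>(1)])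
  moreover have "\<tau> x = x'" by (rule \<tau>(2)[OF G(3)])
  ultimately show False using \<open>x' \<noteq> x\<close> by simp
qed

section \<open>Subfields of the algebraic closure\<close>

interpretation qbar: cring qbar_ring
  by (rule cring_from_type_algebra)

lemma qbar_ring_simps [simp]:
  "carrier qbar_ring = UNIV" "monoid.mult qbar_ring = (*)" "monoid.one qbar_ring = 1"
  "ring.zero qbar_ring = 0" "ring.add qbar_ring = (+)"
  by (auto simp: ring_of_type_algebra_def)

lemma qbar_ring_a_inv [simp]: "\<ominus>\<^bsub>qbar_ring\<^esub> x = - x"
  by (rule qbar.minus_equality) auto

lemma qbar_ring_m_inv: "x \<noteq> 0 \<Longrightarrow> inv\<^bsub>qbar_ring\<^esub> x = inverse x"
  by (rule qbar.comm_inv_char) auto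

text \<open>Because \<open>inverse 0 = 0\<close>, closure under inverses can be required of every
  element, zero included. Zero, negatives and sums come from differences.\<close>

lemma subfield_qbar_iff:
  "subfield F qbar_ring \<longleftrightarrow> 1 \<in> F \<and> (\<forall>x\<in>F. \<forall>y\<in>F. x - y \<in> F \<and> x * y \<in> F) \<and> (\<forall>x\<in>F. inverse x \<in> F)"
proof
  assume F: "subfield F qbar_ring"
  note R = subringE[OF subfieldE(1)[OF F], simplified]
  have "x - y \<in> F" if "x \<in> F" "y \<in> F" for x y
    using R(7)[OF that(1) R(5)[OF that(2)]] by simp
  moreover have "inverse x \<in> F" if "x \<in> F" for x
  proof (cases "x = 0")
    case False
    thus ?thesis using qbar.subfield_m_inv(1)[OF F, of x] that by (simp add: qbar_ring_m_inv)
  qed (use R in simp)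
  ultimately show "1 \<in> F \<and> (\<forall>x\<in>F. \<forall>y\<in>F. x - y \<in> F \<and> x * y \<in> F) \<and> (\<forall>x\<in>F. inverse x \<in> F)"
    using R(3,6) by (intro conjI ballI) simp_all
next
  assume F: "1 \<in> F \<and> (\<forall>x\<in>F. \<forall>y\<in>F. x - y \<in> F \<and> x * y \<in> F) \<and> (\<forall>x\<in>F. inverse x \<in> F)"
  hence d: "x - y \<in> F" "x * y \<in> F" if "x \<in> F" "y \<in> F" for x y using that by blast+
  have z: "0 \<in> F" using d(1)[of 1 1] F by simp
  have n: "- x \<in> F" if "x \<in> F" for x using d(1)[OF z that] by simp
  have a: "x + y \<in> F" if "x \<in> F" "y \<in> F" for x y using d(1)[OF that(1) n[OF that(2)]] by simp
  have "subring F qbar_ring"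
    by (rule qbar.subringI) (use F d n a in auto)
  thus "subfield F qbar_ring"
    by (rule field.subfieldI'[OF field_from_type_algebra]) (use F in \<open>auto simp: qbar_ring_m_inv\<close>)
qed

lemma subfield_qbarD:
  assumes "subfield F qbar_ring"
  shows "0 \<in> F" "1 \<in> F" "x \<in> F \<Longrightarrow> y \<in> F \<Longrightarrow> x - y \<in> F" "x \<in> F \<Longrightarrow> y \<in> F \<Longrightarrow> x * y \<in> F"
    "x \<in> F \<Longrightarrow> inverse x \<in> F" "x \<in> F \<Longrightarrow> - x \<in> F" "x \<in> F \<Longrightarrow> y \<in> F \<Longrightarrow> x + y \<in> F" "\<rat> \<subseteq> F"
    "x \<in> F \<Longrightarrow> y \<in> F \<Longrightarrow> x / y \<in> F"
proof -
  have F: "1 \<in> F" "\<And>x y. x \<in> F \<Longrightarrow> y \<in> F \<Longrightarrow> x - y \<in> F" "\<And>x y. x \<in> F \<Longrightarrow> y \<in> F \<Longrightarrow> x * y \<in> F"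
    "\<And>x. x \<in> F \<Longrightarrow> inverse x \<in> F"
    using assms unfolding subfield_qbar_iff by simp_all
  have z: "0 \<in> F" using F(2)[of 1 1] F(1) by simp
  have n: "- x \<in> F" if "x \<in> F" for x using F(2)[OF z that] by simp
  have a: "x + y \<in> F" if "x \<in> F" "y \<in> F" for x y using F(2)[OF that(1) n[OF that(2)]] by simp
  have nat: "of_nat k \<in> F" for k by (induction k) (auto simp: z F(1) a)
  have int: "of_int k \<in> F" for k
    using nat[of "nat k"] n[OF nat[of "nat (- k)"]] by (cases "k \<ge> 0") auto
  have div: "x / y \<in> F" if "x \<in> F" "y \<in> F" for x y
    using F(3)[OF that(1) F(4)[OF that(2)]] by (simp add: divide_inverse)
  have "of_rat r \<in> F" for r
    by (cases r) (simp add: of_rat_rat div int)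
  thus "\<rat> \<subseteq> F" by (auto elim!: Rats_cases)
  show "0 \<in> F" "1 \<in> F" "x \<in> F \<Longrightarrow> y \<in> F \<Longrightarrow> x - y \<in> F" "x \<in> F \<Longrightarrow> y \<in> F \<Longrightarrow> x * y \<in> F"
    "x \<in> F \<Longrightarrow> inverse x \<in> F" "x \<in> F \<Longrightarrow> - x \<in> F" "x \<in> F \<Longrightarrow> y \<in> F \<Longrightarrow> x + y \<in> F"
    "x \<in> F \<Longrightarrow> y \<in> F \<Longrightarrow> x / y \<in> F"
    by (fact z F n a div)+
qed

lemma line_extension_qbar: "qbar.line_extension K a E = {k * a + v |k v. k \<in> K \<and> v \<in> E}"
  using qbar.line_extension_mem_iff[of _ K a E] by auto

lemma quadratic_field_basis:
  assumes "quadratic_field K"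
  obtains s where "s \<in> K" "s \<notin> \<rat>"
    "\<And>x. x \<in> K \<longleftrightarrow> (\<exists>a b. a \<in> \<rat> \<and> b \<in> \<rat> \<and> x = a + b * s)"
proof -
  have K: "subfield K qbar_ring" and "qbar.dimension 2 \<rat> K"
    using assms by (auto simp: quadratic_field_def)
  note SK = subfield_qbarD[OF K]
  from \<open>qbar.dimension 2 \<rat> K\<close> obtain v E1 where v: "v \<notin> E1" "K = qbar.line_extension \<rat> v E1"
    and "qbar.dimension 1 \<rat> E1"
    by (cases rule: qbar.dimension.cases) (auto simp: numeral_2_eq_2)
  then obtain w where w: "w \<noteq> 0" "E1 = qbar.line_extension \<rat> w {0}"
    by (auto elim!: qbar.dimension.cases[of 1])
      (metis One_nat_def empty_iff insert_iff qbar.dimension.cases Zero_not_Suc nat.inject qbar_ring_simps(4))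
  have E1: "E1 = {k * w |k. k \<in> \<rat>}"
    unfolding w(2) line_extension_qbar by auto
  have Kvw: "K = {k * v + j * w |k j. k \<in> \<rat> \<and> j \<in> \<rat>}"
    unfolding v(2) line_extension_qbar E1 by blast
  have K_iff: "x \<in> K \<longleftrightarrow> (\<exists>k j. k \<in> \<rat> \<and> j \<in> \<rat> \<and> x = k * v + j * w)" for x
    unfolding Kvw by auto
  obtain a b where ab: "a \<in> \<rat>" "b \<in> \<rat>" "1 = a * v + b * w"
    using iffD1[OF K_iff SK(2)] by (elim exE conjE) (rule that)
  have vK: "v \<in> K" unfolding K_iff by (intro exI[of _ 1] exI[of _ 0]) simp
  have wK: "w \<in> K" unfolding K_iff by (intro exI[of _ 1] exI[of _ 0]) simp
  have mixed: "q + r * u \<in> K" if "q \<in> \<rat>" "r \<in> \<rat>" "u \<in> K" for q r u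
    using that SK(8) by (intro SK) auto
  show ?thesis
  \<comment> \<open>Exchange argument: 1 replaces \<open>w\<close> if \<open>a = 0\<close> and
    \<open>v\<close> otherwise, and the remaining basis vector becomes the irrational
    generator.\<close>
  proof (cases "a = 0")
    case True
    hence b: "b \<noteq> 0" "w = 1 / b" using ab(3) by (auto simp: eq_divide_eq mult.commute)
    have "v \<notin> \<rat>"
    proof
      assume "v \<in> \<rat>"
      hence "v \<in> E1" unfolding E1 using b ab(2) by (intro CollectI exI[of _ "v * b"]) auto
      thus False using v(1) by simp
    qed
    moreover have "x \<in> K \<longleftrightarrow> (\<exists>q r. q \<in> \<rat> \<and> r \<in> \<rat> \<and> x = q + r * v)" for x
    proof
      assume "x \<in> K"
      then obtain k j where "x = k * v + j * w" "k \<in> \<rat>" "j \<in> \<rat>" unfolding K_iff by metis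
      hence "j / b \<in> \<rat> \<and> k \<in> \<rat> \<and> x = j / b + k * v" using b ab(2) by auto
      thus "\<exists>q r. q \<in> \<rat> \<and> r \<in> \<rat> \<and> x = q + r * v" by (intro exI)
    qed (use mixed vK in auto)
    ultimately show ?thesis using vK by (intro that)
  next
    case False
    hence va: "v = 1 / a - b / a * w" using ab(3) by (simp add: field_simps)
    have "w \<notin> \<rat>"
    proof
      assume wr: "w \<in> \<rat>"
      hence "v \<in> \<rat>" unfolding va using ab by auto
      hence "v \<in> E1" unfolding E1 using w(1) wr by (intro CollectI exI[of _ "v / w"]) auto
      thus False using v(1) by simp
    qed
    moreover have "x \<in> K \<longleftrightarrow> (\<exists>q r. q \<in> \<rat> \<and> r \<in> \<rat> \<and> x = q + r * w)" for x
    proof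
      assume "x \<in> K"
      then obtain k j where x: "x = k * v + j * w" "k \<in> \<rat>" "j \<in> \<rat>" unfolding K_iff by metis
      have "x = k / a + (j - k * (b / a)) * w" unfolding x(1) va by (simp add: algebra_simps)
      moreover have "k / a \<in> \<rat>" "j - k * (b / a) \<in> \<rat>" using x ab by auto
      ultimately show "\<exists>q r. q \<in> \<rat> \<and> r \<in> \<rat> \<and> x = q + r * w" by (intro exI conjI)
    qed (use mixed wK in auto)
    ultimately show ?thesis using wK by (intro that)
  qed
qed

section \<open>Automorphism groups of subfields\<close>

lemma gal_group_carrier:
  "\<sigma> \<in> carrier (gal_group F) \<longleftrightarrow> \<sigma> \<in> extensional F \<and> bij_betw \<sigma> F F \<and> \<sigma> 1 = 1 \<and>
     (\<forall>x\<in>F. \<forall>y\<in>F. \<sigma> (x + y) = \<sigma> x + \<sigma> y \<and> \<sigma> (x * y) = \<sigma> x * \<sigma> y)"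
  unfolding gal_group_def Bij_def ring_hom_def by (auto simp: bij_betwE)

lemma gal_group_one: "\<one>\<^bsub>gal_group F\<^esub> = (\<lambda>x\<in>F. x)"
  by (simp add: gal_group_def BijGroup_def)

lemma gal_group_mult:
  assumes "\<sigma> \<in> carrier (gal_group F)" "\<rho> \<in> carrier (gal_group F)"
  shows "\<sigma> \<otimes>\<^bsub>gal_group F\<^esub> \<rho> = compose F \<sigma> \<rho>"
  using assms by (simp add: gal_group_def BijGroup_def)

text \<open>Elements of \<open>gal_group\<close> are just ring automorphisms. That they fix the
  rationals, as \<open>embedding_graph\<close> demands, is derived from naturals via integers to
  fractions.\<close>

lemma gal_group_extends:
  assumes F: "subfield F qbar_ring" and \<sigma>: "\<sigma> \<in> carrier (gal_group F)"
  obtains \<tau> where "qbar_aut \<tau>" "\<And>x. x \<in> F \<Longrightarrow> \<tau> x = \<sigma> x"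
proof -
  note SF = subfield_qbarD[OF F]
  have hom: "\<sigma> (x + y) = \<sigma> x + \<sigma> y" "\<sigma> (x * y) = \<sigma> x * \<sigma> y" if "x \<in> F" "y \<in> F" for x y
    using \<sigma> that unfolding gal_group_carrier by blast+
  have one: "\<sigma> 1 = 1" using \<sigma> unfolding gal_group_carrier by blast
  interpret subring_hom F \<sigma>
    by unfold_locales (simp_all add: SF hom one)
  have nat: "\<sigma> (of_nat k) = of_nat k" for k
  proof (induction k)
    case (Suc k)
    have "of_nat k \<in> F" using SF(8) by auto
    thus ?case using Suc by (simp add: hom(1) one SF(2))
  qed (simp add: hom_zero)
  have int: "\<sigma> (of_int k) = of_int k" for k
  proof (cases "k \<ge> 0")
    case False
    have "of_nat (nat (- k)) \<in> F" using SF(8) by auto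
    from hom_uminus[OF this] show ?thesis using nat[of "nat (- k)"] False by simp
  qed (use nat[of "nat k"] in simp)
  have rat: "\<sigma> (of_rat r) = of_rat r" for r
  proof (cases r)
    case (Fract a b)
    have mem: "of_int a / of_int b \<in> F" "of_int b \<in> F" using SF(8) by auto
    have "\<sigma> (of_int a / of_int b * of_int b) = \<sigma> (of_int a / of_int b) * \<sigma> (of_int b)"
      by (rule hom(2)[OF mem])
    hence "\<sigma> (of_int a / of_int b) = of_int a / of_int b"
      using Fract by (simp add: int eq_divide_eq)
    thus ?thesis using Fract by (simp add: of_rat_rat)
  qed
  have inj: "inj_on \<sigma> F" using \<sigma> unfolding gal_group_carrier by (blast dest: bij_betw_imp_inj_on)
  define G where "G = {(x, \<sigma> x) |x. x \<in> F}"
  have "embedding_graph G"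
    unfolding embedding_graph_def
  proof (intro conjI allI impI)
    show "(of_rat r, of_rat r) \<in> G" for r
      using SF(8) by (auto simp: G_def rat)
    show "y = 0" if "(0, y) \<in> G" for y
      using that by (auto simp: G_def hom_zero)
    fix x x' y y' assume "(x, x') \<in> G" "(y, y') \<in> G"
    thus "(x - y, x' - y') \<in> G" "(x * y, x' * y') \<in> G"
      by (auto simp: G_def hom_diff hom(2) SF)
  qed
  then obtain \<tau> where "qbar_aut \<tau>" "\<And>x y. (x, y) \<in> G \<Longrightarrow> \<tau> x = y"
    by (rule embedding_extends) blast
  thus ?thesis by (intro that[of \<tau>]) (auto simp: G_def)
qed

lemma restrict_gal_group:
  assumes "qbar_aut \<tau>" "\<And>x. x \<in> F \<Longrightarrow> \<tau> x \<in> F" "\<And>x. x \<in> F \<Longrightarrow> inv_into UNIV \<tau> x \<in> F"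
    and F: "subfield F qbar_ring"
  shows "restrict \<tau> F \<in> carrier (gal_group F)"
proof -
  interpret qbar_aut \<tau> by fact
  have "bij_betw (restrict \<tau> F) F F"
    by (rule bij_betw_byWitness[where f' = "inv_into UNIV \<tau>"]) (use assms(2,3) in auto)
  thus ?thesis
    unfolding gal_group_carrier using subfield_qbarD[OF F] by (auto simp: add mult one)
qed

lemma klein_four_iso:
  assumes carrier: "carrier G = {e, a, b, c}" and distinct: "distinct [e, a, b, c]"
    and mult: "e \<otimes>\<^bsub>G\<^esub> e = e" "e \<otimes>\<^bsub>G\<^esub> a = a" "e \<otimes>\<^bsub>G\<^esub> b = b" "e \<otimes>\<^bsub>G\<^esub> c = c"
      "a \<otimes>\<^bsub>G\<^esub> e = a" "a \<otimes>\<^bsub>G\<^esub> a = e" "a \<otimes>\<^bsub>G\<^esub> b = c" "a \<otimes>\<^bsub>G\<^esub> c = b"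
      "b \<otimes>\<^bsub>G\<^esub> e = b" "b \<otimes>\<^bsub>G\<^esub> a = c" "b \<otimes>\<^bsub>G\<^esub> b = e" "b \<otimes>\<^bsub>G\<^esub> c = a"
      "c \<otimes>\<^bsub>G\<^esub> e = c" "c \<otimes>\<^bsub>G\<^esub> a = b" "c \<otimes>\<^bsub>G\<^esub> b = a" "c \<otimes>\<^bsub>G\<^esub> c = e"
  shows "G \<cong> integer_mod_group 2 \<times>\<times> integer_mod_group 2"
proof -
  let ?Z = "integer_mod_group 2 \<times>\<times> integer_mod_group 2"
  define f :: "_ \<Rightarrow> int \<times> int" where
    "f x = (if x = e then (0, 0) else if x = a then (1, 0) else if x = b then (0, 1) else (1, 1))" for x
  have f: "f e = (0, 0)" "f a = (1, 0)" "f b = (0, 1)" "f c = (1, 1)"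
    using distinct by (auto simp: f_def)
  have Z: "carrier ?Z = {(0, 0), (1, 0), (0, 1), (1, 1)}"
  proof -
    have "{0..<int 2} = {0, 1}" by auto
    thus ?thesis by (auto simp: DirProd_def carrier_integer_mod_group)
  qed
  have "f \<in> hom G ?Z"
    unfolding hom_def carrier Z by (auto simp: mult f mult_DirProd)
  moreover have "bij_betw f (carrier G) (carrier ?Z)"
    unfolding bij_betw_def carrier Z using distinct by (auto simp: f inj_on_def)
  ultimately show ?thesis by (auto simp: is_iso_def iso_def)
qed

section \<open>The biquadratic field\<close>

lemma qbar_aut_id: "qbar_aut (\<lambda>x. x)"
  by unfold_locales (auto simp: bij_def)

text \<open>\<open>t\<close> is the trace of \<open>s\<close> and -d its norm, so
  \<open>t - s\<close> is the conjugate of \<open>s\<close>. With a general trace any irrational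
  \<open>s\<close> in \<open>K\<close> can serve as generator.\<close>

locale quadratic_basis =
  fixes K :: "qbar set" and s t d :: qbar
  assumes K: "quadratic_field K"
    and sK: "s \<in> K" and s_irrat: "s \<notin> \<rat>"
    and K_iff: "x \<in> K \<longleftrightarrow> (\<exists>a b. a \<in> \<rat> \<and> b \<in> \<rat> \<and> x = a + b * s)"
    and td: "t \<in> \<rat>" "d \<in> \<rat>" and s_sq: "s * s = t * s + d"
begin

lemma K_subfield: "subfield K qbar_ring"
  using K by (simp add: quadratic_field_def)

lemmas SK = subfield_qbarD[OF K_subfield]

lemma K_E:
  assumes "x \<in> K"
  obtains a b where "a \<in> \<rat>" "b \<in> \<rat>" "x = a + b * s"
  using iffD1[OF K_iff assms] by metis

lemma aut_on_K:
  assumes "qbar_aut A" "qbar_aut B" "A s = B s" "x \<in> K"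
  shows "A x = B x"
proof -
  interpret A: qbar_aut A by fact
  interpret B: qbar_aut B by fact
  obtain a b where "a \<in> \<rat>" "b \<in> \<rat>" "x = a + b * s" by (rule K_E[OF assms(4)])
  thus ?thesis using assms(3) by (simp add: A.add A.mult B.add B.mult A.rat_fixed B.rat_fixed)
qed

lemma aut_s:
  assumes "qbar_aut A"
  shows "A s = s \<or> A s = t - s"
proof -
  interpret A: qbar_aut A by fact
  have "A (s * s) = A (t * s + d)" by (simp only: s_sq)
  hence "A s * A s = t * A s + d" by (simp add: A.mult A.add A.rat_fixed td)
  hence "(A s - s) * (A s - (t - s)) = 0" using s_sq by Groebner_Basis.algebra
  thus ?thesis by simp
qed

end

lemma quadratic_basis_exists:
  assumes "quadratic_field K"
  obtains s t d where "quadratic_basis K s t d"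
proof -
  have "subfield K qbar_ring" using assms by (simp add: quadratic_field_def)
  note SK = subfield_qbarD[OF this]
  obtain s where s: "s \<in> K" "s \<notin> \<rat>"
    and K_iff: "\<And>x. x \<in> K \<longleftrightarrow> (\<exists>a b. a \<in> \<rat> \<and> b \<in> \<rat> \<and> x = a + b * s)"
    by (rule quadratic_field_basis[OF assms]) blast
  obtain d t where "d \<in> \<rat>" "t \<in> \<rat>" "s * s = d + t * s"
    using iffD1[OF K_iff SK(4)[OF s(1) s(1)]] by metis
  hence "quadratic_basis K s t d"
    using assms s K_iff by (intro quadratic_basis.intro) auto
  thus ?thesis by (rule that)
qed

text \<open>\<open>N\<close> lifts the nontrivial automorphism of \<open>K\<close>, and
  \<open>T\<close> is an automorphism over \<open>K\<close> that moves \<open>l\<close>. The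
  relation \<open>l * N l = n\<close> puts the conjugate \<open>N l\<close> back into K(l), which is
  what makes that field stable under all automorphisms.\<close>

locale biquadratic =
  N: qbar_aut N + T: qbar_aut T + quadratic_basis K s t d
    for N T :: "qbar \<Rightarrow> qbar" and K s t d +
  fixes l n :: qbar
  assumes Ns: "N s = t - s" and T_K: "x \<in> K \<Longrightarrow> T x = x"
    and lK: "l \<notin> K" and l2: "l * l \<in> K" and Tl: "T l = - l"
    and n: "n \<in> \<rat>" and Nl: "l * N l = n"
begin

lemma l_nz: "l \<noteq> 0"
  using lK SK(1) by auto

definition M :: "qbar set" where
  "M = {u + v * l |u v. u \<in> K \<and> v \<in> K}"

lemma M_iff: "x \<in> M \<longleftrightarrow> (\<exists>u v. u \<in> K \<and> v \<in> K \<and> x = u + v * l)"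
  unfolding M_def by auto

lemma M_intro: "u \<in> K \<Longrightarrow> v \<in> K \<Longrightarrow> u + v * l \<in> M"
  unfolding M_iff by (intro exI conjI) auto

lemma K_M: "x \<in> K \<Longrightarrow> x \<in> M"
  using M_intro[of x 0] SK(1) by simp

lemma l_M: "l \<in> M"
  using M_intro[of 0 1] SK(1,2) by simp

lemma coords_zero:
  assumes "u \<in> K" "v \<in> K" "u + v * l = 0"
  shows "u = 0 \<and> v = 0"
proof -
  have "v = 0"
  proof (rule ccontr)
    assume "v \<noteq> 0"
    have "l * v = - u" using assms(3) by (simp add: eq_neg_iff_add_eq_0 add.commute mult.commute)
    hence "l = - u / v" by (rule nonzero_eq_divide_eq[OF \<open>v \<noteq> 0\<close>, THEN iffD2])
    thus False using lK SK(9)[OF SK(6)[OF assms(1)] assms(2)] by simp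
  qed
  thus ?thesis using assms(3) by simp
qed

lemma M_subfield: "subfield M qbar_ring"
  unfolding subfield_qbar_iff
proof (intro conjI ballI)
  show "1 \<in> M" by (rule K_M) (rule SK)
next
  fix x y assume "x \<in> M" "y \<in> M"
  then obtain u v u' v' where xy: "u \<in> K" "v \<in> K" "x = u + v * l" "u' \<in> K" "v' \<in> K" "y = u' + v' * l"
    unfolding M_iff by metis
  have "x - y = (u - u') + (v - v') * l" by (simp add: xy algebra_simps)
  moreover have "(u - u') + (v - v') * l \<in> M" by (intro M_intro SK(3) xy)
  ultimately show "x - y \<in> M" by (simp only:)
  have "x * y = (u * u' + v * v' * (l * l)) + (u * v' + v * u') * l" by (simp add: xy algebra_simps)
  moreover have "u * u' + v * v' * (l * l) \<in> K" "u * v' + v * u' \<in> K"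
    using SK(7)[OF SK(4)[OF xy(1,4)] SK(4)[OF SK(4)[OF xy(2,5)] l2]]
      SK(7)[OF SK(4)[OF xy(1,5)] SK(4)[OF xy(2,4)]] .
  ultimately show "x * y \<in> M" using M_intro by simp
next
  fix x assume "x \<in> M"
  then obtain u v where x: "u \<in> K" "v \<in> K" "x = u + v * l" unfolding M_iff by metis
  show "inverse x \<in> M"
  proof (cases "x = 0")
    case False
    \<comment> \<open>The norm of \<open>x\<close> from K(l) to \<open>K\<close>. Its second factor
      u - v * l is nonzero because 1 and \<open>l\<close> are independent over
      \<open>K\<close>.\<close>
    define D where "D = u * u - v * v * (l * l)"
    have D: "D = x * (u + (- v) * l)" by (simp add: D_def x algebra_simps)
    have "D \<noteq> 0"
      using coords_zero[OF x(1) SK(6)[OF x(2)]] x False unfolding D by auto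
    have "D \<in> K" 
      unfolding D_def by (rule SK(3)[OF SK(4)[OF x(1,1)] SK(4)[OF SK(4)[OF x(2,2)] l2]])
    have "u / D + (- v / D) * l = (u + (- v) * l) / D"
      by (simp add: add_divide_distrib diff_divide_distrib)
    hence "x * (u / D + (- v / D) * l) = x * (u + (- v) * l) / D" by simp
    also have "\<dots> = 1" using \<open>D \<noteq> 0\<close> unfolding D[symmetric] by simp
    finally have "x * (u / D + (- v / D) * l) = 1" .
    hence "inverse x = u / D + (- v / D) * l" by (rule inverse_unique)
    moreover have "u / D + (- v / D) * l \<in> M"
      by (rule M_intro[OF SK(9)[OF x(1) \<open>D \<in> K\<close>] SK(9)[OF SK(6)[OF x(2)] \<open>D \<in> K\<close>]])
    ultimately show ?thesis by (simp only:)
  qed (simp add: K_M SK(1))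
qed

text \<open>The rational \<open>m\<close> will be the scalar of the isogeny chosen for the identity
  of \<open>K\<close>; it does not enlarge the field.\<close>

lemma M_generate:
  assumes "m \<in> \<rat>"
  shows "generate_field qbar_ring (K \<union> {m, l}) = M"
proof
  show "generate_field qbar_ring (K \<union> {m, l}) \<subseteq> M"
    by (rule field.generate_field_min_subfield1[OF field_from_type_algebra])
      (use assms SK(8) K_M l_M M_subfield in auto)
  show "M \<subseteq> generate_field qbar_ring (K \<union> {m, l})"
  proof
    fix x assume "x \<in> M"
    then obtain u v where x: "u \<in> K" "v \<in> K" "x = u + v * l" unfolding M_iff by metis
    have *: "subfield (generate_field qbar_ring (K \<union> {m, l})) qbar_ring"
      by (rule field.generate_field_is_subfield[OF field_from_type_algebra]) simp
    have "u \<in> generate_field qbar_ring (K \<union> {m, l})" "v \<in> generate_field qbar_ring (K \<union> {m, l})"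
      "l \<in> generate_field qbar_ring (K \<union> {m, l})"
      using x by (auto intro: generate_field.incl)
    thus "x \<in> generate_field qbar_ring (K \<union> {m, l})"
      unfolding x(3) by (intro subfield_qbarD[OF *])
  qed
qed

lemma M_dimension: "qbar.dimension 4 \<rat> M"
proof -
  have "qbar.dimension 2 \<rat> K"
    using K by (simp add: quadratic_field_def)
  hence 3: "qbar.dimension (Suc 2) \<rat> (qbar.line_extension \<rat> l K)"
    by (intro qbar.Suc_dim) (simp_all add: lK)
  have s0: "s \<noteq> 0" using s_irrat by auto
  have "s * l \<notin> qbar.line_extension \<rat> l K"
  proof
    assume "s * l \<in> qbar.line_extension \<rat> l K"
    then obtain k v where kv: "s * l = k * l + v" "k \<in> \<rat>" "v \<in> K"
      unfolding line_extension_qbar by blast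
    have "- v + (s - k) * l = 0" using kv(1) by (simp add: algebra_simps)
    moreover have "- v \<in> K" "s - k \<in> K" using kv SK sK by auto
    ultimately have "s - k = 0" using coords_zero by blast
    thus False using kv(2) s_irrat by simp
  qed
  from qbar.Suc_dim[OF _ this 3]
  have "qbar.dimension 4 \<rat> (qbar.line_extension \<rat> (s * l) (qbar.line_extension \<rat> l K))"
    by (simp add: eval_nat_numeral)
  also have "qbar.line_extension \<rat> (s * l) (qbar.line_extension \<rat> l K) = M"
  proof (intro subset_antisym subsetI)
    fix x assume "x \<in> qbar.line_extension \<rat> (s * l) (qbar.line_extension \<rat> l K)"
    then obtain b a u where "x = b * (s * l) + (a * l + u)" "b \<in> \<rat>" "a \<in> \<rat>" "u \<in> K"
      unfolding line_extension_qbar by blast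
    hence "x = u + (a + b * s) * l" "a + b * s \<in> K" "u \<in> K"
      by (auto simp: algebra_simps K_iff)
    thus "x \<in> M" using M_intro by simp
  next
    fix x assume "x \<in> M"
    then obtain u v where x: "u \<in> K" "v \<in> K" "x = u + v * l" unfolding M_iff by metis
    obtain a b where v: "a \<in> \<rat>" "b \<in> \<rat>" "v = a + b * s" using K_E[OF x(2)] .
    have "x = b * (s * l) + (a * l + u)" by (simp add: x(3) v(3) algebra_simps)
    thus "x \<in> qbar.line_extension \<rat> (s * l) (qbar.line_extension \<rat> l K)"
      unfolding line_extension_qbar using v x(1) by blast
  qed
  finally show ?thesis .
qed

lemma aut_on_M:
  assumes "qbar_aut A" "qbar_aut B" "A s = B s" "A l = B l" "x \<in> M"
  shows "A x = B x"
proof -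
  interpret A: qbar_aut A by fact
  interpret B: qbar_aut B by fact
  obtain u v where "u \<in> K" "v \<in> K" "x = u + v * l" using assms(5) unfolding M_iff by metis
  thus ?thesis
    using aut_on_K[OF assms(1-3)] assms(4) by (simp add: A.add A.mult B.add B.mult)
qed

text \<open>The image of \<open>s\<close> determines an automorphism on \<open>K\<close>, and there
  it agrees with the identity or with \<open>N\<close>. As \<open>l * l\<close> lies in
  \<open>K\<close>, the square of the image of \<open>l\<close> is known, and only a sign is
  left.\<close>

lemma aut_cases:
  assumes "qbar_aut A"
  shows "A s = s \<and> A l = l \<or> A s = s \<and> A l = - l \<or> A s = t - s \<and> A l = N l \<or> A s = t - s \<and> A l = - N l"
proof -
  interpret A: qbar_aut A by fact
  from aut_s[OF assms] show ?thesis
  proof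
    assume As: "A s = s"
    have "A (l * l) = l * l" by (rule aut_on_K[OF assms qbar_aut_id As l2])
    hence "(A l - l) * (A l + l) = 0" by (simp add: A.mult algebra_simps)
    hence "A l = l \<or> A l = - l" by (simp only: mult_eq_0_iff eq_neg_iff_add_eq_0 right_minus_eq)
    thus ?thesis using As by blast
  next
    assume As: "A s = t - s"
    have "A (l * l) = N (l * l)"
      by (rule aut_on_K[OF assms N.qbar_aut_axioms _ l2]) (simp add: As Ns)
    hence "(A l - N l) * (A l + N l) = 0" by (simp add: A.mult N.mult algebra_simps)
    hence "A l = N l \<or> A l = - N l" by (simp only: mult_eq_0_iff eq_neg_iff_add_eq_0 right_minus_eq)
    thus ?thesis using As by blast
  qed
qed

lemma Nl_eq: "N l = n / (l * l) * l"
  using Nl l_nz by (simp add: field_simps)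

lemma Nl_M: "N l \<in> M"
proof -
  have "n / (l * l) \<in> K" using n SK(8) l2 by (intro SK(9)) auto
  hence "0 + n / (l * l) * l \<in> M" by (rule M_intro[OF SK(1)])
  thus ?thesis by (simp only: Nl_eq add_0)
qed

lemma aut_preserves_M:
  assumes "qbar_aut A" "x \<in> M"
  shows "A x \<in> M"
proof -
  interpret A: qbar_aut A by fact
  note SM = subfield_qbarD[OF M_subfield]
  have "s \<in> M" by (rule K_M) (rule sK)
  moreover have "t - s \<in> M" using td(1) SM(8) by (intro SM(3) \<open>s \<in> M\<close>) auto
  ultimately have As: "A s \<in> M" using aut_cases[OF assms(1)] by metis
  have Al: "A l \<in> M" using aut_cases[OF assms(1)] l_M Nl_M SM(6) by metis
  have AK: "A u \<in> M" if uK: "u \<in> K" for u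
  proof -
    obtain a b where u: "a \<in> \<rat>" "b \<in> \<rat>" "u = a + b * s" using K_E[OF uK] .
    have "A u = a + b * A s" using u by (simp add: A.add A.mult A.rat_fixed)
    thus ?thesis using SM(8) u As by (auto intro!: SM(4,7))
  qed
  obtain u v where "u \<in> K" "v \<in> K" "x = u + v * l" using assms(2) unfolding M_iff by metis
  thus ?thesis using AK Al by (auto simp: A.add A.mult intro!: SM(4,7))
qed

lemma restrict_M: "qbar_aut A \<Longrightarrow> restrict A M \<in> carrier (gal_group M)"
  by (rule restrict_gal_group)
    (auto intro: aut_preserves_M qbar_aut.inv_aut M_subfield)

lemma restrict_eq:
  assumes "qbar_aut A" "qbar_aut B" "A s = B s" "A l = B l"
  shows "restrict A M = restrict B M"
  by (rule restrict_ext) (rule aut_on_M[OF assms])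

lemma aut_comp: "qbar_aut A \<Longrightarrow> qbar_aut B \<Longrightarrow> qbar_aut (\<lambda>x. A (B x))"
  unfolding qbar_aut_def by (auto intro: bij_comp[unfolded comp_def])

text \<open>Automorphisms agreeing at \<open>s\<close> and \<open>l\<close> agree on
  \<open>M\<close>, so every product in the group is checked on these two generators.\<close>

lemma restrict_mult:
  assumes A: "qbar_aut A" and B: "qbar_aut B" and C: "qbar_aut C"
    and "A (B s) = C s" "A (B l) = C l"
  shows "restrict A M \<otimes>\<^bsub>gal_group M\<^esub> restrict B M = restrict C M"
proof -
  have "restrict A M \<otimes>\<^bsub>gal_group M\<^esub> restrict B M = compose M (restrict A M) (restrict B M)"
    by (rule gal_group_mult) (intro restrict_M A B)+
  also have "\<dots> = restrict (\<lambda>x. A (B x)) M"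
    unfolding compose_def using aut_preserves_M[OF B] by (auto simp: restrict_def)
  also have "\<dots> = restrict C M"
    by (rule restrict_eq[OF aut_comp[OF A B] C]) (use assms in auto)
  finally show ?thesis .
qed

lemma Ts: "T s = s"
  by (rule T_K) (rule sK)

lemma NNs: "N (N s) = s"
  unfolding Ns by (simp add: N.homs N.rat_fixed td Ns)

lemma NNl: "N (N l) = l"
proof -
  have "N l * N (N l) = N (l * N l)" by (rule N.mult[symmetric])
  also have "\<dots> = n" unfolding Nl by (rule N.rat_fixed[OF n])
  also have "n = N l * l" using Nl by (simp add: mult.commute)
  finally show ?thesis using l_nz by simp
qed

lemma TNl: "T (N l) = - N l"
proof -
  have "l * T (N l) = - T (l * N l)" by (simp add: T.mult Tl)
  also have "T (l * N l) = l * N l" unfolding Nl by (rule T.rat_fixed[OF n])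
  finally have "l * T (N l) = l * (- N l)" by simp
  thus ?thesis by (rule mult_left_cancel[OF l_nz, THEN iffD1])
qed

lemma TNs: "T (N s) = t - s"
  unfolding Ns by (rule T_K) (use td SK(8) sK in \<open>auto intro: SK(3)\<close>)

lemma s_ne: "t - s \<noteq> s"
proof
  assume "t - s = s"
  hence "s = t / 2" by (simp add: field_simps)
  moreover have "t / 2 \<in> \<rat>" using td by auto
  ultimately show False using s_irrat by metis
qed

lemma neg_ne: "x \<noteq> 0 \<Longrightarrow> - x \<noteq> x" for x :: qbar
  by (metis add.right_inverse mult_2 mult_eq_0_iff zero_neq_numeral)

lemma gal_group_M: "gal_group M \<cong> integer_mod_group 2 \<times>\<times> integer_mod_group 2"
proof (rule klein_four_iso)
  \<comment> \<open>The product of the two generators sends \<open>s\<close> to \<open>t - s\<close>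
    and \<open>l\<close> to \<open>- N l\<close>, the last of the four possibilities in
    \<open>aut_cases\<close>.\<close>
  define C where "C = (\<lambda>x. T (N x))"
  have aut: "qbar_aut (\<lambda>x. x)" "qbar_aut T" "qbar_aut N" "qbar_aut C"
    using qbar_aut_id T.qbar_aut_axioms N.qbar_aut_axioms
      aut_comp[OF T.qbar_aut_axioms N.qbar_aut_axioms] by (simp_all only: C_def)
  have Cs: "C s = t - s" and Cl: "C l = - N l"
    by (simp_all add: C_def TNs TNl)
  have vals: "T (t - s) = t - s" "N (t - s) = s" "C (t - s) = s" "N (- l) = - N l" "C (- l) = N l"
    "N (- N l) = - l" "T (- N l) = N l" "C (- N l) = l" "C (N l) = - l" "T (- l) = l"
  proof -
    show "T (t - s) = t - s" using TNs by (simp add: Ns)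
    show 1: "N (t - s) = s" using NNs by (simp add: Ns)
    show "C (t - s) = s" unfolding C_def 1 by (rule Ts)
    show "N (- l) = - N l" "N (- N l) = - l" by (simp_all add: N.hom_uminus NNl)
    thus "C (- l) = N l" "C (- N l) = l" "T (- N l) = N l" "T (- l) = l"
      by (simp_all add: C_def T.hom_uminus TNl Tl)
    show "C (N l) = - l" by (simp add: C_def NNl Tl)
  qed
  show "carrier (gal_group M) = {restrict (\<lambda>x. x) M, restrict T M, restrict N M, restrict C M}"
  proof (intro subset_antisym subsetI)
    fix \<sigma> assume \<sigma>: "\<sigma> \<in> carrier (gal_group M)"
    obtain A where A: "qbar_aut A" "\<And>x. x \<in> M \<Longrightarrow> A x = \<sigma> x"
      by (rule gal_group_extends[OF M_subfield \<sigma>]) blast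
    have "\<sigma> \<in> extensional M" using \<sigma> by (simp add: gal_group_carrier)
    hence "\<sigma> = restrict A M"
      using A(2) by (intro extensionalityI[of _ M]) (auto simp: restrict_def extensional_def)
    moreover have "restrict A M = restrict (\<lambda>x. x) M \<or> restrict A M = restrict T M \<or>
        restrict A M = restrict N M \<or> restrict A M = restrict C M"
      using aut_cases[OF A(1)] restrict_eq[OF A(1) aut(1)] restrict_eq[OF A(1) aut(2)]
        restrict_eq[OF A(1) aut(3)] restrict_eq[OF A(1) aut(4)]
      unfolding Ts Tl Ns Cs Cl by metis
    ultimately show "\<sigma> \<in> {restrict (\<lambda>x. x) M, restrict T M, restrict N M, restrict C M}"
      by blast
  qed (use restrict_M aut in auto)
  have sM: "s \<in> M" by (rule K_M) (rule sK)
  have "N l \<noteq> 0" using l_nz by simp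
  have ne: "restrict A M \<noteq> restrict B M" if "A s \<noteq> B s \<or> A l \<noteq> B l" for A B :: "qbar \<Rightarrow> qbar"
    using that sM l_M by (metis restrict_apply')
  have l1: "l \<noteq> - l" using neg_ne[OF l_nz] by metis
  have s1: "s \<noteq> t - s" using s_ne by metis
  have n1: "N l \<noteq> - N l" using neg_ne[OF \<open>N l \<noteq> 0\<close>] by metis
  have "restrict (\<lambda>x. x) M \<noteq> restrict T M" by (rule ne, unfold Tl) (use l1 in blast)
  moreover have "restrict (\<lambda>x. x) M \<noteq> restrict N M" by (rule ne, unfold Ns) (use s1 in blast)
  moreover have "restrict (\<lambda>x. x) M \<noteq> restrict C M" by (rule ne, unfold Cs) (use s1 in blast)
  moreover have "restrict T M \<noteq> restrict N M" by (rule ne, unfold Ts Ns) (use s1 in blast)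
  moreover have "restrict T M \<noteq> restrict C M" by (rule ne, unfold Ts Cs) (use s1 in blast)
  moreover have "restrict N M \<noteq> restrict C M" by (rule ne, unfold Cl) (use n1 in blast)
  ultimately show "distinct [restrict (\<lambda>x. x) M, restrict T M, restrict N M, restrict C M]"
    by simp
  note mult = restrict_mult[OF aut(1) aut(1) aut(1)] restrict_mult[OF aut(1) aut(2) aut(2)]
    restrict_mult[OF aut(1) aut(3) aut(3)] restrict_mult[OF aut(1) aut(4) aut(4)]
    restrict_mult[OF aut(2) aut(1) aut(2)] restrict_mult[OF aut(2) aut(2) aut(1)]
    restrict_mult[OF aut(2) aut(3) aut(4)] restrict_mult[OF aut(2) aut(4) aut(3)]
    restrict_mult[OF aut(3) aut(1) aut(3)] restrict_mult[OF aut(3) aut(2) aut(4)]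
    restrict_mult[OF aut(3) aut(3) aut(1)] restrict_mult[OF aut(3) aut(4) aut(2)]
    restrict_mult[OF aut(4) aut(1) aut(4)] restrict_mult[OF aut(4) aut(2) aut(3)]
    restrict_mult[OF aut(4) aut(3) aut(2)] restrict_mult[OF aut(4) aut(4) aut(1)]
  show "restrict (\<lambda>x. x) M \<otimes>\<^bsub>gal_group M\<^esub> restrict (\<lambda>x. x) M = restrict (\<lambda>x. x) M"
    "restrict (\<lambda>x. x) M \<otimes>\<^bsub>gal_group M\<^esub> restrict T M = restrict T M"
    "restrict (\<lambda>x. x) M \<otimes>\<^bsub>gal_group M\<^esub> restrict N M = restrict N M"
    "restrict (\<lambda>x. x) M \<otimes>\<^bsub>gal_group M\<^esub> restrict C M = restrict C M"
    "restrict T M \<otimes>\<^bsub>gal_group M\<^esub> restrict (\<lambda>x. x) M = restrict T M"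
    "restrict T M \<otimes>\<^bsub>gal_group M\<^esub> restrict T M = restrict (\<lambda>x. x) M"
    "restrict T M \<otimes>\<^bsub>gal_group M\<^esub> restrict N M = restrict C M"
    "restrict T M \<otimes>\<^bsub>gal_group M\<^esub> restrict C M = restrict N M"
    "restrict N M \<otimes>\<^bsub>gal_group M\<^esub> restrict (\<lambda>x. x) M = restrict N M"
    "restrict N M \<otimes>\<^bsub>gal_group M\<^esub> restrict T M = restrict C M"
    "restrict N M \<otimes>\<^bsub>gal_group M\<^esub> restrict N M = restrict (\<lambda>x. x) M"
    "restrict N M \<otimes>\<^bsub>gal_group M\<^esub> restrict C M = restrict T M"
    "restrict C M \<otimes>\<^bsub>gal_group M\<^esub> restrict (\<lambda>x. x) M = restrict C M"
    "restrict C M \<otimes>\<^bsub>gal_group M\<^esub> restrict T M = restrict N M"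
    "restrict C M \<otimes>\<^bsub>gal_group M\<^esub> restrict N M = restrict T M"
    "restrict C M \<otimes>\<^bsub>gal_group M\<^esub> restrict C M = restrict (\<lambda>x. x) M"
    by (rule mult; simp only: Ts Tl Ns Cs Cl NNl TNl TNs vals minus_minus)+
qed

lemma M_galois: "galois_number_field M"
proof -
  have "number_field M"
    unfolding number_field_def qbar.finite_dimension_def using M_subfield M_dimension by blast
  moreover have "{x \<in> M. \<forall>\<sigma>\<in>carrier (gal_group M). \<sigma> x = x} = \<rat>"
  proof (intro subset_antisym subsetI)
    fix x :: qbar assume "x \<in> \<rat>"
    have xM: "x \<in> M" using \<open>x \<in> \<rat>\<close> SK(8) by (intro K_M) auto
    have "\<sigma> x = x" if \<sigma>: "\<sigma> \<in> carrier (gal_group M)" for \<sigma>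
    proof -
      obtain A where "qbar_aut A" "\<And>x. x \<in> M \<Longrightarrow> A x = \<sigma> x"
        by (rule gal_group_extends[OF M_subfield \<sigma>]) blast
      thus ?thesis using qbar_aut.rat_fixed[of A x] \<open>x \<in> \<rat>\<close> xM by simp
    qed
    with xM show "x \<in> {x \<in> M. \<forall>\<sigma>\<in>carrier (gal_group M). \<sigma> x = x}" by simp
  next
    fix x assume "x \<in> {x \<in> M. \<forall>\<sigma>\<in>carrier (gal_group M). \<sigma> x = x}"
    hence x: "x \<in> M" and fixed: "\<And>\<sigma>. \<sigma> \<in> carrier (gal_group M) \<Longrightarrow> \<sigma> x = x" by auto
    \<comment> \<open>Two automorphisms suffice: invariance under \<open>T\<close> removes the
      component along \<open>l\<close>, and invariance under \<open>N\<close> then the one along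
      \<open>s\<close>.\<close>
    have Tx: "T x = x" and Nx: "N x = x"
      using fixed[OF restrict_M[OF T.qbar_aut_axioms]] fixed[OF restrict_M[OF N.qbar_aut_axioms]] x
      by simp_all
    obtain u v where uv: "u \<in> K" "v \<in> K" "x = u + v * l" using x unfolding M_iff by metis
    have "u + v * (- l) = u + v * l"
      using Tx uv by (simp add: T.add T.mult T_K Tl)
    hence "v = 0" using neg_ne[OF l_nz] by simp
    hence "x \<in> K" using uv by simp
    then obtain a b where ab: "a \<in> \<rat>" "b \<in> \<rat>" "x = a + b * s" by (rule K_E)
    have "a + b * (t - s) = a + b * s"
      using Nx ab by (simp add: N.add N.mult N.rat_fixed Ns)
    hence "b = 0" using s_ne by simp
    thus "x \<in> \<rat>" using ab by simp
  qed
  ultimately show ?thesis by (simp add: galois_number_field_def)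
qed

end

section \<open>The minimal field of complete definition\<close>

text \<open>Iterating \<tau> shows that all r^k * l are roots of one nonzero rational polynomial
  that vanishes at \<open>l\<close>. There are finitely many, so \<open>r\<close> is a rational root
  of unity, that is, 1 or -1.\<close>

lemma rational_multiple_conjugate:
  assumes "qbar_aut \<tau>" "l \<noteq> 0" "r \<in> \<rat>" "\<tau> l = r * l"
  shows "\<tau> l = l \<or> \<tau> l = - l"
proof -
  interpret qbar_aut \<tau> by fact
  obtain q where q: "r = of_rat q" using assms(3) by (rule Rats_cases)
  obtain p :: "qbar poly" where p: "p \<noteq> 0" "\<And>i. Polynomial.coeff p i \<in> \<rat>" "poly p l = 0"
    by (rule qbar_algebraic[of l]) blast
  have map_p: "map_poly \<tau> p = p" by (rule map_poly_rat) (rule p)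
  have root: "poly p (r ^ k * l) = 0" for k
  proof (induction k)
    case (Suc k)
    have "\<tau> (r ^ k * l) = r ^ Suc k * l"
      using assms(4) by (simp add: mult hom_power q of_rat mult_ac)
    moreover have "\<tau> (poly p (r ^ k * l)) = poly (map_poly \<tau> p) (\<tau> (r ^ k * l))"
      by (rule hom_poly) auto
    ultimately show ?case using Suc unfolding map_p by (simp add: hom_zero)
  qed (use p in simp)
  have "finite (range (\<lambda>k. r ^ k * l))"
    by (rule finite_subset[OF _ poly_roots_finite[OF p(1)]]) (use root in auto)
  hence "\<not> inj (\<lambda>k :: nat. r ^ k * l)"
    using finite_imageD[of "\<lambda>k :: nat. r ^ k * l" UNIV] infinite_UNIV_nat by blast
  then obtain i j :: nat where ij: "r ^ i * l = r ^ j * l" "i < j"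
    unfolding inj_def by (metis linorder_neqE_nat)
  have "r ^ i = r ^ j" using ij(1) assms(2) by simp
  have "r \<noteq> 0" using assms(2,4) by (metis eq_0_iff mult_zero_left)
  have "r ^ i * r ^ (j - i) = r ^ (i + (j - i))" by (simp only: power_add)
  also have "\<dots> = r ^ i * 1" using \<open>r ^ i = r ^ j\<close> ij(2) by simp
  finally have "r ^ i * r ^ (j - i) = r ^ i * 1" .
  hence "r ^ (j - i) = 1" using \<open>r \<noteq> 0\<close> by simp
  hence "of_rat (q ^ (j - i)) = (of_rat 1 :: qbar)" by (simp add: q of_rat_power)
  hence "q ^ (j - i) = 1" by (simp only: of_rat_eq_iff)
  hence "\<bar>q\<bar> ^ (j - i) = 1 ^ (j - i)" by (simp flip: power_abs)
  hence "\<bar>q\<bar> = 1" by (rule power_eq_imp_eq_base) (use ij(2) in auto)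
  hence "q = 1 \<or> q = - 1" by linarith
  thus ?thesis using assms(4) q by auto
qed

lemma conj_curve_fixed:
  assumes "\<tau> (coeff_a E) = coeff_a E" "\<tau> (coeff_b E) = coeff_b E"
  shows "conj_curve \<tau> E = E"
  using assms by (cases E) simp

text \<open>
  For \<open>\<phi>\<close> from the conjugate curve to \<open>E\<close> and \<open>\<psi> = N \<phi> N^-1\<close>, every composite \<open>\<chi> \<psi>\<close> is an
  endomorphism of \<open>E\<close>, hence multiplication by an integer.
\<close>
lemma scalar_norm:
  assumes cm: "\<not> has_CM E" and N: "qbar_aut N" "conj_curve N (conj_curve N E) = E"
    and \<phi>: "isogeny (conj_curve N E) E \<phi>" "isogeny_scalar (conj_curve N E) \<phi> l"
    and \<chi>: "isogeny (conj_curve N E) E \<chi>" "isogeny_scalar (conj_curve N E) \<chi> m"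
  shows "m * N l \<in> \<rat>"
proof -
  interpret qbar_aut N by fact
  have "isogeny E (conj_curve N E) (conj_map \<phi>)" "isogeny_scalar E (conj_map \<phi>) (N l)"
    using isogeny_conj[OF \<phi>(1)] isogeny_scalar_conj[OF \<phi>(2)] by (simp_all add: N(2))
  note comp = isogeny_compose[OF this(1) \<chi>(1) this(2) \<chi>(2)]
  obtain c :: int where "N l * m = of_int c"
    by (rule noCM_scalar[OF cm comp])
  thus ?thesis by (simp add: mult.commute)
qed

theorem lemma5p4:
  fixes K L :: "qbar set" and E :: "qbar weierstrass" and \<nu> :: "qbar \<Rightarrow> qbar"
  assumes "quadratic_field K"
    and "Q_curve K E"
    and "\<not> has_CM E"
    and "\<nu> \<in> carrier (gal_group K)" and "\<nu> \<noteq> \<one>\<^bsub>gal_group K\<^esub>"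
    and "\<exists>\<mu>. isogeny (conj_curve \<nu> E) E \<mu> \<and> \<not> isogeny_over K (conj_curve \<nu> E) E \<mu>"
    and "minimal_field_of_complete_definition K E L"
  shows "galois_number_field L \<and>
         gal_group L \<cong> integer_mod_group 2 \<times>\<times> integer_mod_group 2"
proof -
  obtain s t d where "quadratic_basis K s t d"
    by (rule quadratic_basis_exists[OF assms(1)])
  then interpret Q: quadratic_basis K s t d .
  note SK = Q.SK and subK = Q.K_subfield
  have EK: "coeff_a E \<in> K" "coeff_b E \<in> K"
    using assms(2) by (auto simp: Q_curve_def elliptic_curve_over_def)
  obtain N where N: "qbar_aut N" and N\<nu>: "\<And>x. x \<in> K \<Longrightarrow> N x = \<nu> x"
    by (rule gal_group_extends[OF subK assms(4)]) blast
  interpret N: qbar_aut N by fact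
  have ext: "\<sigma> = \<rho>" if "\<sigma> \<in> carrier (gal_group K)" "\<rho> \<in> carrier (gal_group K)"
    "\<And>x. x \<in> K \<Longrightarrow> \<sigma> x = \<rho> x" for \<sigma> \<rho>
    using that by (intro extensionalityI[of _ K]) (auto simp: gal_group_carrier)
  have one: "\<one>\<^bsub>gal_group K\<^esub> \<in> carrier (gal_group K)"
    unfolding gal_group_one by (rule restrict_gal_group[OF qbar_aut_id _ _ subK]) (auto simp: inv_into_def)
  have Ns_ne: "N s \<noteq> s"
  proof
    assume "N s = s"
    hence "N x = x" if "x \<in> K" for x using Q.aut_on_K[OF N qbar_aut_id] that by simp
    hence "\<nu> = \<one>\<^bsub>gal_group K\<^esub>"
      using ext[OF assms(4) one] N\<nu> by (simp add: gal_group_one)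
    thus False using assms(5) by simp
  qed
  have Ns: "N s = t - s" using Q.aut_s[OF N] Ns_ne by blast
  have NNs: "N (N s) = s" unfolding Ns by (simp add: N.hom_diff N.rat_fixed Q.td Ns)
  have NK: "N x \<in> K" if "x \<in> K" for x
    using that assms(4) N\<nu>[OF that] by (auto simp: gal_group_carrier dest: bij_betwE)
  have NN: "N (N x) = x" if xK: "x \<in> K" for x
  proof -
    obtain a b where "a \<in> \<rat>" "b \<in> \<rat>" "x = a + b * s" by (rule Q.K_E[OF xK])
    thus ?thesis by (simp add: N.add N.mult N.rat_fixed NNs)
  qed
  define E' where "E' = conj_curve N E"
  have E'\<nu>: "conj_curve \<nu> E = E'"
    unfolding E'_def using N\<nu> EK by (cases E) simp
  \<comment> \<open>\<open>N\<close> itself need not be an involution, but its square is the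
    identity on \<open>K\<close>, which contains the coefficients of the curve. So conjugating an
    isogeny from \<open>E'\<close> to \<open>E\<close> gives one from \<open>E\<close> to
    \<open>E'\<close>.\<close>
  have E'E: "conj_curve N E' = E"
    unfolding E'_def using NN EK by (cases E) simp
  have E'K: "coeff_a E' \<in> K" "coeff_b E' \<in> K"
    using NK EK by (simp_all add: E'_def weierstrass.map_sel)

  obtain \<mu> where \<mu>: "\<And>\<sigma>. \<sigma> \<in> carrier (gal_group K) \<Longrightarrow> isogeny (conj_curve \<sigma> E) E (\<mu> \<sigma>)"
    and L: "L = generate_field qbar_ring (K \<union>
      {l. \<exists>\<sigma>\<in>carrier (gal_group K). isogeny_scalar (conj_curve \<sigma> E) (\<mu> \<sigma>) l})"
    using assms(7) unfolding minimal_field_of_complete_definition_def by blast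
  define \<phi> where "\<phi> = \<mu> \<nu>"
  have \<phi>: "isogeny E' E \<phi>" using \<mu>[OF assms(4)] by (simp add: \<phi>_def E'\<nu>)
  obtain l where l: "l \<noteq> 0" "isogeny_scalar E' \<phi> l" "\<And>m. isogeny_scalar E' \<phi> m \<longleftrightarrow> m = l"
    by (rule isogeny_has_scalar[OF \<phi>]) blast
  have norm: "m * N l \<in> \<rat>" if "isogeny E' E \<chi>" "isogeny_scalar E' \<chi> m" for \<chi> m
    using scalar_norm[OF assms(3) N _ \<phi>[unfolded E'_def] l(2)[unfolded E'_def]] that E'E
    unfolding E'_def by blast
  have Nl_nz: "N l \<noteq> 0" using l(1) by simp
  have ratio: "m / l \<in> \<rat>" if "isogeny E' E \<chi>" "isogeny_scalar E' \<chi> m" for \<chi> m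
  proof -
    have "(m * N l) / (l * N l) \<in> \<rat>" by (intro Rats_divide norm[OF that] norm[OF \<phi> l(2)])
    thus ?thesis using Nl_nz by simp
  qed

  have fixed: "x \<in> K"
    if x: "\<And>\<tau>. qbar_aut \<tau> \<Longrightarrow> (\<And>k. k \<in> K \<Longrightarrow> \<tau> k = k) \<Longrightarrow> \<tau> x = x" for x
  proof (rule fixed_field)
    show "\<tau> x = x" if "qbar_aut \<tau>" "\<And>k. k \<in> K \<Longrightarrow> \<tau> k = k" for \<tau>
      using that by (rule x)
  qed (fact SK(8) | erule (1) SK(3) | erule (1) SK(4))+

  have lK: "l \<notin> K"
  proof
    assume "l \<in> K"
    \<comment> \<open>The isogeny that does not descend need not be the chosen
      \<open>\<phi>\<close>. Its scalar is a rational multiple of \<open>l\<close>, though, and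
      would lie in \<open>K\<close> together with \<open>l\<close>.\<close>
    obtain \<chi> where \<chi>: "isogeny E' E \<chi>" "\<not> isogeny_over K E' E \<chi>"
      using assms(6) unfolding E'\<nu> by blast
    obtain m where m: "isogeny_scalar E' \<chi> m"
      by (rule isogeny_has_scalar[OF \<chi>(1)]) blast
    have "m / l \<in> K" using ratio[OF \<chi>(1) m] SK(8) by auto
    hence "m / l * l \<in> K" using \<open>l \<in> K\<close> by (rule SK(4))
    hence "m \<in> K" using l(1) by simp
    have "isogeny_over K E' E \<chi>"
    proof (rule isogeny_descent[OF \<chi>(1) m \<open>m \<in> K\<close>])
      show "x \<in> K" if "\<And>\<tau>. qbar_aut \<tau> \<Longrightarrow> (\<And>k. k \<in> K \<Longrightarrow> \<tau> k = k) \<Longrightarrow> \<tau> x = x" for x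
        using that by (rule fixed)
    qed (fact SK(1) SK(2) E'K EK | erule (1) SK(3) | erule (1) SK(4) | erule SK(5))+
    thus False using \<chi>(2) by simp
  qed

  have fixing: "\<tau> l = l \<or> \<tau> l = - l" if \<tau>: "qbar_aut \<tau>" "\<And>k. k \<in> K \<Longrightarrow> \<tau> k = k" for \<tau>
  proof -
    interpret \<tau>: qbar_aut \<tau> by fact
    have c: "conj_curve \<tau> E' = E'" "conj_curve \<tau> E = E"
      by (rule conj_curve_fixed; rule \<tau>(2); fact E'K EK)+
    \<comment> \<open>Both curves are fixed by \<tau>, so the conjugate of \<open>\<phi>\<close> is
      again an isogeny from \<open>E'\<close> to \<open>E\<close> and \<open>ratio\<close> applies
      to its scalar \<open>\<tau> l\<close>.\<close>
    have "isogeny E' E (\<tau>.conj_map \<phi>)" "isogeny_scalar E' (\<tau>.conj_map \<phi>) (\<tau> l)"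
      using \<tau>.isogeny_conj[OF \<phi>] \<tau>.isogeny_scalar_conj[OF l(2)] unfolding c by simp_all
    hence "\<tau> l / l \<in> \<rat>" by (rule ratio)
    thus ?thesis
      by (rule rational_multiple_conjugate[OF \<tau>(1) l(1)]) (use l(1) in simp)
  qed
  have l2: "l * l \<in> K"
  proof (rule fixed)
    fix \<tau> assume \<tau>: "qbar_aut \<tau>" "\<And>k. k \<in> K \<Longrightarrow> \<tau> k = k"
    have "\<tau> (l * l) = \<tau> l * \<tau> l" by (rule qbar_aut.mult[OF \<tau>(1)])
    also have "\<dots> = l * l" using fixing[OF \<tau>] by auto
    finally show "\<tau> (l * l) = l * l" .
  qed
  have "\<exists>T. qbar_aut T \<and> (\<forall>k\<in>K. T k = k) \<and> T l \<noteq> l"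
    using fixed[of l] lK by blast
  then obtain T where T: "qbar_aut T" "\<And>k. k \<in> K \<Longrightarrow> T k = k" "T l \<noteq> l"
    by blast
  have Tl: "T l = - l" using fixing[OF T(1,2)] T(3) by blast

  interpret biquadratic N T K s t d l "l * N l"
  proof (intro biquadratic.intro N T(1) Q.quadratic_basis_axioms biquadratic_axioms.intro)
    show "l * N l \<in> \<rat>" by (rule norm[OF \<phi> l(2)])
  qed (use Ns T(2) lK l2 Tl in auto)

  have gal: "carrier (gal_group K) = {\<one>\<^bsub>gal_group K\<^esub>, \<nu>}"
  proof (intro subset_antisym subsetI)
    fix \<sigma> assume \<sigma>: "\<sigma> \<in> carrier (gal_group K)"
    obtain A where A: "qbar_aut A" "\<And>x. x \<in> K \<Longrightarrow> A x = \<sigma> x"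
      by (rule gal_group_extends[OF subK \<sigma>]) blast
    from Q.aut_s[OF A(1)] show "\<sigma> \<in> {\<one>\<^bsub>gal_group K\<^esub>, \<nu>}"
    proof
      assume "A s = s"
      hence "\<sigma> = \<one>\<^bsub>gal_group K\<^esub>"
        using Q.aut_on_K[OF A(1) qbar_aut_id] A(2) by (intro ext[OF \<sigma> one]) (auto simp: gal_group_one)
      thus ?thesis by simp
    next
      assume "A s = t - s"
      hence "\<sigma> x = \<nu> x" if "x \<in> K" for x
        using Q.aut_on_K[OF A(1) N _ that] A(2)[OF that] N\<nu>[OF that] Ns by simp
      hence "\<sigma> = \<nu>" by (rule ext[OF \<sigma> assms(4)])
      thus ?thesis by simp
    qed
  qed (use one assms(4) in auto)
  have E1: "conj_curve \<one>\<^bsub>gal_group K\<^esub> E = E"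
    by (rule conj_curve_fixed) (simp_all add: gal_group_one EK)
  \<comment> \<open>For the identity of \<open>K\<close> the family \<open>\<mu>\<close> may contain
    any isogeny from \<open>E\<close> to itself. Without complex multiplication its scalar is an
    integer, so only \<open>l\<close> contributes to the field.\<close>
  have "isogeny E E (\<mu> \<one>\<^bsub>gal_group K\<^esub>)"
    using \<mu>[OF one] unfolding E1 .
  then obtain m where m: "generic_scalar E (\<mu> \<one>\<^bsub>gal_group K\<^esub>) m"
    "\<And>k. isogeny_scalar E (\<mu> \<one>\<^bsub>gal_group K\<^esub>) k \<longleftrightarrow> k = m"
    by (rule isogeny_has_scalar) blast
  obtain c :: int where "m = of_int c"
    by (rule noCM_scalar[OF assms(3) \<open>isogeny E E _\<close> m(1)])
  hence "m \<in> \<rat>" by simp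
  have "{l. \<exists>\<sigma>\<in>carrier (gal_group K). isogeny_scalar (conj_curve \<sigma> E) (\<mu> \<sigma>) l} = {m, l}"
    unfolding gal using m(2) l(3) by (auto simp: E1 E'\<nu> \<phi>_def)
  hence "L = M"
    unfolding L using M_generate[OF \<open>m \<in> \<rat>\<close>] by simp
  thus ?thesis using M_galois gal_group_M by simp
qed

end
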